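(* For every constant $k$ and every $\epsilon>0$, Polytree Learning with in-degree bound $k$ (PT$_{\le}$) can be solved exactly in time $(2+\epsilon)^n\,|\mathcal{I}|^{\mathcal{O}(1)}$.
   Context: A DAG $D=(V,A)$ is a polytree if its skeleton is a forest; $D_v$ is the parent set of $v$. Polytree Learning: input is a node set $V$, $|V|=n$, and for each $v\in V$ a family $\mathcal{F}_v$ of potential parent sets with scores $f_v(S)\in\mathbb{R}$ for $S\in\mathcal{F}_v$ (non-zero encoding), where $f_v(S)=-\infty$ for $S\notin \mathcal{F}_v$, $\emptyset\in\mathcal{F}_v$ and $f_v(\emptyset)=0$. The score of $D$ is $f(D)=\sum_{v} f_v(D_v)$; the goal is a polytree of maximum score. PT$_{\le}$ is the variant in which it is guaranteed that every set in every $\mathcal{F}_v$ has size at most $k$. $|\mathcal{I}|$ is the input encoding length. *)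

theory Defs
  imports
    Complex_Main
    "HOL-Library.Extended_Real"
    "HOL-Library.Discrete_Functions"
begin

section \<open>Polytrees and their scores\<close>

definition skeleton :: "('a \<times> 'a) set \<Rightarrow> 'a set set" where
  "skeleton A = {{u, v} | u v. (u, v) \<in> A}"

definition undirected_cycle :: "'a set set \<Rightarrow> 'a list \<Rightarrow> bool" where
  "undirected_cycle E p \<longleftrightarrow>
     length p \<ge> 3 \<and> distinct p \<and>
     (\<forall>i < length p. {p ! i, p ! (Suc i mod length p)} \<in> E)"

definition forest :: "'a set set \<Rightarrow> bool" where
  "forest E \<longleftrightarrow> (\<nexists>p. undirected_cycle E p)"

definition polytree :: "'a set \<Rightarrow> ('a \<times> 'a) set \<Rightarrow> bool" where
  "polytree V A \<longleftrightarrow> A \<subseteq> V \<times> V \<and> acyclic A \<and> forest (skeleton A)"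

definition parents :: "('a \<times> 'a) set \<Rightarrow> 'a \<Rightarrow> 'a set" where
  "parents A v = {u. (u, v) \<in> A}"

definition local_score ::
    "('a \<Rightarrow> 'a set set) \<Rightarrow> ('a \<Rightarrow> 'a set \<Rightarrow> real) \<Rightarrow> 'a \<Rightarrow> 'a set \<Rightarrow> ereal" where
  "local_score F f v S = (if S \<in> F v then ereal (f v S) else -\<infinity>)"

definition score ::
    "'a set \<Rightarrow> ('a \<Rightarrow> 'a set set) \<Rightarrow> ('a \<Rightarrow> 'a set \<Rightarrow> real) \<Rightarrow> ('a \<times> 'a) set \<Rightarrow> ereal" where
  "score V F f A = (\<Sum>v\<in>V. local_score F f v (parents A v))"

definition optimal_polytree ::
    "'a set \<Rightarrow> ('a \<Rightarrow> 'a set set) \<Rightarrow> ('a \<Rightarrow> 'a set \<Rightarrow> real) \<Rightarrow> ('a \<times> 'a) set \<Rightarrow> bool" where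
  "optimal_polytree V F f A \<longleftrightarrow>
     polytree V A \<and> (\<forall>B. polytree V B \<longrightarrow> score V F f B \<le> score V F f A)"

definition polytree_instance ::
    "'a set \<Rightarrow> ('a \<Rightarrow> 'a set set) \<Rightarrow> ('a \<Rightarrow> 'a set \<Rightarrow> real) \<Rightarrow> bool" where
  "polytree_instance V F f \<longleftrightarrow>
     finite V \<and> (\<forall>v\<in>V. F v \<subseteq> Pow (V - {v}) \<and> {} \<in> F v \<and> f v {} = 0)"

definition indegree_bounded :: "nat \<Rightarrow> 'a set \<Rightarrow> ('a \<Rightarrow> 'a set set) \<Rightarrow> bool" where
  "indegree_bounded k V F \<longleftrightarrow> (\<forall>v\<in>V. \<forall>S\<in>F v. card S \<le> k)"


section \<open>Random access machines\<close>

text \<open>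
  The machine has registers and an indirectly addressed memory for natural numbers, and the
  same for real numbers. Operations on natural numbers are charged with logarithmic cost (the
  number of bits of the addresses and values involved). Real numbers can only be moved, added,
  subtracted and compared, each at unit cost; programs contain no real constants, and
  there is no conversion between the two sorts. A program halts when the program counter
  leaves it.
\<close>

datatype instr =
    Const nat nat
  | Add nat nat nat
  | Sub nat nat nat
  | Mul nat nat nat
  | Div nat nat nat
  | Load nat nat
  | Store nat nat
  | RAdd nat nat nat
  | RSub nat nat nat
  | RLoad nat nat
  | RStore nat nat
  | Jump nat
  | JumpLe nat nat nat
  | RJumpLe nat nat nat

record machine_state =
  pc :: nat
  reg :: "nat \<Rightarrow> nat"
  mem :: "nat \<Rightarrow> nat"
  rreg :: "nat \<Rightarrow> real"
  rmem :: "nat \<Rightarrow> real"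

definition set_reg :: "nat \<Rightarrow> nat \<Rightarrow> machine_state \<Rightarrow> machine_state" where
  "set_reg i x s = s\<lparr>pc := Suc (pc s), reg := (reg s)(i := x)\<rparr>"

definition set_rreg :: "nat \<Rightarrow> real \<Rightarrow> machine_state \<Rightarrow> machine_state" where
  "set_rreg i x s = s\<lparr>pc := Suc (pc s), rreg := (rreg s)(i := x)\<rparr>"

fun exec :: "instr \<Rightarrow> machine_state \<Rightarrow> machine_state" where
  "exec (Const i c) s = set_reg i c s"
| "exec (Add i j l) s = set_reg i (reg s j + reg s l) s"
| "exec (Sub i j l) s = set_reg i (reg s j - reg s l) s"
| "exec (Mul i j l) s = set_reg i (reg s j * reg s l) s"
| "exec (Div i j l) s = set_reg i (reg s j div reg s l) s"
| "exec (Load i j) s = set_reg i (mem s (reg s j)) s"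
| "exec (Store i j) s = s\<lparr>pc := Suc (pc s), mem := (mem s)(reg s i := reg s j)\<rparr>"
| "exec (RAdd i j l) s = set_rreg i (rreg s j + rreg s l) s"
| "exec (RSub i j l) s = set_rreg i (rreg s j - rreg s l) s"
| "exec (RLoad i j) s = set_rreg i (rmem s (reg s j)) s"
| "exec (RStore i j) s = s\<lparr>pc := Suc (pc s), rmem := (rmem s)(reg s i := rreg s j)\<rparr>"
| "exec (Jump p) s = s\<lparr>pc := p\<rparr>"
| "exec (JumpLe i j p) s = s\<lparr>pc := (if reg s i \<le> reg s j then p else Suc (pc s))\<rparr>"
| "exec (RJumpLe i j p) s = s\<lparr>pc := (if rreg s i \<le> rreg s j then p else Suc (pc s))\<rparr>"

definition bit_length :: "nat \<Rightarrow> nat" where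
  "bit_length x = Suc (floor_log x)"

fun cost :: "instr \<Rightarrow> machine_state \<Rightarrow> nat" where
  "cost (Const i c) s = bit_length c"
| "cost (Add i j l) s = bit_length (reg s j) + bit_length (reg s l)"
| "cost (Sub i j l) s = bit_length (reg s j) + bit_length (reg s l)"
| "cost (Mul i j l) s = bit_length (reg s j) + bit_length (reg s l)"
| "cost (Div i j l) s = bit_length (reg s j) + bit_length (reg s l)"
| "cost (Load i j) s = bit_length (reg s j) + bit_length (mem s (reg s j))"
| "cost (Store i j) s = bit_length (reg s i) + bit_length (reg s j)"
| "cost (RAdd i j l) s = 1"
| "cost (RSub i j l) s = 1"
| "cost (RLoad i j) s = bit_length (reg s j) + 1"
| "cost (RStore i j) s = bit_length (reg s i) + 1"
| "cost (Jump p) s = 1"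
| "cost (JumpLe i j p) s = bit_length (reg s i) + bit_length (reg s j)"
| "cost (RJumpLe i j p) s = 1"

inductive run :: "instr list \<Rightarrow> machine_state \<Rightarrow> nat \<Rightarrow> machine_state \<Rightarrow> bool"
  for P :: "instr list" where
  halt: "length P \<le> pc s \<Longrightarrow> run P s 0 s"
| step: "pc s < length P \<Longrightarrow> run P (exec (P ! pc s) s) t s' \<Longrightarrow>
           run P s (cost (P ! pc s) s + t) s'"

lemma run_deterministic:
  "run P s t s' \<Longrightarrow> run P s u s'' \<Longrightarrow> t = u \<and> s' = s''"
proof (induction arbitrary: u s'' rule: run.induct)
  case (halt s)
  from halt.prems halt.hyps show ?case by (cases rule: run.cases) auto
next
  case (step s t s')
  from step.prems show ?case
  proof (cases rule: run.cases)
    case halt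
    with step.hyps show ?thesis by simp
  next
    case (step t')
    with \<open>\<And>u s''. run P (exec (P ! pc s) s) u s'' \<Longrightarrow> t = u \<and> s' = s''\<close>
    show ?thesis by blast
  qed
qed


section \<open>Input and output encodings\<close>

text \<open>
  The nodes are \<open>0, \<dots>, n - 1\<close>. Following the non-zero encoding, an instance is written down
  as one list per node \<open>v\<close>, with one entry for each member of \<open>F v\<close>: its elements
  and its score. The order of entries and of elements is arbitrary.
\<close>

type_synonym listing = "(nat list \<times> real) list list"

definition lists_instance ::
    "listing \<Rightarrow> nat \<Rightarrow> (nat \<Rightarrow> nat set set) \<Rightarrow> (nat \<Rightarrow> nat set \<Rightarrow> real) \<Rightarrow> bool" where
  "lists_instance L n F f \<longleftrightarrow>
     length L = n \<and>
     (\<forall>v<n. distinct (map (set \<circ> fst) (L ! v)) \<and>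
            (set \<circ> fst) ` set (L ! v) = F v \<and>
            (\<forall>(xs, r) \<in> set (L ! v). distinct xs \<and> r = f v (set xs)))"

definition nat_input :: "listing \<Rightarrow> nat list" where
  "nat_input L =
     length L # concat (map (\<lambda>es. length es # concat (map (\<lambda>(xs, r). length xs # xs) es)) L)"

definition real_input :: "listing \<Rightarrow> real list" where
  "real_input L = concat (map (map snd) L)"

text \<open>
  Every natural number of the input contributes its bit length and every score contributes 1.
\<close>

definition input_size :: "listing \<Rightarrow> nat" where
  "input_size L = sum_list (map bit_length (nat_input L)) + length (real_input L)"

definition initial_state :: "listing \<Rightarrow> machine_state" where
  "initial_state L =
     \<lparr>pc = 0,
      reg = (\<lambda>_. 0),
      mem = (\<lambda>i. if i < length (nat_input L) then nat_input L ! i else 0),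
      rreg = (\<lambda>_. 0),
      rmem = (\<lambda>i. if i < length (real_input L) then real_input L ! i else 0)\<rparr>"

text \<open>The output is an arc list: the number of arcs, followed by tail and head of each arc.\<close>

definition output_arcs :: "machine_state \<Rightarrow> (nat \<times> nat) set" where
  "output_arcs s = {(mem s (2 * i + 1), mem s (2 * i + 2)) | i. i < mem s 0}"

end

theory Submission
  imports Defs
begin

text \<open>
  Build the polytree by choosing the parent sets one vertex at a time, joining components of the
  current forest, and remember for each vertex only whether it is untouched, active or finished.
  Every component keeps at most one active vertex. If the vertices are processed along the tree
  with heavy parts first, only \<open>w = O(k log n)\<close> vertices are ever active, so it suffices to
  explore the states with at most \<open>w\<close> active vertices by dynamic programming. Each choice raises
  the number of chosen parent sets by one, so a first-in-first-out queue visits the states in a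
  valid order. For every \<open>N \<ge> 1\<close> there are at most \<open>N\<^sup>w (2 + 2/N)\<^sup>n\<close> such states, and \<open>N\<^sup>w\<close> is
  polynomial in \<open>n\<close> for constant \<open>N\<close> and \<open>k\<close>; taking \<open>N \<ge> 2/\<epsilon>\<close> gives the bound. The program
  visits only the reachable states: codes are numbers below \<open>4\<^sup>n\<close>, used directly as addresses.
\<close>

section \<open>Connectivity and forests\<close>

text \<open>Untouched and finished vertices give the base 2: an unrestricted search would meet about
  \<open>4 ^ n\<close> states, so active vertices have to be rare. The logarithm comes from
  \<open>w(m) = w(m div 2) + k + 1\<close>. Before the parents of a vertex are fixed, the branches
  at up to \<open>k + 1\<close> roots must be completed, and only one of them can hold more than
  half of the vertices; it goes first, while no other root is active. Soundness does not rest on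
  this bound, since every visited state belongs to a genuine partial polytree. The bound matters for
  completeness (some order of an optimal polytree stays narrow) and for counting. A table of
  \<open>4 ^ n\<close> cells cannot even be cleared within the time bound. Memory is zero initially,
  so 0 serves as the mark of an unvisited code, and only visited cells are ever written. Codes have
  \<open>2 * n\<close> bits, so using them as addresses costs only a polynomial factor. The program
  depends on \<open>k\<close> alone; \<open>\<epsilon>\<close> enters only the estimate of the
  number of narrow states.\<close>

definition conn :: "('a \<times> 'a) set \<Rightarrow> ('a \<times> 'a) set" where
  "conn A = (A \<union> A\<inverse>)\<^sup>*"

lemma conn_refl [simp]: "(x, x) \<in> conn A"
  by (simp add: conn_def)

lemma conn_sym: "(x, y) \<in> conn A \<Longrightarrow> (y, x) \<in> conn A"
proof -
  assume "(x, y) \<in> conn A"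
  then have "(y, x) \<in> ((A \<union> A\<inverse>)\<^sup>*)\<inverse>" by (simp add: conn_def)
  then show ?thesis by (simp add: conn_def rtrancl_converse[symmetric] converse_Un Un_commute)
qed

lemma conn_trans: "(x, y) \<in> conn A \<Longrightarrow> (y, z) \<in> conn A \<Longrightarrow> (x, z) \<in> conn A"
  unfolding conn_def by (rule rtrancl_trans)

lemma conn_arc: "(x, y) \<in> A \<Longrightarrow> (x, y) \<in> conn A"
  unfolding conn_def by blast

lemma conn_mono: "A \<subseteq> B \<Longrightarrow> conn A \<subseteq> conn B"
  unfolding conn_def by (rule rtrancl_mono) blast

lemma skeleton_edge_conn: "{x, y} \<in> skeleton A \<Longrightarrow> (x, y) \<in> conn A"
  by (auto simp: skeleton_def doubleton_eq_iff intro: conn_arc conn_sym)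

lemma undirected_cycle_rotate:
  assumes "undirected_cycle E p"
  shows "undirected_cycle E (rotate i p)"
proof -
  have m: "length p > 0" using assms by (auto simp: undirected_cycle_def)
  have "{rotate i p ! j, rotate i p ! (Suc j mod length p)} \<in> E" if "j < length p" for j
  proof -
    have "rotate i p ! j = p ! ((i + j) mod length p)" using that by (simp add: nth_rotate)
    moreover have "rotate i p ! (Suc j mod length p) = p ! (Suc ((i + j) mod length p) mod length p)"
      using m by (simp add: nth_rotate mod_simps)
    ultimately show ?thesis using assms m by (simp add: undirected_cycle_def)
  qed
  then show ?thesis using assms by (auto simp: undirected_cycle_def)
qed

text \<open>A cycle in the new skeleton must use the edge \<open>{s, v}\<close>. Rotated so that
  this edge joins its last vertex to its first, the rest of the cycle is a path in \<open>A\<close>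
  between \<open>s\<close> and \<open>v\<close>.\<close>

lemma forest_insert:
  assumes "forest (skeleton A)" and nc: "(s, v) \<notin> conn A"
  shows "forest (skeleton (insert (s, v) A))"
  unfolding forest_def
proof
  let ?E = "skeleton (insert (s, v) A)"
  have E: "e \<in> skeleton A" if "e \<in> ?E" "e \<noteq> {s, v}" for e
    using that by (auto simp: skeleton_def)
  assume "\<exists>p. undirected_cycle ?E p"
  then obtain p where p: "undirected_cycle ?E p" by blast
  have "\<not> undirected_cycle (skeleton A) p" using assms(1) by (auto simp: forest_def)
  then obtain i where i: "i < length p" "{p ! i, p ! (Suc i mod length p)} = {s, v}"
    using p E by (auto simp: undirected_cycle_def)
  define q where "q = rotate (Suc i) p"
  have q: "undirected_cycle ?E q" unfolding q_def by (rule undirected_cycle_rotate[OF p])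
  define m where "m = length q"
  have m: "m \<ge> 3" "distinct q" using q by (auto simp: undirected_cycle_def m_def)
  have mp: "m = length p" by (simp add: m_def q_def)
  have q0: "q ! 0 = p ! (Suc i mod m)" 
    using m(1) mp nth_rotate[of 0 p "Suc i"] by (fastforce simp: q_def simp del: rotate_Suc)
  have "Suc i + (m - 1) = i + m" using m(1) by simp
  then have "(Suc i + (m - 1)) mod m = i" using i(1) mp by (metis mod_add_self2 mod_less)
  then have qm: "q ! (m - 1) = p ! i"
    using m(1) mp nth_rotate[of "m - 1" p "Suc i"] by (simp add: q_def del: rotate_Suc)
  have sv: "{q ! (m - 1), q ! 0} = {s, v}" using i(2) q0 qm mp by simp
  have "(q ! 0, q ! j) \<in> conn A" if "j < m" for j
    using that
  proof (induction j)
    case (Suc j)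
    then have "Suc j mod m = Suc j" by simp
    then have e: "{q ! j, q ! Suc j} \<in> ?E" using q Suc.prems
      by (auto simp: undirected_cycle_def m_def dest: Suc_lessD)
    \<comment> \<open>Distinctness and length at least 3 keep the closing edge from reappearing
      inside the path.\<close>
    have "{q ! j, q ! Suc j} \<noteq> {q ! (m - 1), q ! 0}"
    proof
      assume "{q ! j, q ! Suc j} = {q ! (m - 1), q ! 0}"
      then consider "q ! j = q ! (m - 1)" | "q ! j = q ! 0" "q ! Suc j = q ! (m - 1)"
        by (auto simp: doubleton_eq_iff)
      then show False
      proof cases
        case 1
        have "j < length q" "m - 1 < length q" using Suc.prems m(1) by (simp_all add: m_def)
        then have "j = m - 1" using 1 m(2) nth_eq_iff_index_eq by blast
        then show ?thesis using Suc.prems by simp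
      next
        case 2
        have "j < length q" "Suc j < length q" "0 < length q" "m - 1 < length q"
          using Suc.prems m(1) by (auto simp: m_def)
        then have "j = 0" "Suc j = m - 1" using 2 m(2) nth_eq_iff_index_eq by blast+
        then show ?thesis using m(1) by simp
      qed
    qed
    then have "(q ! j, q ! Suc j) \<in> conn A" using E e sv by (auto intro: skeleton_edge_conn)
    then show ?case using Suc by (auto intro: conn_trans)
  qed simp
  then have "(q ! 0, q ! (m - 1)) \<in> conn A" using m by simp
  then show False using sv nc by (auto simp: doubleton_eq_iff dest: conn_sym)
qed

text \<open>A shortest detour from \<open>s\<close> to \<open>v\<close> is a simple path, and the
  arc itself closes it to a cycle. A detour of length 1 would be the opposite arc
  \<open>(v, s)\<close>, which leaves no trace in the skeleton; acyclicity of \<open>A\<close>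
  excludes it, as it excludes loops.\<close>

lemma forest_bridge:
  assumes "forest (skeleton A)" "acyclic A" and sv: "(s, v) \<in> A"
  shows "(s, v) \<notin> conn (A - {(s, v)})"
proof
  let ?B = "A - {(s, v)}"
  let ?R = "?B \<union> ?B\<inverse>"
  assume "(s, v) \<in> conn ?B"
  then have ex: "\<exists>m. (s, v) \<in> ?R ^^ m" unfolding conn_def rtrancl_power .
  define m where "m = (LEAST m. (s, v) \<in> ?R ^^ m)"
  have m: "(s, v) \<in> ?R ^^ m" unfolding m_def by (rule LeastI_ex[OF ex])
  have least: "(s, v) \<notin> ?R ^^ l" if "l < m" for l
    using that unfolding m_def by (rule not_less_Least)
  have "(v, v) \<notin> A\<^sup>+" "(s, v) \<in> A\<^sup>+" using assms(2) sv by (auto simp: acyclic_def)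
  then have "s \<noteq> v" "(v, s) \<notin> A" using trancl_into_trancl2[of v s A v] by auto
  then have "m \<noteq> 0" "m \<noteq> 1" using m by (auto intro: gr0I)
  then have m2: "m \<ge> 2" by simp
  obtain g where g: "g 0 = s" "g m = v" "\<And>i. i < m \<Longrightarrow> (g i, g (Suc i)) \<in> ?R"
    using m unfolding relpow_fun_conv by blast
  have seg: "(g i, g j) \<in> ?R ^^ (j - i)" if "i \<le> j" "j \<le> m" for i j
    unfolding relpow_fun_conv using that g(3)
    by (intro exI[of _ "\<lambda>l. g (i + l)"]) auto
  \<comment> \<open>Cutting out the part between two equal vertices would shorten the walk below its
    minimal length \<open>m\<close>.\<close>
  have "g i \<noteq> g j" if "i < j" "j \<le> m" for i j
  proof
    assume "g i = g j"
    then have "(s, v) \<in> ?R ^^ (i + (m - j))"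
      using seg[of 0 i] seg[of j m] that g(1,2) unfolding relpow_add by auto
    moreover have "i + (m - j) < m" using that by arith
    ultimately show False using least by blast
  qed
  then have inj: "inj_on g {0..<Suc m}" by (intro linorder_inj_onI) auto
  let ?p = "map g [0..<Suc m]"
  have "undirected_cycle (skeleton A) ?p"
    unfolding undirected_cycle_def
  proof (intro conjI allI impI)
    show "3 \<le> length ?p" using m2 by simp
    show "distinct ?p" using inj by (simp only: distinct_map distinct_upt set_upt)
    fix i assume "i < length ?p"
    then have "i \<le> m" by simp
    then consider "i < m" | "i = m" by linarith
    then show "{?p ! i, ?p ! (Suc i mod length ?p)} \<in> skeleton A"
    proof cases
      case 1
      then have "?p ! i = g i" "?p ! (Suc i mod length ?p) = g (Suc i)"
        by (simp_all del: upt_Suc)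
      moreover have "{g i, g (Suc i)} \<in> skeleton A"
        using g(3)[OF 1] by (auto simp: skeleton_def doubleton_eq_iff)
      ultimately show ?thesis by (simp del: upt_Suc)
    next
      case 2
      then have "?p ! i = g m" "?p ! (Suc i mod length ?p) = g 0"
        by (simp_all del: upt_Suc)
      then show ?thesis using g sv by (auto simp: skeleton_def doubleton_eq_iff simp del: upt_Suc)
    qed
  qed
  then show False using assms(1) by (auto simp: forest_def)
qed

text \<open>A walk that uses new arcs reaches the star \<open>insert v S\<close> at some
  \<open>a\<close> and leaves it for the last time at some \<open>b\<close>; outside it moves in
  \<open>A\<close>.\<close>

lemma conn_star:
  assumes "(x, y) \<in> conn (A \<union> S \<times> {v})"
  shows "(x, y) \<in> conn A \<or>
         (\<exists>a\<in>insert v S. \<exists>b\<in>insert v S. (x, a) \<in> conn A \<and> (b, y) \<in> conn A)"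
  using assms unfolding conn_def[of "A \<union> S \<times> {v}"]
proof (induction rule: rtrancl_induct)
  case (step y z)
  then consider "(y, z) \<in> conn A" | "y \<in> insert v S" "z \<in> insert v S"
    by (auto intro: conn_arc conn_sym)
  then show ?case
  proof cases
    case 1
    then show ?thesis using step.IH by (blast intro: conn_trans)
  next
    case 2
    then show ?thesis using step.IH by (blast intro: conn_refl)
  qed
qed simp

section \<open>Vertex states\<close>

text \<open>
  The state \<open>d x\<close> of a vertex is 0 (untouched), 1 (active, parents not yet chosen), 2 (active,
  parents chosen) or 3 (finished). Choosing the parent set \<open>S\<close> of \<open>v\<close> joins the components of
  \<open>v\<close> and of \<open>S\<close>; only the vertex \<open>r\<close> of the new component stays active (none if
  \<open>r \<notin> insert v S\<close>), so each component has at most one vertex that is not finished and joining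
  distinct unfinished vertices never closes a cycle. The states must lie in \<open>[lo, hi]\<close> and are
  raised to \<open>tgt\<close>.
\<close>

definition tgt :: "nat \<Rightarrow> nat \<Rightarrow> nat \<Rightarrow> nat" where
  "tgt v r x = (if x = v then if x = r then 2 else 3 else if x = r then 1 else 3)"

text \<open>A vertex of \<open>S\<close> other than \<open>r\<close> becomes finished, so its
  parents must already be chosen (state 2); \<open>v\<close> and \<open>r\<close> carry no such
  demand. Dually, \<open>hi\<close> excludes finished vertices and, for \<open>v\<close>, a second
  choice of parents.\<close>

definition lo :: "nat \<Rightarrow> nat \<Rightarrow> nat \<Rightarrow> nat" where
  "lo v r x = (if x = v \<or> x = r then 0 else 2)"

definition hi :: "nat \<Rightarrow> nat \<Rightarrow> nat" where
  "hi v x = (if x = v then 1 else 2)"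

text \<open>The maximum only matters when \<open>r\<close> lies in \<open>S\<close>: it becomes
  active if untouched, but stays 2 if its parents were chosen earlier.\<close>

definition assign :: "nat \<Rightarrow> nat set \<Rightarrow> nat \<Rightarrow> (nat \<Rightarrow> nat) \<Rightarrow> (nat \<Rightarrow> nat) \<Rightarrow> bool" where
  "assign v S r d d' \<longleftrightarrow>
     (\<forall>x\<in>insert v S. lo v r x \<le> d x \<and> d x \<le> hi v x) \<and>
     (\<forall>x. d' x = (if x \<in> insert v S then max (d x) (tgt v r x) else d x))"

definition active :: "nat \<Rightarrow> (nat \<Rightarrow> nat) \<Rightarrow> nat set" where
  "active n d = {x. x < n \<and> (d x = 1 \<or> d x = 2)}"

definition assigned :: "nat \<Rightarrow> (nat \<Rightarrow> nat) \<Rightarrow> nat set" where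
  "assigned n d = {x. x < n \<and> 2 \<le> d x}"

lemma finite_active [simp]: "finite (active n d)" by (simp add: active_def)
lemma finite_assigned [simp]: "finite (assigned n d)" by (simp add: assigned_def)

text \<open>By \<open>lo\<close>, every vertex that gets finished, apart from \<open>v\<close>, had
  its parents chosen before, so a step adds exactly \<open>v\<close>. This count is what orders the
  search by levels.\<close>

lemma assigned_assign:
  assumes "assign v S r d d'" "v < n" "v \<notin> S"
  shows "assigned n d' = insert v (assigned n d)" "v \<notin> assigned n d"
proof -
  show "v \<notin> assigned n d" using assms by (auto simp: assigned_def assign_def hi_def)
  show "assigned n d' = insert v (assigned n d)"
  proof (intro set_eqI)
    fix x
    have "2 \<le> d' x \<longleftrightarrow> x = v \<or> 2 \<le> d x"
      using assms by (cases "x \<in> insert v S") (auto simp: assign_def tgt_def lo_def hi_def)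
    then show "x \<in> assigned n d' \<longleftrightarrow> x \<in> insert v (assigned n d)"
      using assms(2) by (auto simp: assigned_def)
  qed
qed

definition partial_polytree ::
    "nat \<Rightarrow> (nat \<Rightarrow> nat set set) \<Rightarrow> (nat \<Rightarrow> nat) \<Rightarrow> (nat \<times> nat) set \<Rightarrow> bool" where
  "partial_polytree n F d A \<longleftrightarrow>
     polytree {..<n} A \<and> (\<forall>x. d x \<le> 3) \<and>
     (\<forall>x y. x \<noteq> y \<longrightarrow> d x \<noteq> 3 \<longrightarrow> d y \<noteq> 3 \<longrightarrow> (x, y) \<notin> conn A) \<and>
     (\<forall>v<n. if v \<in> assigned n d then parents A v \<in> F v else parents A v = {})"

lemma partial_polytree_empty: "partial_polytree n F (\<lambda>_. 0) {}"
proof -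
  have "forest (skeleton ({} :: (nat \<times> nat) set))"
    unfolding forest_def undirected_cycle_def
  proof clarify
    fix p :: "nat list"
    assume "3 \<le> length p" "\<forall>i<length p. {p ! i, p ! (Suc i mod length p)} \<in> skeleton {}"
    then have "{p ! 0, p ! (Suc 0 mod length p)} \<in> skeleton {}" by fastforce
    then show False by (simp add: skeleton_def)
  qed
  then show ?thesis
    by (auto simp: partial_polytree_def polytree_def acyclic_def conn_def parents_def assigned_def)
qed

text \<open>The arcs into \<open>v\<close> are added one at a time. Before each one, its tail,
  \<open>v\<close> and the earlier tails are distinct unfinished vertices and lie in different
  components of \<open>A\<close>, so \<open>forest_insert\<close> applies. Directed cycles are
  excluded the same way, directed paths being undirected connections.\<close>

lemma partial_polytree_assign:
  assumes pp: "partial_polytree n F d A" and st: "assign v S r d d'"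
    and v: "v < n" and S: "S \<in> F v" "S \<subseteq> {..<n} - {v}"
  shows "partial_polytree n F d' (A \<union> S \<times> {v})"
    and "parents (A \<union> S \<times> {v}) v = S"
    and "x \<noteq> v \<Longrightarrow> parents (A \<union> S \<times> {v}) x = parents A x"
proof -
  have fin: "finite S" using S(2) finite_subset by blast
  have vS: "v \<notin> S" using S by auto
  have d3: "d x \<le> 3" for x using pp by (simp add: partial_polytree_def)
  have nf: "d x \<noteq> 3" if "x \<in> insert v S" for x
    using st that by (auto simp: assign_def hi_def split: if_splits)
  have sep: "(x, y) \<notin> conn A" if "x \<noteq> y" "d x \<noteq> 3" "d y \<noteq> 3" for x y
    using pp that by (auto simp: partial_polytree_def)
  have pA: "acyclic A" "forest (skeleton A)" "A \<subseteq> {..<n} \<times> {..<n}"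
    using pp by (auto simp: partial_polytree_def polytree_def)
  have "acyclic (A \<union> S' \<times> {v}) \<and> forest (skeleton (A \<union> S' \<times> {v}))" if "S' \<subseteq> S" for S'
    using finite_subset[OF that fin] that
  proof (induction S' rule: finite_induct)
    case empty
    then show ?case using pA by simp
  next
    case (insert s S')
    let ?B = "A \<union> S' \<times> {v}"
    have eq: "A \<union> insert s S' \<times> {v} = insert (s, v) ?B" by auto
    have nc: "(s, v) \<notin> conn ?B"
    proof
      assume sv: "(s, v) \<in> conn ?B"
      have "(s, a) \<notin> conn A" if "a \<in> insert v S'" for a
      proof (rule sep)
        show "s \<noteq> a" using that insert vS by auto
        show "d s \<noteq> 3" "d a \<noteq> 3" using that insert by (auto intro!: nf)
      qed
      then show False using conn_star[OF sv] by blast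
    qed
    have "?B\<^sup>* \<subseteq> conn ?B" unfolding conn_def by (rule rtrancl_mono) blast
    then have "(v, s) \<notin> ?B\<^sup>*" using nc conn_sym[of v s ?B] by blast
    then show ?case unfolding eq acyclic_insert using insert forest_insert[OF _ nc] by auto
  qed
  then have ac: "acyclic (A \<union> S \<times> {v})" "forest (skeleton (A \<union> S \<times> {v}))" by auto
  have notas: "v \<notin> assigned n d" using st by (auto simp: assign_def hi_def assigned_def)
  then have pv: "parents A v = {}" using pp v by (auto simp: partial_polytree_def)
  then show par: "parents (A \<union> S \<times> {v}) v = S" by (auto simp: parents_def)
  show par': "parents (A \<union> S \<times> {v}) x = parents A x" if "x \<noteq> v" for x
    using that by (auto simp: parents_def)
  have dd: "d x \<le> d' x" "d' x \<le> 3" for x using st d3 by (auto simp: assign_def tgt_def)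
  have "(x, y) \<notin> conn (A \<union> S \<times> {v})" if xy: "x \<noteq> y" "d' x \<noteq> 3" "d' y \<noteq> 3" for x y
  proof
    have dxy: "d x \<noteq> 3" "d y \<noteq> 3" using xy dd[of x] dd[of y] by auto
    assume c: "(x, y) \<in> conn (A \<union> S \<times> {v})"
    obtain a b where ab: "a \<in> insert v S" "b \<in> insert v S" "(x, a) \<in> conn A" "(b, y) \<in> conn A"
      using conn_star[OF c] sep[OF xy(1) dxy] by blast
    \<comment> \<open>Both vertices were unfinished before the step as well, hence alone of this
      kind in their components, so each is itself a vertex of the star. There only \<open>r\<close>
      is not raised to 3.\<close>
    have "x = a" using sep[of x a] dxy(1) nf[OF ab(1)] ab(3) by blast
    moreover have "y = b" using sep[of b y] dxy(2) nf[OF ab(2)] ab(4) by blast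
    ultimately have "tgt v r x \<noteq> 3" "tgt v r y \<noteq> 3" "x \<in> insert v S" "y \<in> insert v S"
      using st xy d3[of x] d3[of y] ab by (auto simp: assign_def max_def split: if_splits)
    then show False using xy(1) by (auto simp: tgt_def split: if_splits)
  qed
  moreover have "polytree {..<n} (A \<union> S \<times> {v})"
    using ac pA S v by (auto simp: polytree_def)
  moreover have "if x \<in> assigned n d' then parents (A \<union> S \<times> {v}) x \<in> F x
        else parents (A \<union> S \<times> {v}) x = {}" if "x < n" for x
    using assigned_assign[OF st v vS] par par'[of x] pp that S
    by (cases "x = v") (auto simp: partial_polytree_def)
  ultimately show "partial_polytree n F d' (A \<union> S \<times> {v})"
    using dd by (simp add: partial_polytree_def)
qed


section \<open>Narrow elimination orders\<close>

text \<open>Closed form of the recurrence in \<open>width_half\<close>, starting from 0 at 0. The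
  summand \<open>Suc k\<close> counts a vertex together with its at most \<open>k\<close>
  parents.\<close>

definition width :: "nat \<Rightarrow> nat \<Rightarrow> nat" where
  "width k m = (if m = 0 then 0 else Suc k * Suc (floor_log m))"

lemma width_half:
  assumes "m > 0" shows "width k m = width k (m div 2) + Suc k"
proof (cases "m = 1")
  case False
  then show ?thesis using assms floor_log_rec[of m] by (simp add: width_def)
qed (simp add: width_def)

lemma width_mono: "l \<le> m \<Longrightarrow> width k l \<le> width k m"
  using floor_log_mono[THEN monoD, of l m]
  by (auto simp: width_def intro: mult_le_mono add_mono)

text \<open>A move in a schedule for one fixed polytree \<open>A\<close>: the parent sets are
  dictated by \<open>A\<close>, and only the order and the vertex \<open>r\<close> that stays active
  are free. As \<open>n\<close> is not a vertex, \<open>r = n\<close> stands for no such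
  vertex.\<close>

definition assign_step ::
    "nat \<Rightarrow> (nat \<times> nat) set \<Rightarrow> nat \<Rightarrow> (nat \<Rightarrow> nat) \<Rightarrow> (nat \<Rightarrow> nat) \<Rightarrow> bool" where
  "assign_step n A B d d' \<longleftrightarrow>
     (\<exists>v<n. \<exists>r\<le>n. assign v (parents A v) r d d' \<and> card (active n d') \<le> B)"

text \<open>
  \<open>X\<close> is closed under the arcs, except that those leaving \<open>r\<close> may lead into or out of \<open>X\<close>: this
  holds for unions of branches at \<open>r\<close>.
\<close>

definition side_closed :: "('a \<times> 'a) set \<Rightarrow> 'a \<Rightarrow> 'a set \<Rightarrow> bool" where
  "side_closed A r X \<longleftrightarrow> (\<forall>(s, v)\<in>A. s \<noteq> r \<longrightarrow> (s \<in> X \<longleftrightarrow> v \<in> X))"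

lemma side_closedD: "side_closed A r X \<Longrightarrow> (s, v) \<in> A \<Longrightarrow> s \<noteq> r \<Longrightarrow> s \<in> X \<longleftrightarrow> v \<in> X"
  by (auto simp: side_closed_def)

lemma card_active_insert:
  assumes "active n d' \<subseteq> active n d \<union> Z" "finite Z"
  shows "card (active n d') \<le> card (active n d) + card Z"
  using card_mono[OF _ assms(1)] card_Un_le[of "active n d" Z] assms(2) by auto

text \<open>
  Branches at \<open>r\<close> can be processed in any order, each leaving only \<open>r\<close> active. Processing a largest
  part first means that every part handled while up to \<open>k + 1\<close> further vertices are active has at
  most half the size, hence the logarithmic width.
\<close>

lemma narrow_schedule:
  assumes poly: "polytree {..<n} A" and deg: "\<And>v. v < n \<Longrightarrow> card (parents A v) \<le> k"
  shows "X \<subseteq> {..<n} \<Longrightarrow> r \<le> n \<Longrightarrow> side_closed A r X \<Longrightarrow> \<forall>x\<in>X - {r}. d x = 0 \<Longrightarrow>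
    (r \<in> X \<longrightarrow> d r \<le> 1) \<Longrightarrow> d r \<le> 2 \<Longrightarrow> card (active n d) + width k (card X) \<le> B \<Longrightarrow>
    \<exists>d'. (assign_step n A B)\<^sup>*\<^sup>* d d' \<and> (\<forall>x. x \<noteq> r \<longrightarrow> d' x = (if x \<in> X then 3 else d x)) \<and>
      (if r \<in> X then d' r = 2 else d' r = d r \<or> d r = 0 \<and> d' r = 1)"
proof (induction "card X" arbitrary: X r d rule: less_induct)
  case less
  let ?P = "parents A"
  let ?step = "(assign_step n A B)\<^sup>*\<^sup>*"
  have pA: "acyclic A" "forest (skeleton A)" "A \<subseteq> {..<n} \<times> {..<n}"
    using poly by (auto simp: polytree_def)
  note cl = side_closedD[OF less.prems(3)]
  have d0: "d x = 0" if "x \<in> X" "x \<noteq> r" for x using less.prems(4) that by auto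
  have finX: "finite X" using less.prems(1) finite_subset by blast
  show ?case
  proof (cases "X = {}")
    case True
    then show ?thesis by (intro exI[of _ d]) auto
  next
    case False
    define touch where "touch v = insert v (?P v)" for v
    \<comment> \<open>\<open>v\<close> is a child of \<open>r\<close>, or \<open>r\<close> itself,
      whenever \<open>X\<close> contains such a vertex. Otherwise no arc into \<open>X\<close>
      involves \<open>r\<close>, so \<open>r\<close> is isolated in the arc set \<open>A'\<close>
      below.\<close>
    obtain v where v: "v \<in> X" and vr: "w \<in> X \<Longrightarrow> r \<in> touch w \<Longrightarrow> r \<in> touch v" for w
      using False by (metis all_not_in_conv)
    have vn: "v < n" using v less.prems(1) by auto
    \<comment> \<open>Without the arcs into \<open>v\<close>, the vertex \<open>v\<close> and its
      parents fall into separate components; these are the branches \<open>Z u\<close>.\<close>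
    define A' where "A' = {(s, w) \<in> A. w \<in> X - {v}}"
    define H where "H = touch v - {r}"
    define Z where "Z u = {x \<in> X - {v}. (u, x) \<in> conn A'}" for u
    define X1 where "X1 = insert v (\<Union>u\<in>H. Z u)"
    have irr: "(x, x) \<notin> A" for x using pA(1) by (auto simp: acyclic_def)
    have vP: "v \<notin> ?P v" using irr by (auto simp: parents_def)
    have finH: "finite H" "finite (?P v)"
      using finite_subset[of "?P v" "{..<n}"] pA(3) by (auto simp: H_def touch_def parents_def)
    have sep1: "(u, v) \<notin> conn A'" if "u \<in> ?P v" for u
    proof -
      have "A' \<subseteq> A - {(u, v)}" by (auto simp: A'_def)
      moreover have "(u, v) \<in> A" using that by (simp add: parents_def)
      ultimately show ?thesis using forest_bridge[OF pA(2,1)] conn_mono by blast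
    qed
    have sep2: "(u, w) \<notin> conn A'" if "u \<in> ?P v" "w \<in> ?P v" "u \<noteq> w" for u w
    proof
      assume "(u, w) \<in> conn A'"
      moreover have "A' \<subseteq> A - {(u, v)}" by (auto simp: A'_def)
      ultimately have "(u, w) \<in> conn (A - {(u, v)})" using conn_mono by blast
      moreover have "(w, v) \<in> A - {(u, v)}" using that by (simp add: parents_def)
      ultimately have "(u, v) \<in> conn (A - {(u, v)})" using conn_arc conn_trans by metis
      moreover have "(u, v) \<in> A" using that by (simp add: parents_def)
      ultimately show False using forest_bridge[OF pA(2,1)] by blast
    qed
    have sep: "(u, w) \<notin> conn A'" if "u \<in> touch v" "w \<in> touch v" "u \<noteq> w" for u w
      using that sep1[of u] sep1[of w] sep2[of u w] conn_sym[of u w A'] by (auto simp: touch_def)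
    have sepr: "(u, r) \<notin> conn A'" if "u \<in> H" for u
    proof (cases "r \<in> touch v")
      case True
      then show ?thesis using that sep by (auto simp: H_def)
    next
      case False
      then have "r \<notin> touch w" if "w \<in> X" for w using vr that by blast
      then have iso: "(r, y) \<notin> A'" "(y, r) \<notin> A'" for y
        by (auto simp: A'_def touch_def parents_def)
      show ?thesis
      proof
        assume "(u, r) \<in> conn A'"
        then show False unfolding conn_def using iso that
          by (cases rule: rtranclE) (auto simp: H_def)
      qed
    qed
    have arc': "(s, w) \<in> conn A'" if "(s, w) \<in> A" "w \<in> X" "w \<noteq> v" for s w
      using that by (intro conn_arc) (auto simp: A'_def)
    have ZclD: "w \<in> Z u" if "u \<in> H" "(s, w) \<in> A" "s \<in> Z u" "w \<noteq> v" for u s w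
    proof -
      have "s \<noteq> r" using sepr that by (auto simp: Z_def)
      then have "w \<in> X" using cl that by (auto simp: Z_def)
      then have "(s, w) \<in> conn A'" using that arc' by blast
      then show ?thesis using that \<open>w \<in> X\<close> conn_trans[of u s A' w] by (auto simp: Z_def)
    qed
    have ZclU: "s \<in> Z u" if "u \<in> H" "(s, w) \<in> A" "w \<in> Z u" "s \<noteq> v" for u s w
    proof -
      have "(s, w) \<in> conn A'" using that arc' by (auto simp: Z_def)
      then have us: "(u, s) \<in> conn A'"
        using that conn_trans[of u w A' s] conn_sym[of s w A'] by (auto simp: Z_def)
      then have "s \<noteq> r" using sepr that by auto
      then show ?thesis using us cl that by (auto simp: Z_def)
    qed
    have Zu: "u \<in> Z u" if "u \<in> H" "u \<noteq> v" for u
    proof -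
      have "(u, v) \<in> A" using that by (auto simp: H_def touch_def parents_def)
      then show ?thesis using cl that v by (auto simp: Z_def H_def)
    qed
    have Zother: "w \<notin> Z u" if "u \<in> H" "w \<in> H" "u \<noteq> w" for u w
      using that sep by (auto simp: H_def Z_def)
    have Zdisj: "Z u \<inter> Z w = {}" if "u \<in> H" "w \<in> H" "u \<noteq> w" for u w
    proof (rule ccontr)
      assume "Z u \<inter> Z w \<noteq> {}"
      then obtain x where "(u, x) \<in> conn A'" "(w, x) \<in> conn A'" by (auto simp: Z_def)
      then have "(u, w) \<in> conn A'" using conn_sym conn_trans by metis
      then show False using sep that by (auto simp: H_def)
    qed
    \<comment> \<open>Each branch is again an instance of the claim, with its root \<open>u\<close>
      in the role of \<open>r\<close>. A parent \<open>u\<close> of \<open>v\<close> lies in its own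
      branch, whereas \<open>v\<close> does not lie in \<open>Z v\<close>.\<close>
    have Zcl: "side_closed A u (Z u)" if u: "u \<in> H" for u
      unfolding side_closed_def
    proof clarify
      fix s w assume a: "(s, w) \<in> A" "s \<noteq> u"
      have "w \<noteq> v" if "s \<in> Z u"
      proof
        assume "w = v"
        then have "s \<in> touch v" using a by (simp add: touch_def parents_def)
        then show False using sep[of u s] that u a(2) by (auto simp: Z_def H_def)
      qed
      moreover have "s \<noteq> v" if "w \<in> Z u"
      proof
        assume s: "s = v"
        then have "(s, w) \<in> conn A'" using a that arc' by (auto simp: Z_def)
        then have "(u, v) \<in> conn A'" using that conn_sym conn_trans s by (fastforce simp: Z_def)
        then show False using sep[of u v] u a(2) s by (auto simp: H_def touch_def)
      qed
      ultimately show "s \<in> Z u \<longleftrightarrow> w \<in> Z u" using ZclD ZclU u a by blast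
    qed
    have X1X: "X1 \<subseteq> X" using v by (auto simp: X1_def Z_def)
    have X1cl: "s \<in> X1 \<longleftrightarrow> w \<in> X1" if a: "(s, w) \<in> A" "s \<noteq> r" for s w
    proof
      assume "s \<in> X1"
      then consider "s = v" | u where "u \<in> H" "s \<in> Z u" by (auto simp: X1_def)
      then show "w \<in> X1"
      proof cases
        case 1
        then have "w \<noteq> v" "w \<in> X" using a irr cl v by auto
        then have "(v, w) \<in> conn A'" using a 1 arc' by blast
        then have "w \<in> Z v" "v \<in> H" using \<open>w \<noteq> v\<close> \<open>w \<in> X\<close> 1 a by (auto simp: Z_def H_def touch_def)
        then show ?thesis by (auto simp: X1_def)
      next
        case 2
        then show ?thesis using ZclD[OF _ a(1)] by (auto simp: X1_def)
      qed
    next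
      assume "w \<in> X1"
      then consider "w = v" | u where "u \<in> H" "w \<in> Z u" by (auto simp: X1_def)
      then show "s \<in> X1"
      proof cases
        case 1
        then have "s \<in> H" "s \<noteq> v" using a irr by (auto simp: H_def touch_def parents_def)
        then show ?thesis using Zu by (auto simp: X1_def)
      next
        case 2
        then show ?thesis using ZclU[OF _ a(1)] by (auto simp: X1_def)
      qed
    qed
    show ?thesis
    proof (cases "X1 = X")
      case split: False
      \<comment> \<open>Both parts are closed at \<open>r\<close>, so they can be treated one after
        the other. The larger part is processed with no extra active vertex; the smaller has at most
        half the size, which pays for \<open>r\<close> being active by then.\<close>
      have *: ?thesis if S: "S \<union> T = X" "S \<inter> T = {}" "S \<noteq> {}" "T \<noteq> {}" "card T \<le> card S"
        and Scl: "side_closed A r S" and Tcl: "side_closed A r T" for S T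
      proof -
        have fin: "finite S" "finite T" using S(1) finX by auto
        have cX: "card X = card S + card T" using S fin card_Un_disjoint by blast
        moreover have "card S > 0" "card T > 0" using S fin by (auto simp: card_gt_0_iff)
        ultimately have lt: "card S < card X" "card T < card X" by auto
        have "width k (card S) \<le> width k (card X)" using lt by (intro width_mono) simp
        then have "\<exists>d1. ?step d d1 \<and> (\<forall>x. x \<noteq> r \<longrightarrow> d1 x = (if x \<in> S then 3 else d x)) \<and>
            (if r \<in> S then d1 r = 2 else d1 r = d r \<or> d r = 0 \<and> d1 r = 1)"
          using less.prems S(1) Scl lt by (intro less.hyps) auto
        then obtain d1 where d1: "?step d d1" "\<And>x. x \<noteq> r \<Longrightarrow> d1 x = (if x \<in> S then 3 else d x)"
          "if r \<in> S then d1 r = 2 else d1 r = d r \<or> d r = 0 \<and> d1 r = 1" by blast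
        have "active n d1 \<subseteq> active n d \<union> {r}"
          using d1(2) by (auto simp: active_def split: if_splits)
        then have a1: "card (active n d1) \<le> card (active n d) + 1"
          using card_active_insert[of n d1 d "{r}"] by simp
        have "card T \<le> card X div 2" using S(5) cX by simp
        then have "width k (card T) + Suc k \<le> width k (card X)"
          using width_mono[of "card T" "card X div 2" k] width_half[of "card X" k] lt by simp
        then have "\<exists>d2. ?step d1 d2 \<and> (\<forall>x. x \<noteq> r \<longrightarrow> d2 x = (if x \<in> T then 3 else d1 x)) \<and>
            (if r \<in> T then d2 r = 2 else d2 r = d1 r \<or> d1 r = 0 \<and> d2 r = 1)"
          using less.prems S(1,2) Tcl lt a1 d1 by (intro less.hyps) (auto split: if_splits)
        then obtain d2 where d2: "?step d1 d2"
          "\<And>x. x \<noteq> r \<Longrightarrow> d2 x = (if x \<in> T then 3 else d1 x)"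
          "if r \<in> T then d2 r = 2 else d2 r = d1 r \<or> d1 r = 0 \<and> d2 r = 1" by blast
        show ?thesis
        proof (intro exI[of _ d2] conjI)
          show "?step d d2" using d1(1) d2(1) by (rule rtranclp_trans)
          show "\<forall>x. x \<noteq> r \<longrightarrow> d2 x = (if x \<in> X then 3 else d x)"
            using d1(2) d2(2) S(1) by auto
          show "if r \<in> X then d2 r = 2 else d2 r = d r \<or> d r = 0 \<and> d2 r = 1"
            using d1(3) d2(3) S(1,2) by (auto split: if_splits)
        qed
      qed
      have cls: "side_closed A r X1" "side_closed A r (X - X1)"
        using X1cl cl by (auto simp: side_closed_def)
      have "X1 \<noteq> {}" "X - X1 \<noteq> {}" using split X1X by (auto simp: X1_def)
      moreover have "X1 \<union> (X - X1) = X" "(X - X1) \<union> X1 = X" "X1 \<inter> (X - X1) = {}"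
        "(X - X1) \<inter> X1 = {}" using X1X by auto
      moreover note cls
      ultimately show ?thesis
        using *[of X1 "X - X1"] *[of "X - X1" X1]
        by (cases "card (X - X1) \<le> card X1") (simp_all only: not_le less_imp_le not_False_eq_True)
    next
      case X1: True
      have rX: "r = v" if rX: "r \<in> X"
      proof (rule ccontr)
        assume "r \<noteq> v"
        then obtain u where "u \<in> H" "r \<in> Z u" using rX X1 by (auto simp: X1_def)
        then show False using sepr by (auto simp: Z_def)
      qed
      have HX: "H \<subseteq> X" using X1 Zu by (auto simp: X1_def)
      have dH: "d u = 0" if "u \<in> H" for u using that HX d0 by (auto simp: H_def)
      have cZ: "card (Z u) < card X" for u
        using v finX by (intro psubset_card_mono) (auto simp: Z_def)
      have finZ: "finite (Z u)" for u using finX by (simp add: Z_def)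
      have cH: "card H \<le> Suc k"
      proof -
        have "card H \<le> card (touch v)" unfolding H_def touch_def
          using finH by (intro card_mono) auto
        also have "\<dots> \<le> Suc (card (?P v))" unfolding touch_def by (rule card_insert_le_m1) auto
        finally show ?thesis using deg[OF vn] by simp
      qed
      \<comment> \<open>The state once the branches at the roots in \<open>G\<close> are done:
        parents of \<open>v\<close> have their own parents chosen, \<open>v\<close> itself does not
        yet, just as \<open>lo\<close> and \<open>hi\<close> demand for the final step at
        \<open>v\<close>.\<close>
      let ?post = "\<lambda>G d'. ?step d d' \<and> (\<forall>x\<in>G. if x = v then d' x \<le> 1 else d' x = 2) \<and>
          (\<forall>x. x \<notin> G \<longrightarrow> d' x = (if x \<in> (\<Union>u\<in>G. Z u) then 3 else d x))"
      have one: "\<exists>d2. ?post (insert u G) d2"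
        if p: "?post G d1" and uG: "u \<in> H" "u \<notin> G" "G \<subseteq> H"
          and bound: "card (active n d) + card G + width k (card (Z u)) \<le> B" for G d1 u
      proof -
        have "active n d1 \<subseteq> active n d \<union> G"
          using p by (auto simp: active_def split: if_splits)
        then have a1: "card (active n d1) \<le> card (active n d) + card G"
          using card_active_insert finite_subset[OF uG(3) finH(1)] by blast
        have uu: "d1 u = 0"
        proof -
          have "u \<notin> (\<Union>w\<in>G. Z w)" using Zother uG by blast
          then show ?thesis using p uG dH by auto
        qed
        have zz: "d1 x = 0" if "x \<in> Z u" "x \<noteq> u" for x
        proof -
          have "x \<notin> G" using that Zother uG by blast
          moreover have "x \<notin> (\<Union>w\<in>G. Z w)" using that Zdisj uG by blast
          moreover have "x \<noteq> r" using that sepr uG by (auto simp: Z_def)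
          ultimately show ?thesis using p that d0 by (auto simp: Z_def)
        qed
        have "\<exists>d2. ?step d1 d2 \<and> (\<forall>x. x \<noteq> u \<longrightarrow> d2 x = (if x \<in> Z u then 3 else d1 x)) \<and>
            (if u \<in> Z u then d2 u = 2 else d2 u = d1 u \<or> d1 u = 0 \<and> d2 u = 1)"
          using less.prems(1) Zcl[OF uG(1)] cZ[of u] a1 bound uu zz HX uG(1)
          by (intro less.hyps) (auto simp: Z_def)
        then obtain d2 where d2: "?step d1 d2"
          "\<And>x. x \<noteq> u \<Longrightarrow> d2 x = (if x \<in> Z u then 3 else d1 x)"
          "if u \<in> Z u then d2 u = 2 else d2 u = d1 u \<or> d1 u = 0 \<and> d2 u = 1" by blast
        have "if u = v then d2 u \<le> 1 else d2 u = 2"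
          using d2(3) Zu[OF uG(1)] uu by (auto simp: Z_def)
        moreover have "if x = v then d2 x \<le> 1 else d2 x = 2" if "x \<in> G" for x
        proof -
          have "x \<noteq> u" "x \<in> H" using that uG by auto
          then have "d2 x = d1 x" using d2(2)[of x] Zother[of u x] uG(1) by simp
          moreover have "if x = v then d1 x \<le> 1 else d1 x = 2" using p that by blast
          ultimately show ?thesis by (auto split: if_splits)
        qed
        moreover have "d2 x = (if x \<in> (\<Union>w\<in>insert u G. Z w) then 3 else d x)"
          if "x \<notin> insert u G" for x
          using d2(2)[of x] that p by auto
        moreover have "?step d d2" using p d2(1) rtranclp_trans by metis
        ultimately show ?thesis by (intro exI[of _ d2]) blast
      qed
      have "\<exists>d2. ?post H d2"
      proof (cases "H = {}")
        \<comment> \<open>This happens only if \<open>v = r\<close> has no parents.\<close>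
        case True
        then show ?thesis by (intro exI[of _ d]) auto
      next
        case False
        \<comment> \<open>The root with the largest branch goes first, while no other root is
          active. Every other branch has at most half of \<open>X\<close>, which pays for the at
          most \<open>k\<close> roots that may be active by then.\<close>
        obtain h where h: "h \<in> H" "\<And>u. u \<in> H \<Longrightarrow> card (Z u) \<le> card (Z h)"
          using finite_has_maximal[of "(\<lambda>u. card (Z u)) ` H"] finH False
          by (auto simp: not_le) (metis nat_le_linear)
        have "\<exists>d2. ?post (insert h G) d2" if "G \<subseteq> H - {h}" for G
          using finite_subset[OF that finite_Diff[OF finH(1)]] that
        proof (induction G rule: finite_induct)
          case empty
          have "card (active n d) + width k (card (Z h)) \<le> B"
            using less.prems(7) width_mono[of "card (Z h)" "card X" k] cZ[of h] by simp
          then show ?case using one[where G = "{}" and ?d1.0 = d and u = h] h(1) by auto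
        next
          case (insert u G)
          then obtain d1 where d1: "?post (insert h G) d1" by auto
          have "card (insert u (insert h G)) \<le> card H"
            using insert h(1) finH by (intro card_mono) auto
          moreover have "card (insert u (insert h G)) = Suc (card (insert h G))"
            using insert by (intro card_insert_disjoint) auto
          ultimately have c1: "card (insert h G) \<le> k" using cH by simp
          have "card (Z u) + card (Z h) = card (Z u \<union> Z h)"
            using Zdisj[of u h] insert h(1) finZ by (intro card_Un_disjoint[symmetric]) auto
          also have "\<dots> \<le> card X" using finX by (intro card_mono) (auto simp: Z_def)
          finally have "card (Z u) \<le> card X div 2" using h(2)[of u] insert by auto
          then have "width k (card (Z u)) + Suc k \<le> width k (card X)"
            using width_mono[of "card (Z u)" "card X div 2" k] width_half[of "card X" k] cZ[of u]
            by simp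
          then have "\<exists>d2. ?post (insert u (insert h G)) d2"
            using insert h(1) c1 less.prems(7) by (intro one[OF d1]) auto
          then show ?case by (simp only: insert_commute[of h u G])
        qed
        from this[of "H - {h}"] show ?thesis
          using h(1) by (simp only: insert_Diff subset_refl)
      qed
      then obtain d2 where d2: "?step d d2" "\<And>x. x \<in> H \<Longrightarrow> if x = v then d2 x \<le> 1 else d2 x = 2"
        "\<And>x. x \<notin> H \<Longrightarrow> d2 x = (if x \<in> (\<Union>u\<in>H. Z u) then 3 else d x)" by blast
      have d2r: "d2 r = d r"
      proof -
        have "r \<notin> H" "r \<notin> (\<Union>u\<in>H. Z u)" using sepr by (auto simp: H_def Z_def)
        then show ?thesis using d2(3) by auto
      qed
      define d' where "d' x = (if x \<in> touch v then max (d2 x) (tgt v r x) else d2 x)" for x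
      have d'x: "d' x = (if x \<in> X then 3 else d x)" if "x \<noteq> r" for x
      proof (cases "x \<in> H")
        case True
        then have "d2 x \<le> 3" using d2(2)[of x] by (auto split: if_splits)
        then show ?thesis using True HX by (auto simp: d'_def tgt_def H_def)
      next
        case False
        then have "x \<notin> touch v" using that by (simp add: H_def)
        moreover from this have "x \<noteq> v" by (simp add: touch_def)
        ultimately show ?thesis using d2(3)[OF False] X1 by (auto simp: d'_def X1_def)
      qed
      have "active n d' \<subseteq> active n d \<union> {r}"
        using d'x by (auto simp: active_def split: if_splits)
      then have "card (active n d') \<le> card (active n d) + 1"
        using card_active_insert[of n d' d "{r}"] by simp
      \<comment> \<open>The budget of a nonempty \<open>X\<close> covers \<open>r\<close>, which the
        last step may activate.\<close>
      moreover have "width k (card X) \<ge> 1" using width_half[of "card X" k] False finX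
        by (simp add: card_gt_0_iff)
      ultimately have a': "card (active n d') \<le> B" using less.prems(7) by simp
      have "assign v (?P v) r d2 d'"
        unfolding assign_def
      proof (intro conjI ballI allI)
        show "d' x = (if x \<in> insert v (?P v) then max (d2 x) (tgt v r x) else d2 x)" for x
          by (simp add: d'_def touch_def)
        fix x assume x: "x \<in> insert v (?P v)"
        have "lo v r x \<le> d2 x \<and> d2 x \<le> hi v x"
        proof (cases "x = r")
          case True
          then show ?thesis using d2r less.prems(5,6) v by (auto simp: lo_def hi_def)
        next
          case False
          then have "x \<in> H" using x by (simp add: H_def touch_def)
          then show ?thesis using d2(2)[of x] False by (auto simp: lo_def hi_def)
        qed
        then show "lo v r x \<le> d2 x" "d2 x \<le> hi v x" by auto
      qed
      then have "assign_step n A B d2 d'"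
        using vn less.prems(2) a' by (auto simp: assign_step_def)
      then have "?step d d'" using d2(1) by (rule rtranclp.rtrancl_into_rtrancl[rotated])
      moreover have "if r \<in> X then d' r = 2 else d' r = d r \<or> d r = 0 \<and> d' r = 1"
      proof (cases "r \<in> X")
        case True
        then have "r = v" "d2 r \<le> 1" using rX d2r less.prems(5) by auto
        then show ?thesis using True by (simp add: d'_def tgt_def touch_def)
      next
        case False
        then have "r \<noteq> v" using v by auto
        then show ?thesis using False d2r by (auto simp: d'_def tgt_def)
      qed
      ultimately show ?thesis using d'x by (intro exI[of _ d']) auto
    qed
  qed
qed

section \<open>Structured programs\<close>

text \<open>Loops run while one register exceeds another because the machine branches on
  \<open>\<le>\<close> only, and a taken branch leaves the loop. \<open>Call\<close> generates no
  code; it marks where symbolic execution hands over to a separately proved rule.\<close>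

datatype com =
    Skip
  | Bas instr
  | Seq com com (infixr ";;" 60)
  | IfLe nat nat com com
  | IfRLe nat nat com com
  | WhileGt nat nat com
  | Call com

fun csize :: "com \<Rightarrow> nat" where
  "csize Skip = 0"
| "csize (Bas i) = 1"
| "csize (c1 ;; c2) = csize c1 + csize c2"
| "csize (IfLe i j c1 c2) = csize c1 + csize c2 + 2"
| "csize (IfRLe i j c1 c2) = csize c1 + csize c2 + 2"
| "csize (WhileGt i j c) = csize c + 2"
| "csize (Call c) = csize c"

fun compile :: "nat \<Rightarrow> com \<Rightarrow> instr list" where
  "compile a Skip = []"
| "compile a (Bas i) = [i]"
| "compile a (c1 ;; c2) = compile a c1 @ compile (a + csize c1) c2"
| "compile a (IfLe i j c1 c2) =
     JumpLe i j (a + csize c2 + 2) # compile (Suc a) c2 @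
     Jump (a + csize c2 + csize c1 + 2) # compile (a + csize c2 + 2) c1"
| "compile a (IfRLe i j c1 c2) =
     RJumpLe i j (a + csize c2 + 2) # compile (Suc a) c2 @
     Jump (a + csize c2 + csize c1 + 2) # compile (a + csize c2 + 2) c1"
| "compile a (WhileGt i j c) =
     JumpLe i j (a + csize c + 2) # compile (Suc a) c @ [Jump a]"
| "compile a (Call c) = compile a c"

lemma length_compile [simp]: "length (compile a c) = csize c"
  by (induction c arbitrary: a) auto

text \<open>\<open>run\<close> relates only initial and halting states, so an unfinished execution
  is described by its effect on continuations: every halting run from \<open>s'\<close> extends
  backwards to one from \<open>s\<close> at extra cost \<open>t\<close>.\<close>

definition reach :: "instr list \<Rightarrow> machine_state \<Rightarrow> nat \<Rightarrow> machine_state \<Rightarrow> bool" where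
  "reach P s t s' \<longleftrightarrow> (\<forall>u s''. run P s' u s'' \<longrightarrow> run P s (t + u) s'')"

lemma reach_refl: "reach P s 0 s" by (simp add: reach_def)

lemma reach_trans: "reach P s t s' \<Longrightarrow> reach P s' u s'' \<Longrightarrow> reach P s (t + u) s''"
  by (auto simp: reach_def add.assoc)

lemma reach_step:
  assumes "pc s < length P" shows "reach P s (cost (P ! pc s) s) (exec (P ! pc s) s)"
  using assms by (auto simp: reach_def intro: run.step)

text \<open>Indirect addresses are register values, so this bound also controls the address part of
  the logarithmic cost.\<close>

definition bounded :: "nat \<Rightarrow> machine_state \<Rightarrow> bool" where
  "bounded M s \<longleftrightarrow> (\<forall>i. reg s i \<le> M \<and> mem s i \<le> M)"

text \<open>
  Timed total correctness of the compiled code, at any position in any program. The first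
  argument of the postcondition bounds the number of executed instructions, which bounds the
  logarithmic cost because all natural numbers are required to stay below \<open>M\<close>.
\<close>

definition wp :: "nat \<Rightarrow> com \<Rightarrow> machine_state \<Rightarrow> (nat \<Rightarrow> machine_state \<Rightarrow> bool) \<Rightarrow> bool" where
  "wp M c s Q \<longleftrightarrow> (bounded M s \<longrightarrow>
     (\<forall>xs ys. \<exists>t T s'. reach (xs @ compile (length xs) c @ ys) (s\<lparr>pc := length xs\<rparr>) t
           (s'\<lparr>pc := length xs + csize c\<rparr>) \<and>
        t \<le> T * (2 * bit_length M) \<and> bounded M s' \<and> Q T s'))"

lemma wp_run:
  assumes "wp M c s Q" "bounded M s" "pc s = 0"
  shows "\<exists>t T s'. run (compile 0 c) s t (s'\<lparr>pc := csize c\<rparr>) \<and> t \<le> T * (2 * bit_length M) \<and> Q T s'"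
proof -
  obtain t T s' where "reach ([] @ compile (length ([]::instr list)) c @ []) (s\<lparr>pc := length ([]::instr list)\<rparr>) t
      (s'\<lparr>pc := length ([]::instr list) + csize c\<rparr>)" "t \<le> T * (2 * bit_length M)" "Q T s'"
    using assms(1,2) unfolding wp_def by blast
  moreover have "s\<lparr>pc := 0\<rparr> = s" using assms(3) by simp
  moreover have "run (compile 0 c) (s'\<lparr>pc := csize c\<rparr>) 0 (s'\<lparr>pc := csize c\<rparr>)"
    by (rule run.halt) simp
  ultimately show ?thesis unfolding reach_def by fastforce
qed

lemma wp_conseq:
  assumes "wp M c s Q" "\<And>t s'. bounded M s' \<Longrightarrow> Q t s' \<Longrightarrow> Q' t s'"
  shows "wp M c s Q'"
  using assms unfolding wp_def by meson

lemma wp_Skip: "Q 0 s \<Longrightarrow> wp M Skip s Q"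
  by (auto simp: wp_def intro!: exI[of _ 0] exI[of _ s] reach_refl)

lemma wp_Seq:
  assumes "wp M c1 s (\<lambda>t s'. wp M c2 s' (\<lambda>u. Q (t + u)))"
  shows "wp M (c1 ;; c2) s Q"
  unfolding wp_def
proof (intro impI allI)
  fix xs ys assume "bounded M s"
  then obtain t1 T1 s1 where 1: "reach (xs @ compile (length xs) c1 @ (compile (length xs + csize c1) c2 @ ys))
      (s\<lparr>pc := length xs\<rparr>) t1 (s1\<lparr>pc := length xs + csize c1\<rparr>)"
      "t1 \<le> T1 * (2 * bit_length M)" "bounded M s1" "wp M c2 s1 (\<lambda>u. Q (T1 + u))"
    using assms(1) unfolding wp_def[of M c1] by meson
  obtain t2 T2 s2 where 2: "reach ((xs @ compile (length xs) c1) @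
      compile (length (xs @ compile (length xs) c1)) c2 @ ys)
      (s1\<lparr>pc := length (xs @ compile (length xs) c1)\<rparr>) t2
      (s2\<lparr>pc := length (xs @ compile (length xs) c1) + csize c2\<rparr>)"
      "t2 \<le> T2 * (2 * bit_length M)" "bounded M s2" "Q (T1 + T2) s2"
    using 1(3,4) unfolding wp_def[of M c2] by blast
  show "\<exists>t T s'. reach (xs @ compile (length xs) (c1 ;; c2) @ ys) (s\<lparr>pc := length xs\<rparr>) t
           (s'\<lparr>pc := length xs + csize (c1 ;; c2)\<rparr>) \<and>
        t \<le> T * (2 * bit_length M) \<and> bounded M s' \<and> Q T s'"
    using reach_trans[OF 1(1), of t2 "s2\<lparr>pc := length xs + csize (c1 ;; c2)\<rparr>"] 2 1(2)
    by (intro exI[of _ "t1 + t2"] exI[of _ "T1 + T2"] exI[of _ s2]) (simp add: add.assoc algebra_simps)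
qed

section \<open>Proof rules for instructions, branches and loops\<close>

fun nonjump :: "instr \<Rightarrow> bool" where
  "nonjump (Jump _) = False"
| "nonjump (JumpLe _ _ _) = False"
| "nonjump (RJumpLe _ _ _) = False"
| "nonjump _ = True"

lemma exec_pc: "nonjump i \<Longrightarrow> exec i (s\<lparr>pc := a\<rparr>) = (exec i s)\<lparr>pc := Suc a\<rparr>"
  by (cases i) (auto simp: set_reg_def set_rreg_def)

lemma bit_length_mono: "x \<le> y \<Longrightarrow> bit_length x \<le> bit_length y"
  by (simp add: bit_length_def floor_log_le_iff)

lemma bit_length_pos: "1 \<le> bit_length x" by (simp add: bit_length_def)

text \<open>An instruction handles at most two numbers, addresses included. All are bounded in the
  state before it, except the literal of \<open>Const\<close>, which shows up in the state after
  it.\<close>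

lemma cost_bound:
  assumes "bounded M s" "bounded M (exec i s)"
  shows "cost i s \<le> 2 * bit_length M"
proof -
  have r: "bit_length (reg s j) \<le> bit_length M" "bit_length (mem s j) \<le> bit_length M" for j
    using assms(1) by (auto simp: bounded_def intro: bit_length_mono)
  have "bit_length x \<le> bit_length M" if "i = Const j x" for j x
    using assms(2) that by (auto simp: bounded_def set_reg_def intro!: bit_length_mono dest: spec[of _ j])
  note this[simp]
  have "Suc (bit_length (reg s j)) \<le> 2 * bit_length M" for j
    using r(1)[of j] bit_length_pos[of M] by simp
  then show ?thesis using r bit_length_pos[of M]
    by (cases i) (auto intro: add_mono order_trans[of _ "bit_length M"] simp: mult_2)
qed

lemma wp_Bas:
  assumes "nonjump i" "exec i s = s'\<lparr>pc := Suc (pc s)\<rparr>"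
    "bounded M s \<Longrightarrow> bounded M s'" "Q 1 s'"
  shows "wp M (Bas i) s Q"
  unfolding wp_def
proof (intro impI allI)
  fix xs ys assume b: "bounded M s"
  let ?P = "xs @ compile (length xs) (Bas i) @ ys"
  let ?s = "s\<lparr>pc := length xs\<rparr>"
  have ex: "(exec i s)\<lparr>pc := a\<rparr> = s'\<lparr>pc := a\<rparr>" for a using assms(2) by simp
  have bb: "bounded M ?s" "bounded M (exec i ?s)"
    using b assms(3) by (auto simp: exec_pc[OF assms(1)] ex bounded_def)
  have "reach ?P ?s (cost (?P ! pc ?s) ?s) (exec (?P ! pc ?s) ?s)"
    by (rule reach_step) simp
  then have "reach ?P ?s (cost i ?s) (s'\<lparr>pc := length xs + csize (Bas i)\<rparr>)"
    using exec_pc[OF assms(1)] ex by simp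
  then show "\<exists>t T s'. reach ?P ?s t (s'\<lparr>pc := length xs + csize (Bas i)\<rparr>) \<and>
      t \<le> T * (2 * bit_length M) \<and> bounded M s' \<and> Q T s'"
    using cost_bound[OF bb] assms(3,4) b by (intro exI[of _ "cost i ?s"] exI[of _ 1] exI[of _ s']) auto
qed

lemma wp_Const:
  "(bounded M s \<Longrightarrow> c \<le> M) \<Longrightarrow> Q 1 (s\<lparr>reg := (reg s)(i := c)\<rparr>) \<Longrightarrow> wp M (Bas (Const i c)) s Q"
  by (rule wp_Bas[where s' = "s\<lparr>reg := (reg s)(i := c)\<rparr>"]) (auto simp: set_reg_def bounded_def)

lemma wp_Add:
  "(bounded M s \<Longrightarrow> reg s j + reg s l \<le> M) \<Longrightarrow> Q 1 (s\<lparr>reg := (reg s)(i := reg s j + reg s l)\<rparr>) \<Longrightarrow>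
   wp M (Bas (Add i j l)) s Q"
  by (rule wp_Bas[where s' = "s\<lparr>reg := (reg s)(i := reg s j + reg s l)\<rparr>"])
    (auto simp: set_reg_def bounded_def)

lemma wp_Mul:
  "(bounded M s \<Longrightarrow> reg s j * reg s l \<le> M) \<Longrightarrow> Q 1 (s\<lparr>reg := (reg s)(i := reg s j * reg s l)\<rparr>) \<Longrightarrow>
   wp M (Bas (Mul i j l)) s Q"
  by (rule wp_Bas[where s' = "s\<lparr>reg := (reg s)(i := reg s j * reg s l)\<rparr>"])
    (auto simp: set_reg_def bounded_def)

lemma wp_Sub:
  "Q 1 (s\<lparr>reg := (reg s)(i := reg s j - reg s l)\<rparr>) \<Longrightarrow> wp M (Bas (Sub i j l)) s Q"
  by (rule wp_Bas[where s' = "s\<lparr>reg := (reg s)(i := reg s j - reg s l)\<rparr>"])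
    (auto simp: set_reg_def bounded_def intro: le_trans[OF diff_le_self])

lemma wp_Div:
  "Q 1 (s\<lparr>reg := (reg s)(i := reg s j div reg s l)\<rparr>) \<Longrightarrow> wp M (Bas (Div i j l)) s Q"
  by (rule wp_Bas[where s' = "s\<lparr>reg := (reg s)(i := reg s j div reg s l)\<rparr>"])
    (auto simp: set_reg_def bounded_def intro: le_trans[OF div_le_dividend])

lemma wp_Load:
  "Q 1 (s\<lparr>reg := (reg s)(i := mem s (reg s j))\<rparr>) \<Longrightarrow> wp M (Bas (Load i j)) s Q"
  by (rule wp_Bas[where s' = "s\<lparr>reg := (reg s)(i := mem s (reg s j))\<rparr>"])
    (auto simp: set_reg_def bounded_def)

lemma wp_Store:
  "Q 1 (s\<lparr>mem := (mem s)(reg s i := reg s j)\<rparr>) \<Longrightarrow> wp M (Bas (Store i j)) s Q"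
  by (rule wp_Bas[where s' = "s\<lparr>mem := (mem s)(reg s i := reg s j)\<rparr>"]) (auto simp: bounded_def)

lemma wp_RAdd:
  "Q 1 (s\<lparr>rreg := (rreg s)(i := rreg s j + rreg s l)\<rparr>) \<Longrightarrow> wp M (Bas (RAdd i j l)) s Q"
  by (rule wp_Bas[where s' = "s\<lparr>rreg := (rreg s)(i := rreg s j + rreg s l)\<rparr>"])
    (auto simp: set_rreg_def bounded_def)

lemma wp_RLoad:
  "Q 1 (s\<lparr>rreg := (rreg s)(i := rmem s (reg s j))\<rparr>) \<Longrightarrow> wp M (Bas (RLoad i j)) s Q"
  by (rule wp_Bas[where s' = "s\<lparr>rreg := (rreg s)(i := rmem s (reg s j))\<rparr>"])
    (auto simp: set_rreg_def bounded_def)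

lemma wp_RStore:
  "Q 1 (s\<lparr>rmem := (rmem s)(reg s i := rreg s j)\<rparr>) \<Longrightarrow> wp M (Bas (RStore i j)) s Q"
  by (rule wp_Bas[where s' = "s\<lparr>rmem := (rmem s)(reg s i := rreg s j)\<rparr>"]) (auto simp: bounded_def)

lemma reach_instr:
  assumes "P = xs @ i # ys" "pc s = length xs" "bounded M s" "bounded M (exec i s)"
    "exec i s = s'"
  shows "\<exists>t \<le> 2 * bit_length M. reach P s t s'"
proof -
  have "reach P s (cost i s) (exec i s)" using reach_step[of s P] assms(1,2) by simp
  then show ?thesis using cost_bound[OF assms(3,4)] assms(5) by blast
qed

text \<open>Shared by comparisons of naturals and of reals, with \<open>b\<close> the outcome of the
  test. Both outcomes are charged 2 instructions, although only the branch \<open>c2\<close>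
  executes the closing \<open>Jump\<close>.\<close>

lemma wp_branch:
  assumes P: "P = xs @ j # compile (Suc (length xs)) c2 @
      Jump (length xs + csize c2 + csize c1 + 2) # compile (length xs + csize c2 + 2) c1 @ ys"
    and j: "exec j (s\<lparr>pc := length xs\<rparr>) = s\<lparr>pc := if b then length xs + csize c2 + 2 else Suc (length xs)\<rparr>"
    and 1: "b \<Longrightarrow> wp M c1 s (\<lambda>t. Q (t + 2))" and 2: "\<not> b \<Longrightarrow> wp M c2 s (\<lambda>t. Q (t + 2))"
    and bs: "bounded M s"
  shows "\<exists>t T s'. reach P (s\<lparr>pc := length xs\<rparr>) t (s'\<lparr>pc := length xs + (csize c1 + csize c2 + 2)\<rparr>) \<and>
        t \<le> T * (2 * bit_length M) \<and> bounded M s' \<and> Q T s'"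
proof -
  let ?a = "length xs"
  obtain t0 where t0: "t0 \<le> 2 * bit_length M"
    "reach P (s\<lparr>pc := ?a\<rparr>) t0 (s\<lparr>pc := if b then ?a + csize c2 + 2 else Suc ?a\<rparr>)"
    using reach_instr[OF P, of "s\<lparr>pc := ?a\<rparr>" M] bs j by (auto simp: bounded_def)
  show ?thesis
  proof (cases b)
    case True
    let ?xs = "xs @ j # compile (Suc ?a) c2 @ [Jump (?a + csize c2 + csize c1 + 2)]"
    have eq: "P = ?xs @ compile (length ?xs) c1 @ ys" using P by (simp add: add.commute)
    obtain t T s' where "reach P (s\<lparr>pc := length ?xs\<rparr>) t (s'\<lparr>pc := length ?xs + csize c1\<rparr>)"
      "t \<le> T * (2 * bit_length M)" "bounded M s'" "Q (T + 2) s'"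
      using 1[OF True] bs unfolding wp_def eq by blast
    then show ?thesis using reach_trans[OF t0(2), of t "s'\<lparr>pc := length ?xs + csize c1\<rparr>"] t0(1) True
      by (intro exI[of _ "t0 + t"] exI[of _ "T + 2"] exI[of _ s']) (auto simp: algebra_simps)
  next
    case False
    let ?xs = "xs @ [j]"
    let ?ys = "Jump (?a + csize c2 + csize c1 + 2) # compile (?a + csize c2 + 2) c1 @ ys"
    have eq: "P = ?xs @ compile (length ?xs) c2 @ ?ys" using P by simp
    obtain t T s' where t: "reach P (s\<lparr>pc := length ?xs\<rparr>) t (s'\<lparr>pc := length ?xs + csize c2\<rparr>)"
      "t \<le> T * (2 * bit_length M)" "bounded M s'" "Q (T + 2) s'"
      using 2[OF False] bs unfolding wp_def eq by blast
    have eq2: "P = (?xs @ compile (length ?xs) c2) @ Jump (?a + csize c2 + csize c1 + 2) #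
        (compile (?a + csize c2 + 2) c1 @ ys)" using P by simp
    obtain t1 where t1: "t1 \<le> 2 * bit_length M" "reach P (s'\<lparr>pc := length ?xs + csize c2\<rparr>) t1
        (s'\<lparr>pc := ?a + (csize c1 + csize c2 + 2)\<rparr>)"
      using reach_instr[OF eq2, of "s'\<lparr>pc := length ?xs + csize c2\<rparr>" M
          "s'\<lparr>pc := ?a + (csize c1 + csize c2 + 2)\<rparr>"] t(3)
      by (auto simp: bounded_def algebra_simps)
    show ?thesis
      using reach_trans[OF reach_trans[OF t0(2)] t1(2), of t] t t0(1) t1(1) False
      by (intro exI[of _ "t0 + t + t1"] exI[of _ "T + 2"] exI[of _ s']) (auto simp: algebra_simps)
  qed
qed

lemma wp_IfLe:
  assumes "reg s i \<le> reg s j \<Longrightarrow> wp M c1 s (\<lambda>t. Q (t + 2))"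
    "reg s j < reg s i \<Longrightarrow> wp M c2 s (\<lambda>t. Q (t + 2))"
  shows "wp M (IfLe i j c1 c2) s Q"
  unfolding wp_def
proof (intro impI allI)
  fix xs ys assume bs: "bounded M s"
  show "\<exists>t T s'. reach (xs @ compile (length xs) (IfLe i j c1 c2) @ ys) (s\<lparr>pc := length xs\<rparr>) t
           (s'\<lparr>pc := length xs + csize (IfLe i j c1 c2)\<rparr>) \<and>
        t \<le> T * (2 * bit_length M) \<and> bounded M s' \<and> Q T s'"
    using wp_branch[of "xs @ compile (length xs) (IfLe i j c1 c2) @ ys" xs
        "JumpLe i j (length xs + csize c2 + 2)" c2 c1 ys s "reg s i \<le> reg s j" M Q] assms bs
    by auto
qed

lemma wp_IfRLe:
  assumes "rreg s i \<le> rreg s j \<Longrightarrow> wp M c1 s (\<lambda>t. Q (t + 2))"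
    "rreg s j < rreg s i \<Longrightarrow> wp M c2 s (\<lambda>t. Q (t + 2))"
  shows "wp M (IfRLe i j c1 c2) s Q"
  unfolding wp_def
proof (intro impI allI)
  fix xs ys assume bs: "bounded M s"
  show "\<exists>t T s'. reach (xs @ compile (length xs) (IfRLe i j c1 c2) @ ys) (s\<lparr>pc := length xs\<rparr>) t
           (s'\<lparr>pc := length xs + csize (IfRLe i j c1 c2)\<rparr>) \<and>
        t \<le> T * (2 * bit_length M) \<and> bounded M s' \<and> Q T s'"
    using wp_branch[of "xs @ compile (length xs) (IfRLe i j c1 c2) @ ys" xs
        "RJumpLe i j (length xs + csize c2 + 2)" c2 c1 ys s "rreg s i \<le> rreg s j" M Q] assms bs
    by auto
qed

text \<open>Each round is charged its body, the test and the jump back, hence \<open>T + 2\<close>;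
  the final 1 is the test that exits.\<close>

lemma wp_WhileGt:
  fixes \<mu> :: "machine_state \<Rightarrow> nat"
  assumes "I s"
    and "\<And>s t. bounded M s \<Longrightarrow> I s \<Longrightarrow> reg s i \<le> reg s j \<Longrightarrow> t \<le> T' \<Longrightarrow> Q t s"
    and "\<And>s. bounded M s \<Longrightarrow> I s \<Longrightarrow> reg s j < reg s i \<Longrightarrow>
           0 < \<mu> s \<and> wp M c s (\<lambda>t s'. I s' \<and> \<mu> s' < \<mu> s \<and> t \<le> T)"
    and "\<mu> s * (T + 2) + 1 \<le> T'"
  shows "wp M (WhileGt i j c) s Q"
  unfolding wp_def
proof (intro impI allI)
  fix xs ys assume bs: "bounded M s"
  let ?w = "WhileGt i j c"
  let ?P = "xs @ compile (length xs) ?w @ ys"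
  let ?a = "length xs"
  let ?\<beta> = "2 * bit_length M"
  have "\<exists>t s'. reach ?P (s\<lparr>pc := ?a\<rparr>) t (s'\<lparr>pc := ?a + csize ?w\<rparr>) \<and>
      t \<le> (\<mu> s * (T + 2) + 1) * ?\<beta> \<and> bounded M s' \<and> I s' \<and> reg s' i \<le> reg s' j"
    using assms(1) bs
  proof (induction "\<mu> s" arbitrary: s rule: less_induct)
    case less
    have eq: "?P = xs @ JumpLe i j (?a + csize c + 2) # (compile (Suc ?a) c @ [Jump ?a] @ ys)" by simp
    let ?next = "s\<lparr>pc := if reg s i \<le> reg s j then ?a + csize c + 2 else Suc ?a\<rparr>"
    obtain t0 where t0: "t0 \<le> ?\<beta>" "reach ?P (s\<lparr>pc := ?a\<rparr>) t0 ?next"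
      using reach_instr[OF eq, of "s\<lparr>pc := ?a\<rparr>" M ?next] less.prems
      by (auto simp: bounded_def)
    show ?case
    proof (cases "reg s i \<le> reg s j")
      case True
      then show ?thesis using t0 less.prems by (intro exI[of _ t0] exI[of _ s]) auto
    next
      case False
      then have pos: "0 < \<mu> s" and body: "wp M c s (\<lambda>t s'. I s' \<and> \<mu> s' < \<mu> s \<and> t \<le> T)"
        using assms(3) less.prems by auto
      let ?xs = "xs @ [JumpLe i j (?a + csize c + 2)]"
      have eq1: "?P = ?xs @ compile (length ?xs) c @ ([Jump ?a] @ ys)" by simp
      obtain t1 s1 where 1: "reach ?P (s\<lparr>pc := length ?xs\<rparr>) t1 (s1\<lparr>pc := length ?xs + csize c\<rparr>)"
        "t1 \<le> T * ?\<beta>" "bounded M s1" "I s1" "\<mu> s1 < \<mu> s"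
        using body less.prems unfolding wp_def eq1 by (meson le_trans mult_le_mono1)
      have eq2: "?P = (?xs @ compile (length ?xs) c) @ Jump ?a # ys" by simp
      obtain t2 where 2: "t2 \<le> ?\<beta>" "reach ?P (s1\<lparr>pc := length ?xs + csize c\<rparr>) t2 (s1\<lparr>pc := ?a\<rparr>)"
        using reach_instr[OF eq2, of "s1\<lparr>pc := length ?xs + csize c\<rparr>" M "s1\<lparr>pc := ?a\<rparr>"] 1(3)
        by (auto simp: bounded_def)
      obtain t3 s' where 3: "reach ?P (s1\<lparr>pc := ?a\<rparr>) t3 (s'\<lparr>pc := ?a + csize ?w\<rparr>)"
        "t3 \<le> (\<mu> s1 * (T + 2) + 1) * ?\<beta>" "bounded M s'" "I s'" "reg s' i \<le> reg s' j"
        using less.hyps[OF 1(5) 1(4) 1(3)] by blast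
      have "reach ?P (s\<lparr>pc := ?a\<rparr>) (t0 + (t1 + (t2 + t3))) (s'\<lparr>pc := ?a + csize ?w\<rparr>)"
        using t0(2) False 1(1) 2(2) 3(1) by (auto intro!: reach_trans)
      moreover have "t0 + (t1 + (t2 + t3)) \<le> (\<mu> s * (T + 2) + 1) * ?\<beta>"
      proof -
        have "\<mu> s1 * (T + 2) + (T + 2) \<le> \<mu> s * (T + 2)"
          using 1(5) mult_le_mono1[of "Suc (\<mu> s1)" "\<mu> s" "T + 2"] by simp
        then have "(\<mu> s1 * (T + 2) + (T + 2) + 1) * ?\<beta> \<le> (\<mu> s * (T + 2) + 1) * ?\<beta>"
          by (intro mult_le_mono1) simp
        moreover have "t0 + (t1 + (t2 + t3)) \<le> (\<mu> s1 * (T + 2) + (T + 2) + 1) * ?\<beta>"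
          using t0(1) 1(2) 2(1) 3(2) by (simp add: algebra_simps)
        ultimately show ?thesis by linarith
      qed
      ultimately show ?thesis using 3(3-5) by blast
    qed
  qed
  then obtain t s' where "reach ?P (s\<lparr>pc := ?a\<rparr>) t (s'\<lparr>pc := ?a + csize ?w\<rparr>)"
    "t \<le> (\<mu> s * (T + 2) + 1) * ?\<beta>" "bounded M s'" "I s'" "reg s' i \<le> reg s' j" by blast
  then show "\<exists>t T s'. reach ?P (s\<lparr>pc := ?a\<rparr>) t (s'\<lparr>pc := ?a + csize ?w\<rparr>) \<and>
      t \<le> T * ?\<beta> \<and> bounded M s' \<and> Q T s'" using assms(2)[of s' "\<mu> s * (T + 2) + 1"] assms(4) by blast
qed

lemma wp_Call: "wp M c s Q \<Longrightarrow> wp M (Call c) s Q"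
  by (simp add: wp_def)

lemma wp_boundedI: "(bounded M s \<Longrightarrow> wp M c s Q) \<Longrightarrow> wp M c s Q"
  by (simp add: wp_def)

lemma boundedD: "bounded M s \<Longrightarrow> reg s i \<le> M" "bounded M s \<Longrightarrow> mem s i \<le> M"
  by (simp_all add: bounded_def)

fun ivc :: "nat \<Rightarrow> instr \<Rightarrow> machine_state \<Rightarrow> (machine_state \<Rightarrow> bool) \<Rightarrow> bool" where
  "ivc M (Const i c) s Q \<longleftrightarrow> c \<le> M \<and> Q (s\<lparr>reg := (reg s)(i := c)\<rparr>)"
| "ivc M (Add i j l) s Q \<longleftrightarrow> reg s j + reg s l \<le> M \<and> Q (s\<lparr>reg := (reg s)(i := reg s j + reg s l)\<rparr>)"
| "ivc M (Mul i j l) s Q \<longleftrightarrow> reg s j * reg s l \<le> M \<and> Q (s\<lparr>reg := (reg s)(i := reg s j * reg s l)\<rparr>)"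
| "ivc M (Sub i j l) s Q \<longleftrightarrow> Q (s\<lparr>reg := (reg s)(i := reg s j - reg s l)\<rparr>)"
| "ivc M (Div i j l) s Q \<longleftrightarrow> Q (s\<lparr>reg := (reg s)(i := reg s j div reg s l)\<rparr>)"
| "ivc M (Load i j) s Q \<longleftrightarrow> Q (s\<lparr>reg := (reg s)(i := mem s (reg s j))\<rparr>)"
| "ivc M (Store i j) s Q \<longleftrightarrow> Q (s\<lparr>mem := (mem s)(reg s i := reg s j)\<rparr>)"
| "ivc M (RAdd i j l) s Q \<longleftrightarrow> Q (s\<lparr>rreg := (rreg s)(i := rreg s j + rreg s l)\<rparr>)"
| "ivc M (RLoad i j) s Q \<longleftrightarrow> Q (s\<lparr>rreg := (rreg s)(i := rmem s (reg s j))\<rparr>)"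
| "ivc M (RStore i j) s Q \<longleftrightarrow> Q (s\<lparr>rmem := (rmem s)(reg s i := rreg s j)\<rparr>)"
| "ivc M _ s Q \<longleftrightarrow> False"

text \<open>
  Verification conditions that the simplifier computes by symbolic execution; it stops at loops
  and at calls.
\<close>

primrec vc :: "nat \<Rightarrow> com \<Rightarrow> machine_state \<Rightarrow> (nat \<Rightarrow> machine_state \<Rightarrow> bool) \<Rightarrow> bool" where
  "vc M Skip s Q \<longleftrightarrow> Q 0 s"
| "vc M (Bas i) s Q \<longleftrightarrow> ivc M i s (Q 1)"
| "vc M (c1 ;; c2) s Q \<longleftrightarrow> vc M c1 s (\<lambda>t s'. vc M c2 s' (\<lambda>u. Q (t + u)))"
| "vc M (IfLe i j c1 c2) s Q \<longleftrightarrow>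
     (if reg s i \<le> reg s j then vc M c1 s (\<lambda>t. Q (t + 2)) else vc M c2 s (\<lambda>t. Q (t + 2)))"
| "vc M (IfRLe i j c1 c2) s Q \<longleftrightarrow>
     (if rreg s i \<le> rreg s j then vc M c1 s (\<lambda>t. Q (t + 2)) else vc M c2 s (\<lambda>t. Q (t + 2)))"
| "vc M (WhileGt i j c) s Q \<longleftrightarrow> wp M (WhileGt i j c) s Q"
| "vc M (Call c) s Q \<longleftrightarrow> wp M c s Q"

lemma wp_ivc: "ivc M i s (Q 1) \<Longrightarrow> wp M (Bas i) s Q"
  by (cases i) (auto intro: wp_Const wp_Add wp_Mul wp_Sub wp_Div wp_Load wp_Store wp_RAdd wp_RLoad
      wp_RStore)

lemma wp_vc: "vc M c s Q \<Longrightarrow> wp M c s Q"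
proof (induction c arbitrary: s Q)
  case (Seq c1 c2)
  from Seq.prems have "wp M c1 s (\<lambda>t s'. vc M c2 s' (\<lambda>u. Q (t + u)))" by (auto intro: Seq.IH(1))
  then show ?case by (rule wp_Seq[OF wp_conseq]) (rule Seq.IH(2))
qed (auto intro: wp_Skip wp_ivc wp_IfLe wp_IfRLe wp_Call split: if_splits)

text \<open>Weak congruence: the simplifier rewrites only the state, so symbolic execution follows
  program order and does not descend into continuations too early.\<close>

lemma wp_cong [cong]: "s = s' \<Longrightarrow> wp M c s Q = wp M c s' Q"
  by simp

lemma vc_cong [cong]: "s = s' \<Longrightarrow> vc M c s Q = vc M c s' Q"
  by simp

lemma ivc_cong [cong]: "s = s' \<Longrightarrow> ivc M i s Q = ivc M i s' Q"
  by simp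

section \<open>Codes of vertex states\<close>

definition dig :: "nat \<Rightarrow> nat \<Rightarrow> nat" where
  "dig c x = c div 4 ^ x mod 4"

lemma dig_less: "dig c x < 4" by (simp add: dig_def)

lemma dig_0: "dig c 0 = c mod 4" by (simp add: dig_def)

lemma dig_Suc: "dig c (Suc x) = dig (c div 4) x" by (simp add: dig_def div_mult2_eq)

lemma dig_of_0 [simp]: "dig 0 x = 0" by (simp add: dig_def)

lemma dig_outside: "c < 4 ^ n \<Longrightarrow> n \<le> x \<Longrightarrow> dig c x = 0"
proof -
  assume "c < 4 ^ n" "n \<le> x"
  then have "c < 4 ^ x" using power_increasing[of n x "4::nat"] by linarith
  then show ?thesis by (simp add: dig_def)
qed

lemma dig_inject: "dig c = dig c' \<Longrightarrow> c = c'"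
proof (induction c arbitrary: c' rule: less_induct)
  case (less c)
  have m: "c mod 4 = c' mod 4" using less.prems dig_0 by metis
  have d: "dig (c div 4) = dig (c' div 4)" using less.prems by (metis dig_Suc ext)
  show ?case
  proof (cases "c = 0")
    case True
    show ?thesis
    proof (rule ccontr)
      assume "c \<noteq> c'"
      then have "c' \<noteq> 0" using True by simp
      have "dig c' x = 0" for x using less.prems True by (metis dig_of_0)
      moreover have "\<exists>x. dig c' x \<noteq> 0" using \<open>c' \<noteq> 0\<close>
      proof (induction c' rule: less_induct)
        case (less b)
        show ?case
        proof (cases "b mod 4 = 0")
          case True
          then have "b div 4 \<noteq> 0" "b div 4 < b" using less.prems by auto
          then show ?thesis using less.IH dig_Suc by metis
        qed (metis dig_0)
      qed
      ultimately show False by simp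
    qed
  next
    case False
    then have "c div 4 = c' div 4" using less.IH[OF _ d] by simp
    then show ?thesis using m by (metis div_mult_mod_eq)
  qed
qed

text \<open>The assumption rules out a carry, so the program can change a single digit by adding a
  multiple of \<open>4 ^ x\<close>.\<close>

lemma dig_add:
  assumes "dig c x + e < 4"
  shows "dig (c + e * 4 ^ x) y = dig c y + (if y = x then e else 0)"
proof -
  let ?q = "c div 4 ^ x"
  have q: "?q mod 4 + e < 4" using assms by (simp add: dig_def)
  have cx: "(c + e * 4 ^ x) div 4 ^ x = ?q + e" by simp
  have "y = x \<or> (\<exists>i. y = x + Suc i) \<or> (\<exists>i. x = y + Suc i)" by presburger
  then consider "y = x" | i where "y = x + Suc i" | i where "x = y + Suc i" by blast
  then show ?thesis
  proof cases
    case 1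
    have "(?q + e) mod 4 = ?q mod 4 + e" using q by (metis mod_add_left_eq mod_less)
    then show ?thesis unfolding dig_def 1 cx by simp
  next
    case 2
    have "?q + e = (?q mod 4 + e) + 4 * (?q div 4)" by simp
    then have "(?q + e) div 4 = (?q mod 4 + e) div 4 + ?q div 4"
      by (metis add.commute div_mult_self2 zero_neq_numeral)
    then have "(?q + e) div 4 = ?q div 4" using q by simp
    then have "(?q + e) div 4 ^ Suc i = ?q div 4 ^ Suc i" by (simp add: div_mult2_eq)
    then have "(c + e * 4 ^ x) div 4 ^ y = c div 4 ^ y"
      using 2 cx by (simp only: power_add div_mult2_eq)
    then show ?thesis using 2 by (simp add: dig_def)
  next
    case 3
    have "e * 4 ^ x = (4 * (e * 4 ^ i)) * 4 ^ y" using 3 by (simp add: power_add)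
    then have "(c + e * 4 ^ x) div 4 ^ y = c div 4 ^ y + 4 * (e * 4 ^ i)"
      by (metis add.commute div_mult_self1 power_eq_0_iff zero_neq_numeral)
    then show ?thesis using 3 by (simp add: dig_def)
  qed
qed

lemma code_exists:
  assumes "\<And>x. d x < 4" "\<And>x. n \<le> x \<Longrightarrow> d x = 0"
  shows "\<exists>c < 4 ^ n. dig c = d"
  using assms
proof (induction n arbitrary: d)
  case 0
  then show ?case by (intro exI[of _ 0]) auto
next
  case (Suc n)
  obtain c where c: "c < 4 ^ n" "dig c = (\<lambda>x. d (Suc x))" using Suc.IH[of "\<lambda>x. d (Suc x)"] Suc.prems by auto
  have "dig (d 0 + 4 * c) x = d x" for x
    using Suc.prems(1)[of 0] c(2) by (cases x) (auto simp: dig_0 dig_Suc)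
  moreover have "d 0 + 4 * c < 4 ^ Suc n" using Suc.prems(1)[of 0] c(1) by simp
  ultimately show ?case by blast
qed

text \<open>By \<open>code_exists\<close> these digits belong to some code below
  \<open>4 ^ n\<close>, which by injectivity is \<open>c\<close> itself.\<close>

lemma code_less:
  assumes "\<And>x. n \<le> x \<Longrightarrow> dig c x = 0" shows "c < 4 ^ n"
  using code_exists[of "dig c" n] dig_less assms dig_inject by metis

lemma dig_final: "dig (4 ^ n - Suc 0) x = (if x < n then 3 else 0)"
proof (induction n arbitrary: x)
  case (Suc n)
  have "(1::nat) \<le> 4 ^ n" by (rule one_le_power) simp
  then obtain m where "(4::nat) ^ n = Suc m" by (metis One_nat_def Suc_le_D)
  then have "(4::nat) ^ Suc n - Suc 0 = 3 + 4 * (4 ^ n - Suc 0)" by simp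
  then show ?case using Suc by (cases x) (auto simp: dig_0 dig_Suc simp del: power_Suc)
qed simp

lemma active_Suc: "active (Suc n) d = active n d \<union> (if d n = 1 \<or> d n = 2 then {n} else {})"
  by (auto simp: active_def less_Suc_eq)

lemma active_shift:
  assumes "e < 4"
  shows "card (active (Suc n) (dig (4 * c + e))) = (if e = 1 \<or> e = 2 then 1 else 0) + card (active n (dig c))"
proof -
  have "active (Suc n) (dig (4 * c + e)) =
      (if e = 1 \<or> e = 2 then {0} else {}) \<union> Suc ` active n (dig c)"
  proof (intro set_eqI)
    fix x show "x \<in> active (Suc n) (dig (4 * c + e)) \<longleftrightarrow>
        x \<in> (if e = 1 \<or> e = 2 then {0} else {}) \<union> Suc ` active n (dig c)"
      using assms by (cases x) (auto simp: active_def dig_0 dig_Suc)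
  qed
  then show ?thesis by (simp add: card_image card_Un_disjoint)
qed

text \<open>Generating function of the number of active vertices: each vertex has two inactive
  states of weight 1 and two active ones of weight \<open>q\<close>, hence contributes a factor
  \<open>2 + 2 * q\<close>.\<close>

lemma sum_active:
  fixes q :: real
  shows "(\<Sum>c<4 ^ n. q ^ card (active n (dig c))) = (2 + 2 * q) ^ n"
proof (induction n)
  case 0
  then show ?case by (simp add: active_def)
next
  case (Suc n)
  let ?g = "\<lambda>n c. q ^ card (active n (dig c))"
  have "(\<Sum>c<4 ^ Suc n. ?g (Suc n) c) = (\<Sum>c<4 ^ n. \<Sum>b\<in>{c * 4..<c * 4 + 4}. ?g (Suc n) b)"
    by (simp add: sum.nat_group mult.commute)
  also have "\<dots> = (\<Sum>c<4 ^ n. (2 + 2 * q) * ?g n c)"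
  proof (rule sum.cong[OF refl])
    fix c :: nat
    have "{c * 4..<c * 4 + 4} = {4 * c + 0, 4 * c + 1, 4 * c + 2, 4 * c + 3}" by auto
    then have "(\<Sum>b\<in>{c * 4..<c * 4 + 4}. ?g (Suc n) b) =
        ?g (Suc n) (4 * c + 0) + ?g (Suc n) (4 * c + 1) + ?g (Suc n) (4 * c + 2) + ?g (Suc n) (4 * c + 3)"
      by simp
    also have "\<dots> = (2 + 2 * q) * ?g n c"
      by (simp only: active_shift) (simp add: algebra_simps)
    finally show "(\<Sum>b\<in>{c * 4..<c * 4 + 4}. ?g (Suc n) b) = (2 + 2 * q) * ?g n c" .
  qed
  finally show ?case using Suc by (simp add: sum_distrib_left[symmetric])
qed

text \<open>Markov's inequality for the weights \<open>N\<^sup>-\<^sup>a\<close>, where \<open>a\<close> is the number of active vertices.\<close>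

lemma card_narrow_codes:
  fixes N :: real
  assumes "N \<ge> 1"
  shows "real (card {c. c < 4 ^ n \<and> card (active n (dig c)) \<le> W}) \<le> N ^ W * (2 + 2 / N) ^ n"
proof -
  let ?S = "{c. c < 4 ^ n \<and> card (active n (dig c)) \<le> W}"
  let ?a = "\<lambda>c. card (active n (dig c))"
  have "real (card ?S) = (\<Sum>c\<in>?S. 1)" by simp
  also have "\<dots> \<le> (\<Sum>c\<in>?S. N ^ W * (1 / N) ^ ?a c)"
  proof (rule sum_mono)
    fix c assume "c \<in> ?S"
    then have "N ^ ?a c \<le> N ^ W" using assms by (intro power_increasing) auto
    then show "1 \<le> N ^ W * (1 / N) ^ ?a c" using assms by (simp add: power_divide field_simps)
  qed
  also have "\<dots> \<le> (\<Sum>c<4 ^ n. N ^ W * (1 / N) ^ ?a c)"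
    using assms by (intro sum_mono2) auto
  also have "\<dots> = N ^ W * (2 + 2 / N) ^ n"
    using sum_active[of "1 / N" n] by (simp add: sum_distrib_left[symmetric])
  finally show ?thesis .
qed

section \<open>Breadth-first dynamic programming\<close>

locale polytree_problem =
  fixes n k :: nat and F :: "nat \<Rightarrow> nat set set" and f :: "nat \<Rightarrow> nat set \<Rightarrow> real"
  assumes inst: "polytree_instance {..<n} F f" and deg: "indegree_bounded k {..<n} F"
begin

definition W :: nat where "W = width k n"

definition trans :: "nat \<Rightarrow> nat \<Rightarrow> nat \<Rightarrow> nat set \<Rightarrow> nat \<Rightarrow> bool" where
  "trans c c' v S r \<longleftrightarrow> v < n \<and> S \<in> F v \<and> r \<le> n \<and> assign v S r (dig c) (dig c') \<and>
     c < 4 ^ n \<and> c' < 4 ^ n \<and> card (active n (dig c')) \<le> W"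

definition level :: "nat \<Rightarrow> nat" where "level c = card (assigned n (dig c))"

lemma F_sub: "v < n \<Longrightarrow> S \<in> F v \<Longrightarrow> S \<subseteq> {..<n} - {v}"
  using inst by (fastforce simp: polytree_instance_def)

lemma level_trans: "trans c c' v S r \<Longrightarrow> level c' = Suc (level c)"
proof -
  assume t: "trans c c' v S r"
  then have "v \<notin> S" using F_sub[of v S] by (auto simp: trans_def)
  then show ?thesis
    using t assigned_assign[of v S r "dig c" "dig c'" n] by (auto simp: trans_def level_def)
qed

lemma level_0 [simp]: "level 0 = 0" by (simp add: level_def assigned_def)

lemma trans_unique: "trans c c1 v S r \<Longrightarrow> trans c c2 v S r \<Longrightarrow> c1 = c2"
  by (rule dig_inject) (auto simp: trans_def assign_def fun_eq_iff)

text \<open>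
  \<open>Q\<close> is the queue with its first \<open>h\<close> entries expanded, \<open>R\<close> the transitions already tried from
  entry \<open>h\<close>, \<open>prv\<close> is one more than the predecessor of a visited code and \<open>0\<close> for other codes,
  and \<open>E v p S\<close> says that \<open>p\<close> is a reference to the parent set \<open>S\<close> of \<open>v\<close>.
\<close>

definition dp_inv where
  "dp_inv E Q h prv bv bp sc R \<longleftrightarrow>
     0 < length Q \<and> Q ! 0 = 0 \<and> distinct Q \<and> h \<le> length Q \<and> sc 0 = (0::real) \<and>
     (\<forall>c<4 ^ n. prv c \<noteq> (0::nat) \<longleftrightarrow> c \<in> set Q) \<and>
     (\<forall>c\<in>set Q. c < 4 ^ n \<and> card (active n (dig c)) \<le> W) \<and>
     sorted (map level Q) \<and>
     (h < length Q \<longrightarrow> (\<forall>c\<in>set Q. level c \<le> Suc (level (Q ! h)))) \<and>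
     (\<forall>c\<in>set Q. c \<noteq> 0 \<longrightarrow> (\<exists>c' S r. prv c = Suc c' \<and> c' \<in> set (take (Suc h) Q) \<and>
        E (bv c) (bp c) S \<and> trans c' c (bv c) S r \<and> sc c = sc c' + f (bv c) S)) \<and>
     (\<forall>i<h. \<forall>v S r c'. trans (Q ! i) c' v S r \<longrightarrow> c' \<in> set Q \<and> sc (Q ! i) + f v S \<le> sc c') \<and>
     (\<forall>v S r c'. (v, S, r) \<in> R \<longrightarrow> trans (Q ! h) c' v S r \<longrightarrow>
        c' \<in> set Q \<and> sc (Q ! h) + f v S \<le> sc c')"

lemma dp_inv_init:
  assumes "\<And>c. c < 4 ^ n \<Longrightarrow> prv c \<noteq> 0 \<longleftrightarrow> c = 0" "sc 0 = 0"
  shows "dp_inv E [0] 0 prv bv bp sc {}"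
  using assms by (auto simp: dp_inv_def active_def)

lemma dp_inv_skip:
  assumes "dp_inv E Q h prv bv bp sc R" "\<And>c'. \<not> trans (Q ! h) c' v S r"
  shows "dp_inv E Q h prv bv bp sc (insert (v, S, r) R)"
  using assms unfolding dp_inv_def by blast

text \<open>The target is one level above entry \<open>h\<close> and the queue is sorted by level,
  so it is not among the first \<open>h + 1\<close> entries. Overwriting its score and predecessor
  therefore touches neither an expanded entry nor any code in use as a predecessor, and the sums
  recorded along predecessors stay exact.\<close>

lemma dp_inv_relax:
  assumes dp: "dp_inv E Q h prv bv bp sc R" and h: "h < length Q"
    and tr: "trans (Q ! h) c v S r" and E: "E v p S"
    and upd: "c \<notin> set Q \<or> sc c < sc (Q ! h) + f v S"
  shows "dp_inv E (if c \<in> set Q then Q else Q @ [c]) h (prv(c := Suc (Q ! h))) (bv(c := v))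
           (bp(c := p)) (sc(c := sc (Q ! h) + f v S)) (insert (v, S, r) R)"
proof -
  let ?q = "Q ! h" and ?Q = "if c \<in> set Q then Q else Q @ [c]"
  let ?sc = "sc(c := sc ?q + f v S)"
  note D = dp[unfolded dp_inv_def]
  have lc: "level c = Suc (level ?q)" using level_trans[OF tr] .
  have srt: "level (Q ! i) \<le> level (Q ! j)" if "i \<le> j" "j < length Q" for i j
    using D that sorted_iff_nth_mono[of "map level Q"] by auto
  have new: "Q ! i \<noteq> c" if "i \<le> h" for i using srt[OF that h] lc by auto
  have c0: "c \<noteq> 0" using lc level_0 by (metis Zero_not_Suc)
  have qc: "?q \<noteq> c" using new by simp
  have nth: "?Q ! i = Q ! i" if "i \<le> h" for i using that h by (auto simp: nth_append)
  have tk: "take (Suc h) ?Q = take (Suc h) Q" using h by simp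
  have tkc: "c \<notin> set (take (Suc h) Q)"
    using new h by (auto simp: in_set_conv_nth less_Suc_eq_le)
  have sq: "set ?Q = insert c (set Q)" by auto
  \<comment> \<open>Scores only grow, so the inequalities for earlier transitions survive.\<close>
  have scge: "sc x \<le> ?sc x" if "x \<in> set Q" for x using that upd by auto
  have 1: "sorted (map level ?Q)"
  proof (cases "c \<in> set Q")
    case False
    have "\<forall>x\<in>set Q. level x \<le> level c" using D h lc by auto
    then show ?thesis using False D by (auto simp: sorted_append)
  qed (use D in auto)
  have 2: "\<exists>c' S r. (prv(c := Suc ?q)) b = Suc c' \<and> c' \<in> set (take (Suc h) ?Q) \<and>
        E ((bv(c := v)) b) ((bp(c := p)) b) S \<and> trans c' b ((bv(c := v)) b) S r \<and>
        ?sc b = ?sc c' + f ((bv(c := v)) b) S" if b: "b \<in> set ?Q" "b \<noteq> 0" for b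
  proof (cases "b = c")
    case True
    have "?q \<in> set (take (Suc h) Q)" using h by (auto simp: in_set_conv_nth intro!: exI[of _ h])
    then show ?thesis using True tk E tr qc by auto
  next
    case False
    then have "b \<in> set Q" using b sq by auto
    then obtain c' S' r' where c': "prv b = Suc c'" "c' \<in> set (take (Suc h) Q)"
      "E (bv b) (bp b) S'" "trans c' b (bv b) S' r'" "sc b = sc c' + f (bv b) S'"
      using D b(2) by blast
    moreover have "c' \<noteq> c" using c'(2) tkc by auto
    ultimately show ?thesis using False tk by auto
  qed
  have 3: "c' \<in> set ?Q \<and> ?sc (?Q ! i) + f w T \<le> ?sc c'"
    if "i < h" "trans (?Q ! i) c' w T s" for i w T s c'
  proof -
    have "c' \<in> set Q" "sc (Q ! i) + f w T \<le> sc c'" using that D nth[of i] by auto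
    then show ?thesis using scge[of c'] new[of i] nth[of i] that sq by auto
  qed
  have 4: "c' \<in> set ?Q \<and> ?sc (?Q ! h) + f w T \<le> ?sc c'"
    if "(w, T, s) \<in> insert (v, S, r) R" "trans (?Q ! h) c' w T s" for w T s c'
  proof (cases "(w, T, s) = (v, S, r)")
    case True
    then have "c' = c" using trans_unique that nth[of h] tr by auto
    then show ?thesis using True nth[of h] qc sq by auto
  next
    case False
    then have "c' \<in> set Q" "sc (Q ! h) + f w T \<le> sc c'" using that D nth[of h] by auto
    then show ?thesis using scge[of c'] qc nth[of h] sq by auto
  qed
  have "?Q ! 0 = 0" using nth[of 0] D by simp
  moreover have "distinct ?Q" "h \<le> length ?Q" "?sc 0 = 0" "0 < length ?Q" using D c0 by auto
  moreover have "\<forall>b<4 ^ n. (prv(c := Suc ?q)) b \<noteq> 0 \<longleftrightarrow> b \<in> set ?Q" using D sq by auto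
  moreover have "\<forall>b\<in>set ?Q. b < 4 ^ n \<and> card (active n (dig b)) \<le> W"
    using D tr sq by (auto simp: trans_def)
  moreover have "\<forall>b\<in>set ?Q. level b \<le> Suc (level (?Q ! h))" using D h lc nth[of h] sq by auto
  ultimately show ?thesis unfolding dp_inv_def using 1 2 3 4 by blast
qed

lemma dp_inv_keep:
  assumes dp: "dp_inv E Q h prv bv bp sc R"
    and tr: "trans (Q ! h) c v S r" and upd: "c \<in> set Q" "sc (Q ! h) + f v S \<le> sc c"
  shows "dp_inv E Q h prv bv bp sc (insert (v, S, r) R)"
proof -
  have "c' = c" if "trans (Q ! h) c' v S r" for c' using trans_unique[OF that tr] .
  then show ?thesis using dp upd unfolding dp_inv_def by blast
qed

lemma dp_inv_next:
  assumes dp: "dp_inv E Q h prv bv bp sc R" and h: "h < length Q"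
    and R: "\<And>v S r. v < n \<Longrightarrow> S \<in> F v \<Longrightarrow> r \<le> n \<Longrightarrow> (v, S, r) \<in> R"
  shows "dp_inv E Q (Suc h) prv bv bp sc {}"
proof -
  note D = dp[unfolded dp_inv_def]
  have tk: "set (take (Suc h) Q) \<subseteq> set (take (Suc (Suc h)) Q)" by (rule set_take_subset_set_take) simp
  have "level (Q ! h) \<le> level (Q ! Suc h)" if "Suc h < length Q"
    using D that sorted_iff_nth_mono[of "map level Q"] by auto
  then have "Suc h < length Q \<longrightarrow> (\<forall>c\<in>set Q. level c \<le> Suc (level (Q ! Suc h)))"
    using D h by (meson Suc_le_mono le_trans)
  moreover have "c' \<in> set Q \<and> sc (Q ! i) + f v S \<le> sc c'"
    if "i < Suc h" "trans (Q ! i) c' v S r" for i v S r c'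
  proof (cases "i = h")
    case True
    then have "(v, S, r) \<in> R" using that R by (auto simp: trans_def)
    then show ?thesis using D that True by blast
  next
    case False
    then have "i < h" using that(1) by simp
    then show ?thesis using D that(2) by blast
  qed
  moreover have "\<exists>c' S r. prv c = Suc c' \<and> c' \<in> set (take (Suc (Suc h)) Q) \<and>
      E (bv c) (bp c) S \<and> trans c' c (bv c) S r \<and> sc c = sc c' + f (bv c) S"
    if "c \<in> set Q" "c \<noteq> 0" for c
    using D that tk by blast
  moreover have "Suc h \<le> length Q" using h by simp
  ultimately show ?thesis unfolding dp_inv_def using D by simp
qed

section \<open>Soundness, completeness and optimality of the tables\<close>

inductive trace :: "(nat \<Rightarrow> nat \<Rightarrow> nat set \<Rightarrow> bool) \<Rightarrow> (nat \<Rightarrow> nat) \<Rightarrow> (nat \<Rightarrow> nat) \<Rightarrow> (nat \<Rightarrow> nat) \<Rightarrow>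
    nat \<Rightarrow> (nat \<times> nat) set \<Rightarrow> nat \<Rightarrow> bool" for E prv bv bp where
  trace_0: "trace E prv bv bp 0 {} 0"
| trace_Suc: "trace E prv bv bp c A m \<Longrightarrow> c' \<noteq> 0 \<Longrightarrow> c' < 4 ^ n \<Longrightarrow> prv c' = Suc c \<Longrightarrow> E (bv c') (bp c') S \<Longrightarrow>
    trace E prv bv bp c' (A \<union> S \<times> {bv c'}) (Suc m)"

text \<open>Soundness, by induction on the level, which drops along predecessors. As
  \<open>trace\<close> refers only to table entries, the arc set can later be rebuilt by the program
  itself.\<close>

lemma dp_inv_trace:
  assumes dp: "dp_inv E Q h prv bv bp sc R" and "c \<in> set Q"
  shows "\<exists>A. trace E prv bv bp c A (level c) \<and> partial_polytree n F (dig c) A \<and>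
           sc c = (\<Sum>v\<in>assigned n (dig c). f v (parents A v))"
  using assms(2)
proof (induction "level c" arbitrary: c rule: less_induct)
  case less
  note D = dp[unfolded dp_inv_def]
  show ?case
  proof (cases "c = 0")
    case True
    have "dig 0 = (\<lambda>_. 0)" by auto
    then show ?thesis using True D partial_polytree_empty[of n F]
      by (intro exI[of _ "{}"]) (auto simp: assigned_def intro: trace_0)
  next
    case False
    then obtain c' S r where c': "prv c = Suc c'" "c' \<in> set (take (Suc h) Q)"
      "E (bv c) (bp c) S" "trans c' c (bv c) S r" "sc c = sc c' + f (bv c) S"
      using D less.prems by blast
    have lv: "level c = Suc (level c')" using level_trans[OF c'(4)] .
    have "c' \<in> set Q" using c'(2) in_set_takeD by metis
    then obtain A where A: "trace E prv bv bp c' A (level c')" "partial_polytree n F (dig c') A"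
      "sc c' = (\<Sum>v\<in>assigned n (dig c'). f v (parents A v))" using less.hyps lv by auto
    let ?v = "bv c" and ?A = "A \<union> S \<times> {bv c}"
    have v: "?v < n" "S \<in> F ?v" "assign ?v S r (dig c') (dig c)" "c < 4 ^ n"
      using c'(4) by (auto simp: trans_def)
    have S: "S \<subseteq> {..<n} - {?v}" using F_sub v by auto
    then have vS: "?v \<notin> S" by auto
    note pp = partial_polytree_assign[OF A(2) v(3) v(1) v(2) S]
    have "(\<Sum>v\<in>assigned n (dig c). f v (parents ?A v)) =
        f ?v S + (\<Sum>v\<in>assigned n (dig c'). f v (parents ?A v))"
      using assigned_assign[OF v(3) v(1) vS] pp(2) by simp
    also have "(\<Sum>v\<in>assigned n (dig c'). f v (parents ?A v)) = (\<Sum>v\<in>assigned n (dig c'). f v (parents A v))"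
      using assigned_assign(2)[OF v(3) v(1) vS] pp(3) by (intro sum.cong) metis+
    finally have "sc c = (\<Sum>v\<in>assigned n (dig c). f v (parents ?A v))" using c'(5) A(3) by simp
    moreover have "trace E prv bv bp c ?A (level c)"
      unfolding lv using trace_Suc[OF A(1) False v(4) c'(1,3)] .
    ultimately show ?thesis using pp(1) by blast
  qed
qed

text \<open>The narrow schedule of \<open>B\<close> is followed through the fully expanded queue:
  each of its states has been visited, with a score at least that of the parent sets chosen so far.
  This is where the width \<open>W\<close> has to be large enough.\<close>

lemma dp_inv_complete:
  assumes dp: "dp_inv E Q (length Q) prv bv bp sc R"
    and B: "polytree {..<n} B" "\<And>v. v < n \<Longrightarrow> parents B v \<in> F v"
  shows "4 ^ n - 1 \<in> set Q \<and> (\<Sum>v<n. f v (parents B v)) \<le> sc (4 ^ n - 1)"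
proof -
  note D = dp[unfolded dp_inv_def]
  have "card (parents B v) \<le> k" if "v < n" for v
    using deg B(2)[OF that] that by (auto simp: indegree_bounded_def)
  then obtain d' where d': "(assign_step n B W)\<^sup>*\<^sup>* (\<lambda>_. 0) d'"
      "\<forall>x. x \<noteq> n \<longrightarrow> d' x = (if x < n then 3 else 0)"
    \<comment> \<open>With \<open>r = n\<close>, which is no vertex, the whole vertex set is closed,
      and the schedule finishes every vertex.\<close>
    using narrow_schedule[OF B(1), of k "{..<n}" n "\<lambda>_. 0" W] polytree_def[of "{..<n}" B] B(1)
    by (auto simp: side_closed_def active_def W_def)
  have reach: "\<exists>c\<in>set Q. dig c = d \<and> (\<Sum>v\<in>assigned n d. f v (parents B v)) \<le> sc c"
    if "(assign_step n B W)\<^sup>*\<^sup>* (\<lambda>_. 0) d" for d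
    using that
  proof (induction rule: rtranclp_induct)
    case base
    have "dig 0 = (\<lambda>_. 0)" by auto
    moreover have "0 \<in> set Q" using D nth_mem by metis
    ultimately show ?case using D by (intro bexI[of _ 0]) (auto simp: assigned_def)
  next
    case (step d d'')
    then obtain c where c: "c \<in> set Q" "dig c = d" "(\<Sum>v\<in>assigned n d. f v (parents B v)) \<le> sc c" by blast
    obtain v r where v: "v < n" "r \<le> n" "assign v (parents B v) r d d''" "card (active n d'') \<le> W"
      using step by (auto simp: assign_step_def)
    have S: "parents B v \<in> F v" "parents B v \<subseteq> {..<n} - {v}" using B(2) F_sub v by auto
    have c4: "c < 4 ^ n" using D c(1) by blast
    have "d'' x < 4" for x
      using v(3) dig_less[of c x] c(2) by (auto simp: assign_def tgt_def)
    moreover have "d'' x = 0" if "n \<le> x" for x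
      using v(1,3) S(2) dig_outside[OF c4 that] c(2) that by (auto simp: assign_def)
    ultimately obtain c'' where c'': "c'' < 4 ^ n" "dig c'' = d''" using code_exists by metis
    obtain i where i: "i < length Q" "Q ! i = c" using c(1) by (auto simp: in_set_conv_nth)
    have "trans (Q ! i) c'' v (parents B v) r"
      using v S c(2) c4 c'' i by (auto simp: trans_def)
    then have "c'' \<in> set Q \<and> sc c + f v (parents B v) \<le> sc c''" using D i by blast
    moreover have "v \<notin> parents B v" using S by auto
    then have "(\<Sum>v\<in>assigned n d''. f v (parents B v)) =
        f v (parents B v) + (\<Sum>v\<in>assigned n d. f v (parents B v))"
      using assigned_assign[OF v(3,1)] by simp
    ultimately show ?case using c'' c(3) by (intro bexI[of _ c'']) auto
  qed
  obtain c where c: "c \<in> set Q" "dig c = d'" "(\<Sum>v\<in>assigned n d'. f v (parents B v)) \<le> sc c"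
    using reach[OF d'(1)] by blast
  have "c < 4 ^ n" using D c(1) by blast
  then have "dig c x = (if x < n then 3 else 0)" for x
    using d'(2) c(2) dig_outside[of c n x] by (cases "x = n") auto
  then have "dig c = dig (4 ^ n - 1)" by (intro ext) (simp add: dig_final)
  then have "c = 4 ^ n - 1" by (rule dig_inject)
  moreover have "assigned n d' = {..<n}" using d'(2) by (auto simp: assigned_def)
  ultimately show ?thesis using c by auto
qed

lemma score_eq:
  assumes "\<And>v. v < n \<Longrightarrow> parents A v \<in> F v"
  shows "score {..<n} F f A = ereal (\<Sum>v<n. f v (parents A v))"
  using assms by (simp add: score_def local_score_def)

text \<open>The other summands have to be kept away from \<open>\<infinity>\<close>, because adding
  \<open>-\<infinity>\<close> to it would not give \<open>-\<infinity>\<close>. Local scores are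
  real or \<open>-\<infinity>\<close>.\<close>

lemma score_MInf:
  assumes "v < n" "parents A v \<notin> F v"
  shows "score {..<n} F f A = -\<infinity>"
proof -
  have "(\<Sum>w\<in>{..<n} - {v}. local_score F f w (parents A w)) \<noteq> \<infinity>"
    by (subst sum_Pinfty) (auto simp: local_score_def)
  moreover have "score {..<n} F f A = local_score F f v (parents A v) +
      (\<Sum>w\<in>{..<n} - {v}. local_score F f w (parents A w))"
    unfolding score_def using assms(1) by (intro sum.remove) auto
  ultimately show ?thesis using assms(2) by (simp add: local_score_def)
qed

lemma level_le: "level c \<le> n"
  using card_mono[of "{..<n}" "assigned n (dig c)"] by (auto simp: level_def assigned_def)

text \<open>The empty polytree is a feasible competitor, which guarantees that the code
  \<open>4 ^ n - 1\<close> with all vertices finished is visited at all. Competitors with a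
  forbidden parent set have score \<open>-\<infinity>\<close>.\<close>

lemma dp_inv_optimal:
  assumes dp: "dp_inv E Q (length Q) prv bv bp sc R"
  shows "\<exists>A m. trace E prv bv bp (4 ^ n - 1) A m \<and> m \<le> n \<and> optimal_polytree {..<n} F f A"
proof -
  let ?c = "4 ^ n - 1 :: nat"
  have "polytree {..<n} ({} :: (nat \<times> nat) set)"
    using partial_polytree_empty[of n F] by (simp add: partial_polytree_def)
  moreover have "parents {} v \<in> F v" if "v < n" for v
    using inst that by (auto simp: parents_def polytree_instance_def)
  ultimately have "?c \<in> set Q" using dp_inv_complete[OF dp] by blast
  then obtain A where A: "trace E prv bv bp ?c A (level ?c)" "partial_polytree n F (dig ?c) A"
      "sc ?c = (\<Sum>v\<in>assigned n (dig ?c). f v (parents A v))" using dp_inv_trace[OF dp] by blast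
  have as: "assigned n (dig ?c) = {..<n}" by (auto simp: assigned_def dig_final)
  then have pF: "parents A v \<in> F v" if "v < n" for v using A(2) that by (auto simp: partial_polytree_def)
  have "score {..<n} F f B \<le> score {..<n} F f A" if B: "polytree {..<n} B" for B
  proof (cases "\<forall>v<n. parents B v \<in> F v")
    case True
    then have "(\<Sum>v<n. f v (parents B v)) \<le> sc ?c" using dp_inv_complete[OF dp B] by blast
    then show ?thesis using True A(3) as pF by (simp add: score_eq)
  next
    case False
    then show ?thesis using score_MInf by fastforce
  qed
  moreover have "polytree {..<n} A" using A(2) by (simp add: partial_polytree_def)
  ultimately show ?thesis using A(1) level_le by (auto simp: optimal_polytree_def)
qed

lemma dp_inv_length:
  assumes "dp_inv E Q h prv bv bp sc R"
  shows "length Q \<le> card {c. c < 4 ^ n \<and> card (active n (dig c)) \<le> W}"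
proof -
  have "set Q \<subseteq> {c. c < 4 ^ n \<and> card (active n (dig c)) \<le> W}" "length Q = card (set Q)"
    using assms by (auto simp: dp_inv_def distinct_card)
  then show ?thesis by (simp add: card_mono)
qed

end

section \<open>The program\<close>

text \<open>
  Registers \<open>rZ\<close>, \<open>rI\<close>, \<open>rF\<close>, \<open>rN\<close>, \<open>rM\<close>, \<open>rW\<close>, \<open>rB\<close>, \<open>rTop\<close> keep 0, 1, 4, \<open>n\<close>, \<open>n + 1\<close>, the width bound,
  the length of the input and \<open>4\<^sup>n\<close>. The first register is never written and thus stays 0.
\<close>

abbreviation (input) "rZ \<equiv> (0::nat)"
abbreviation (input) "rI \<equiv> (29::nat)"
abbreviation (input) "rF \<equiv> (2::nat)"
abbreviation (input) "rN \<equiv> (3::nat)"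
abbreviation (input) "rM \<equiv> (4::nat)"
abbreviation (input) "rW \<equiv> (5::nat)"
abbreviation (input) "rB \<equiv> (6::nat)"
abbreviation (input) "rTop \<equiv> (7::nat)"
abbreviation (input) "rHead \<equiv> (8::nat)"
abbreviation (input) "rTail \<equiv> (9::nat)"
abbreviation (input) "rC \<equiv> (10::nat)"
abbreviation (input) "rP \<equiv> (11::nat)"
abbreviation (input) "rRP \<equiv> (12::nat)"
abbreviation (input) "rV \<equiv> (13::nat)"
abbreviation (input) "rCnt \<equiv> (14::nat)"
abbreviation (input) "rR \<equiv> (15::nat)"
abbreviation (input) "rNew \<equiv> (16::nat)"
abbreviation (input) "rBad \<equiv> (17::nat)"
abbreviation (input) "rX \<equiv> (18::nat)"
abbreviation (input) "rPow \<equiv> (19::nat)"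
abbreviation (input) "rD \<equiv> (20::nat)"
abbreviation (input) "rQ \<equiv> (21::nat)"
abbreviation (input) "rEnd \<equiv> (22::nat)"
abbreviation (input) "rLo \<equiv> (23::nat)"
abbreviation (input) "rHi \<equiv> (24::nat)"
abbreviation (input) "rTgt \<equiv> (25::nat)"
abbreviation (input) "rT \<equiv> (26::nat)"
abbreviation (input) "rU \<equiv> (27::nat)"
abbreviation (input) "rA \<equiv> (28::nat)"

section \<open>Subroutines acting on a single state code\<close>

definition same :: "nat set \<Rightarrow> machine_state \<Rightarrow> machine_state \<Rightarrow> bool" where
  "same R s s' \<longleftrightarrow> (\<forall>i. i \<notin> R \<longrightarrow> reg s' i = reg s i) \<and> mem s' = mem s \<and> rreg s' = rreg s \<and> rmem s' = rmem s"

definition std :: "nat \<Rightarrow> machine_state \<Rightarrow> bool" where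
  "std n s \<longleftrightarrow> reg s rZ = 0 \<and> reg s rI = 1 \<and> reg s rF = 4 \<and> reg s rN = n"

definition pow_c :: com where
  "pow_c = Bas (Const rPow 1) ;; Bas (Add rT rX rZ) ;;
     WhileGt rT rZ (Bas (Mul rPow rPow rF) ;; Bas (Sub rT rT rI))"

text \<open>Subtraction is truncated, so adding \<open>(rTgt - rD) * rPow\<close> raises the digit
  to the maximum without a further test. A violated bound only sets \<open>rBad\<close>; from then
  on the contents of \<open>rNew\<close> no longer matter.\<close>

definition elem_c :: com where
  "elem_c = Call pow_c ;; Bas (Div rT rNew rPow) ;; Bas (Div rU rT rF) ;; Bas (Mul rU rU rF) ;;
     Bas (Sub rD rT rU) ;;
     IfLe rLo rD
       (IfLe rD rHi (Bas (Sub rT rTgt rD) ;; Bas (Mul rT rT rPow) ;; Bas (Add rNew rNew rT))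
         (Bas (Const rBad 1)))
       (Bas (Const rBad 1))"

text \<open>Equality with \<open>rR\<close> takes two comparisons. Since \<open>v\<close> is never
  its own parent, \<open>param_v\<close> and \<open>param_s\<close> can specialise
  \<open>lo\<close>, \<open>hi\<close> and \<open>tgt\<close> to the cases \<open>x = v\<close> and
  \<open>x \<noteq> v\<close>.\<close>

definition param_v :: com where
  "param_v = Bas (Const rLo 0) ;; Bas (Const rHi 1) ;; Bas (Const rTgt 3) ;;
     IfLe rX rR (IfLe rR rX (Bas (Const rTgt 2)) Skip) Skip"

definition param_s :: com where
  "param_s = Bas (Const rLo 2) ;; Bas (Const rHi 2) ;; Bas (Const rTgt 3) ;;
     IfLe rX rR (IfLe rR rX (Bas (Const rLo 0) ;; Bas (Const rTgt 1)) Skip) Skip"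

definition try_c :: com where
  "try_c = Bas (Const rBad 0) ;; Bas (Add rNew rC rZ) ;; Bas (Add rX rV rZ) ;; Call param_v ;; Call elem_c ;;
     Bas (Load rEnd rP) ;; Bas (Add rEnd rEnd rP) ;; Bas (Add rQ rP rZ) ;;
     WhileGt rEnd rQ (Bas (Add rQ rQ rI) ;; Bas (Load rX rQ) ;; Call param_s ;; Call elem_c)"

definition count_c :: com where
  "count_c = Bas (Const rA 0) ;; Bas (Const rD 2) ;; Bas (Add rQ rNew rZ) ;; Bas (Add rEnd rN rZ) ;;
     WhileGt rEnd rZ (Bas (Div rT rQ rF) ;; Bas (Mul rU rT rF) ;; Bas (Sub rU rQ rU) ;;
       IfLe rI rU (IfLe rU rD (Bas (Add rA rA rI)) Skip) Skip ;;
       Bas (Add rQ rT rZ) ;; Bas (Sub rEnd rEnd rI))"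

lemma wp_pow:
  assumes "std n s" "reg s rX \<le> n" "4 ^ n \<le> M"
    and "\<And>t s'. t \<le> 4 * n + 3 \<Longrightarrow> same {rPow, rT} s s' \<Longrightarrow> reg s' rPow = 4 ^ reg s rX \<Longrightarrow> Q t s'"
  shows "wp M pow_c s Q"
proof -
  have pw: "4 ^ reg s rX \<le> M"
    by (rule le_trans[OF power_increasing assms(3)]) (use assms(2) in auto)
  have M1: "1 \<le> M" by (rule le_trans[OF _ assms(3)]) simp
  let ?I = "\<lambda>s'. same {rPow, rT} s s' \<and> reg s' rT \<le> reg s rX \<and> reg s' rPow = 4 ^ (reg s rX - reg s' rT)"
  let ?c = "Bas (Mul rPow rPow rF) ;; Bas (Sub rT rT rI)"
  have loop: "wp M (WhileGt rT rZ ?c) s1 (\<lambda>t. Q (1 + (1 + t)))" if "?I s1" for s1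
  proof (rule wp_WhileGt[where I = ?I and \<mu> = "\<lambda>s'. reg s' rT" and T = 2 and T' = "4 * n + 1"])
    show "?I s1" by fact
    show "Q (1 + (1 + t)) s'" if "?I s'" "reg s' rT \<le> reg s' rZ" "t \<le> 4 * n + 1" for s' t
    proof (rule assms(4))
      have "reg s' rT = 0" using that assms(1) by (auto simp: same_def std_def)
      then show "reg s' rPow = 4 ^ reg s rX" "same {rPow, rT} s s'" using that(1) by auto
    qed (use that in simp)
    show "0 < reg s' rT \<and> wp M ?c s' (\<lambda>t s''. ?I s'' \<and> reg s'' rT < reg s' rT \<and> t \<le> 2)"
      if I: "?I s'" "reg s' rZ < reg s' rT" for s'
    proof
      have c: "reg s' rF = 4" "reg s' rI = 1" using I assms(1) by (auto simp: same_def std_def)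
      show "0 < reg s' rT" using I by simp
      have e: "4 ^ (reg s rX - reg s' rT) * 4 = (4::nat) ^ (reg s rX - (reg s' rT - 1))"
        using I(1) \<open>0 < reg s' rT\<close> by (metis Suc_diff_eq_diff_pred Suc_diff_le power_Suc2)
      have "(4::nat) ^ (reg s rX - (reg s' rT - 1)) \<le> M"
        by (rule le_trans[OF power_increasing pw]) auto
      then have b: "reg s' rPow * reg s' rF \<le> M" using I(1) e c by simp
      show "wp M ?c s' (\<lambda>t s''. ?I s'' \<and> reg s'' rT < reg s' rT \<and> t \<le> 2)"
        by (rule wp_vc) (use I b c e \<open>0 < reg s' rT\<close> in \<open>auto simp: same_def\<close>)
    qed
    show "reg s1 rT * (2 + 2) + 1 \<le> 4 * n + 1" using that assms(2) by simp
  qed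
  show ?thesis
  proof (rule wp_boundedI)
    assume b: "bounded M s"
    show ?thesis
      unfolding pow_c_def
      by (rule wp_vc)
        (use M1 assms(1) pw boundedD[OF b] in \<open>auto simp: same_def std_def intro!: loop\<close>)
  qed
qed

abbreviation elem_ok :: "machine_state \<Rightarrow> bool" where
  "elem_ok s \<equiv> reg s rLo \<le> dig (reg s rNew) (reg s rX) \<and> dig (reg s rNew) (reg s rX) \<le> reg s rHi"

lemma wp_elem:
  assumes "std n s" "reg s rX < n" "4 ^ n \<le> M" "reg s rNew < 4 ^ n" "reg s rTgt \<le> 3"
    and Q: "\<And>t s'. t \<le> 4 * n + 16 \<Longrightarrow> same {rPow, rT, rU, rD, rNew, rBad} s s' \<Longrightarrow>
        reg s' rBad = (if elem_ok s then reg s rBad else 1) \<Longrightarrow> reg s' rNew < 4 ^ n \<Longrightarrow>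
        \<forall>y. dig (reg s' rNew) y = (if elem_ok s \<and> y = reg s rX
            then max (dig (reg s rNew) y) (reg s rTgt) else dig (reg s rNew) y) \<Longrightarrow> Q t s'"
  shows "wp M elem_c s Q"
proof -
  let ?x = "reg s rX" and ?c = "reg s rNew"
  let ?d = "dig ?c ?x"
  let ?new = "?c + (reg s rTgt - ?d) * 4 ^ ?x"
  have M1: "1 \<le> M" by (rule le_trans[OF _ assms(3)]) simp
  have dd: "?d + (reg s rTgt - ?d) < 4" using assms(5) dig_less[of ?c ?x] by linarith
  have dn: "dig ?new y = (if y = ?x then max (dig ?c y) (reg s rTgt) else dig ?c y)" for y
    using dig_add[OF dd, of y] by auto
  have new: "?new < 4 ^ n"
    using assms(2) dig_outside[OF assms(4)] by (intro code_less) (auto simp: dn)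
  have d: "?c div 4 ^ ?x - ?c div 4 ^ ?x div 4 * 4 = ?d"
    unfolding dig_def by (simp add: minus_mult_div_eq_mod mult.commute)
  have b1: "?c div 4 ^ ?x div 4 * 4 \<le> M"
  proof -
    have "?c div 4 ^ ?x div 4 * 4 \<le> ?c" by (meson div_le_dividend div_times_less_eq_dividend le_trans)
    then show ?thesis using assms(3,4) by linarith
  qed
  have b2: "?new \<le> M" "(reg s rTgt - ?d) * 4 ^ ?x \<le> M" using new assms(3) by linarith+
  show ?thesis
    unfolding elem_c_def
  proof (rule wp_vc, simp, rule wp_pow[of n])
    fix t s1
    assume t: "t \<le> 4 * n + 3" and s1: "same {rPow, rT} s s1" "reg s1 rPow = 4 ^ ?x"
    have r: "reg s1 rNew = ?c" "reg s1 rF = 4" "reg s1 rTgt = reg s rTgt" "reg s1 rLo = reg s rLo"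
      "reg s1 rHi = reg s rHi"
      using s1 assms(1) by (auto simp: same_def std_def)
    show "vc M (Bas (Div rT rNew rPow) ;; Bas (Div rU rT rF) ;; Bas (Mul rU rU rF) ;;
     Bas (Sub rD rT rU) ;;
     IfLe rLo rD
       (IfLe rD rHi (Bas (Sub rT rTgt rD) ;; Bas (Mul rT rT rPow) ;; Bas (Add rNew rNew rT))
         (Bas (Const rBad 1)))
       (Bas (Const rBad 1))) s1 (\<lambda>u. Q (t + u))"
      by (simp add: r s1(2) b1 d b2)
        (intro conjI impI Q; use M1 s1(1) new dn t assms(4) in \<open>auto simp: same_def\<close>)
  qed (use assms in auto)
qed

lemma wp_param_v:
  assumes "3 \<le> M" "\<And>t s'. t \<le> 10 \<Longrightarrow> same {rLo, rHi, rTgt} s s' \<Longrightarrow> reg s' rLo = 0 \<Longrightarrow> reg s' rHi = 1 \<Longrightarrow>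
      reg s' rTgt = (if reg s rX = reg s rR then 2 else 3) \<Longrightarrow> Q t s'"
  shows "wp M param_v s Q"
  unfolding param_v_def
  by (rule wp_vc) (use assms(1) in \<open>auto simp: same_def intro!: assms(2)\<close>)

lemma wp_param_s:
  assumes "3 \<le> M" "\<And>t s'. t \<le> 10 \<Longrightarrow> same {rLo, rHi, rTgt} s s' \<Longrightarrow>
      reg s' rLo = (if reg s rX = reg s rR then 0 else 2) \<Longrightarrow> reg s' rHi = 2 \<Longrightarrow>
      reg s' rTgt = (if reg s rX = reg s rR then 1 else 3) \<Longrightarrow> Q t s'"
  shows "wp M param_s s Q"
  unfolding param_s_def
  by (rule wp_vc) (use assms(1) in \<open>auto simp: same_def intro!: assms(2)\<close>)

lemma wp_count:
  assumes "std n s" "4 \<le> M" "reg s rNew < 4 ^ n" "n \<le> M"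
    and Q: "\<And>t s'. t \<le> 12 * n + 5 \<Longrightarrow> same {rA, rD, rQ, rEnd, rT, rU} s s' \<Longrightarrow>
        reg s' rA = card (active n (dig (reg s rNew))) \<Longrightarrow> Q t s'"
  shows "wp M count_c s Q"
proof -
  let ?c = "reg s rNew"
  let ?R = "{rA, rD, rQ, rEnd, rT, rU}"
  let ?I = "\<lambda>s'. same ?R s s' \<and> reg s' rEnd \<le> n \<and> reg s' rD = 2 \<and>
      reg s' rQ = ?c div 4 ^ (n - reg s' rEnd) \<and> reg s' rA = card (active (n - reg s' rEnd) (dig ?c))"
  let ?b = "Bas (Div rT rQ rF) ;; Bas (Mul rU rT rF) ;; Bas (Sub rU rQ rU) ;;
       IfLe rI rU (IfLe rU rD (Bas (Add rA rA rI)) Skip) Skip ;;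
       Bas (Add rQ rT rZ) ;; Bas (Sub rEnd rEnd rI)"
  have loop: "wp M (WhileGt rEnd rZ ?b) s1 (\<lambda>t. Q (1 + (1 + (1 + (1 + t)))))" if "?I s1" for s1
  proof (rule wp_WhileGt[where I = ?I and \<mu> = "\<lambda>s'. reg s' rEnd" and T = 10 and T' = "12 * n + 1"])
    show "?I s1" by fact
    show "Q (1 + (1 + (1 + (1 + t)))) s'" if "?I s'" "reg s' rEnd \<le> reg s' rZ" "t \<le> 12 * n + 1" for s' t
    proof (rule Q)
      have "reg s' rEnd = 0" using that assms(1) by (auto simp: same_def std_def)
      then show "reg s' rA = card (active n (dig ?c))" "same ?R s s'" using that(1) by auto
    qed (use that in simp)
    show "0 < reg s' rEnd \<and> wp M ?b s' (\<lambda>t s''. ?I s'' \<and> reg s'' rEnd < reg s' rEnd \<and> t \<le> 10)"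
      if b: "bounded M s'" and I: "?I s'" "reg s' rZ < reg s' rEnd" for s'
    proof
      show pos: "0 < reg s' rEnd" using I by simp
      have c: "reg s' rF = 4" "reg s' rI = 1" "reg s' rZ = 0" using I assms(1) by (auto simp: same_def std_def)
      define i where "i = n - reg s' rEnd"
      define q where "q = ?c div 4 ^ i"
      have i: "n - (reg s' rEnd - Suc 0) = Suc i" using I pos by (auto simp: i_def)
      have q: "reg s' rQ = q" "reg s' rA = card (active i (dig ?c))" using I by (auto simp: i_def q_def)
      have sm: "same ?R s s'" "reg s' rEnd \<le> n" "reg s' rD = 2" using I(1) by auto
      have "q \<le> M" using boundedD(1)[OF b, of rQ] q(1) by simp
      then have qM: "q div 4 * 4 \<le> M" "q div 4 \<le> M" by auto
      have d: "q - q div 4 * 4 = dig ?c i"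
        unfolding dig_def q_def by (simp add: minus_mult_div_eq_mod mult.commute)
      have q4: "?c div 4 ^ Suc i = q div 4" unfolding q_def by (simp only: power_Suc2 div_mult2_eq)
      have ni: "i \<notin> active i (dig ?c)" by (simp add: active_def)
      have cs: "card (active (Suc i) (dig ?c)) =
          card (active i (dig ?c)) + (if dig ?c i = 1 \<or> dig ?c i = 2 then 1 else 0)"
        using ni by (simp add: active_Suc)
      have aM: "Suc (card (active i (dig ?c))) \<le> M"
      proof -
        have "card (active i (dig ?c)) \<le> card {..<i}" by (rule card_mono) (auto simp: active_def)
        moreover have "i < n" using I pos by (auto simp: i_def)
        ultimately show ?thesis using assms(4) by simp
      qed
      show "wp M ?b s' (\<lambda>t s''. ?I s'' \<and> reg s'' rEnd < reg s' rEnd \<and> t \<le> 10)"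
        by (rule wp_vc) (use assms(1) sm pos aM qM in
          \<open>auto simp: c q d i q4 cs same_def std_def simp del: power_Suc\<close>)
    qed
    show "reg s1 rEnd * (10 + 2) + 1 \<le> 12 * n + 1" using that by simp
  qed
  show ?thesis
  proof (rule wp_boundedI)
    assume b: "bounded M s"
    show ?thesis
      unfolding count_c_def
      by (rule wp_vc)
        (use assms(1,2,4) boundedD[OF b] in \<open>auto simp: same_def std_def active_def intro!: loop\<close>)
  qed
qed


definition legal :: "nat \<Rightarrow> nat set \<Rightarrow> nat \<Rightarrow> (nat \<Rightarrow> nat) \<Rightarrow> bool" where
  "legal v S r d \<longleftrightarrow> (\<forall>x\<in>insert v S. lo v r x \<le> d x \<and> d x \<le> hi v x)"

lemma assign_legal: "assign v S r d d' \<longleftrightarrow> legal v S r d \<and>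
    (\<forall>x. d' x = (if x \<in> insert v S then max (d x) (tgt v r x) else d x))"
  by (simp add: assign_def legal_def)

lemma wp_try:
  assumes std: "std n s" and M: "4 ^ n \<le> M" "3 \<le> M" "reg s rP + length xs \<le> M"
    and c: "reg s rC < 4 ^ n" and v: "reg s rV < n"
    and xs: "distinct xs" "set xs \<subseteq> {..<n} - {reg s rV}"
    and mem: "mem s (reg s rP) = length xs" "\<And>i. i < length xs \<Longrightarrow> mem s (Suc (reg s rP + i)) = xs ! i"
    and Q: "\<And>t s'. t \<le> n * (4 * n + 30) + 4 * n + 33 \<Longrightarrow>
        same {rPow, rT, rU, rD, rNew, rBad, rX, rLo, rHi, rTgt, rQ, rEnd} s s' \<Longrightarrow>
        reg s' rBad = 0 \<and> reg s' rNew < 4 ^ n \<and>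
          assign (reg s rV) (set xs) (reg s rR) (dig (reg s rC)) (dig (reg s' rNew)) \<or>
        reg s' rBad \<noteq> 0 \<and> \<not> legal (reg s rV) (set xs) (reg s rR) (dig (reg s rC)) \<Longrightarrow> Q t s'"
  shows "wp M try_c s Q"
proof (rule wp_boundedI)
  assume b: "bounded M s"
  define c v r p where "c = reg s rC" and "v = reg s rV" and "r = reg s rR" and "p = reg s rP"
  note defs = c_def v_def r_def p_def
  let ?R = "{rPow, rT, rU, rD, rNew, rBad, rX, rLo, rHi, rTgt, rQ, rEnd}"
  let ?len = "length xs"
  have len: "?len \<le> n" using xs distinct_card[of xs] card_mono[of "{..<n}" "set xs"] by auto
  \<comment> \<open>The code after \<open>v\<close> and the vertices in \<open>Y\<close> have been
    treated. Once a bound has failed, the invariant keeps only the illegality of the whole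
    choice.\<close>
  define part where "part Y new \<longleftrightarrow> assign v Y r (dig c) (dig new)" for Y new
  let ?G = "\<lambda>Y s'. reg s' rNew < 4 ^ n \<and> (reg s' rBad = 0 \<and> part Y (reg s' rNew) \<or>
      reg s' rBad = 1 \<and> \<not> legal v (set xs) r (dig c))"
  let ?I = "\<lambda>s'. same ?R s s' \<and> p \<le> reg s' rQ \<and> reg s' rQ \<le> p + ?len \<and> reg s' rEnd = p + ?len \<and>
      ?G (set (take (reg s' rQ - p) xs)) s'"
  let ?b = "Bas (Add rQ rQ rI) ;; Bas (Load rX rQ) ;; Call param_s ;; Call elem_c"
  have body: "wp M ?b s1 (\<lambda>t s''. ?I s'' \<and> p + ?len - reg s'' rQ < p + ?len - reg s1 rQ \<and> t \<le> 4 * n + 28)"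
    if I: "?I s1" and lt: "reg s1 rQ < p + ?len" for s1
  proof -
    define i where "i = reg s1 rQ - p"
    have i: "reg s1 rQ = p + i" "i < ?len" using I lt by (auto simp: i_def)
    let ?x = "xs ! i"
    have "?x \<in> {..<n} - {v}" using xs(2) nth_mem[OF i(2)] by (auto simp: defs)
    then have x: "?x < n" "?x \<noteq> v" by auto
    have tk: "set (take (Suc i) xs) = insert ?x (set (take i xs))"
      using i by (simp add: take_Suc_conv_app_nth)
    have nin: "?x \<notin> insert v (set (take i xs))"
      using x xs(1) i by (auto simp: in_set_conv_nth nth_eq_iff_index_eq)
    have sub: "insert v (set (take (Suc i) xs)) \<subseteq> insert v (set xs)" by (auto dest: in_set_takeD)
    have G: "?G (set (take i xs)) s1" using I by (simp add: i_def)
    have m: "mem s1 (Suc (p + i)) = ?x" using I i mem by (auto simp: same_def defs)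
    have r1: "reg s1 rI = 1" "reg s1 rR = r" using I std by (auto simp: same_def std_def defs)
    have bM: "Suc (p + i) \<le> M" using i M(3) by (simp add: defs)
    let ?s2 = "s1\<lparr>reg := (reg s1)(rQ := Suc (p + i), rX := ?x)\<rparr>"
    have "wp M param_s ?s2 (\<lambda>t s'. vc M (Call elem_c) s' (\<lambda>u s''. ?I s'' \<and>
        p + ?len - reg s'' rQ < p + ?len - reg s1 rQ \<and> 1 + (1 + (t + u)) \<le> 4 * n + 28))"
    proof (rule wp_param_s[OF M(2)], unfold vc.simps, rule wp_elem)
      fix t :: nat and s3
      assume t: "t \<le> 10" and s3: "same {rLo, rHi, rTgt} ?s2 s3"
        "reg s3 rLo = (if reg ?s2 rX = reg ?s2 rR then 0 else 2)" "reg s3 rHi = 2"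
        "reg s3 rTgt = (if reg ?s2 rX = reg ?s2 rR then 1 else 3)"
      have r3: "reg s3 rLo = lo v r ?x" "reg s3 rHi = hi v ?x" "reg s3 rTgt = tgt v r ?x"
        "reg s3 rX = ?x" "reg s3 rNew = reg s1 rNew" "reg s3 rBad = reg s1 rBad"
        "reg s3 rQ = Suc (p + i)" "reg s3 rEnd = reg s1 rEnd"
        using s3 x r1 by (auto simp: lo_def hi_def tgt_def same_def)
      have s3': "same ?R s s3" using s3(1) I by (auto simp: same_def)
      show "std n s3" using s3' std by (auto simp: std_def same_def)
      show "reg s3 rX < n" "4 ^ n \<le> M" "reg s3 rNew < 4 ^ n" "reg s3 rTgt \<le> 3"
        using r3 x M G by (auto simp: tgt_def)
      fix u :: nat and s4
      assume u: "u \<le> 4 * n + 16" and s4: "same {rPow, rT, rU, rD, rNew, rBad} s3 s4"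
        "reg s4 rBad = (if elem_ok s3 then reg s3 rBad else 1)" "reg s4 rNew < 4 ^ n"
        "\<forall>y. dig (reg s4 rNew) y = (if elem_ok s3 \<and> y = reg s3 rX
            then max (dig (reg s3 rNew) y) (reg s3 rTgt) else dig (reg s3 rNew) y)"
      have "same ?R s s4" using s3' s4(1) by (auto simp: same_def)
      moreover have "reg s4 rQ = Suc (p + i)" "reg s4 rEnd = p + ?len"
        using s4(1) r3 I by (auto simp: same_def)
      moreover have "?G (set (take (Suc i) xs)) s4"
      proof (cases "reg s1 rBad = 0")
        case True
        then have pt: "part (set (take i xs)) (reg s1 rNew)" using G by auto
        \<comment> \<open>The list is distinct and avoids \<open>v\<close>, so this digit still has
          its original value.\<close>
        then have dx: "dig (reg s1 rNew) ?x = dig c ?x" using nin by (auto simp: part_def assign_def)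
        have ok: "elem_ok s3 \<longleftrightarrow> lo v r ?x \<le> dig c ?x \<and> dig c ?x \<le> hi v ?x"
          using r3 dx by simp
        show ?thesis
        proof (cases "elem_ok s3")
          case ok': True
          have "part (set (take (Suc i) xs)) (reg s4 rNew)"
            unfolding part_def assign_def tk
          proof (intro conjI ballI allI)
            fix x assume "x \<in> insert v (insert ?x (set (take i xs)))"
            then show "lo v r x \<le> dig c x" "dig c x \<le> hi v x"
              using pt ok ok' by (auto simp: part_def assign_def)
          next
            fix x
            show "dig (reg s4 rNew) x = (if x \<in> insert v (insert ?x (set (take i xs)))
                then max (dig c x) (tgt v r x) else dig c x)"
              using s4(4) ok' r3 pt dx by (cases "x = ?x") (auto simp: part_def assign_def)
          qed
          then show ?thesis using s4(2,3) ok' r3 True by auto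
        next
          case False
          then have "\<not> legal v (set xs) r (dig c)" using ok i by (auto simp: legal_def)
          then show ?thesis using s4(2,3) False by auto
        qed
      next
        case False
        then show ?thesis using G s4(2,3) r3 by auto
      qed
      ultimately show "?I s4 \<and> p + ?len - reg s4 rQ < p + ?len - reg s1 rQ \<and> 1 + (1 + (t + u)) \<le> 4 * n + 28"
        using i t u by simp
    qed
    then show ?thesis by (intro wp_vc) (simp add: r1 i m bM)
  qed
  have loop: "wp M (WhileGt rEnd rQ ?b) s1 (\<lambda>t. Q (k + t))" if I: "?I s1" and k: "k \<le> 4 * n + 32" for s1 k
  proof (rule wp_WhileGt[where I = ?I and \<mu> = "\<lambda>s'. p + ?len - reg s' rQ" and T = "4 * n + 28" and
        T' = "n * (4 * n + 30) + 1"])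
    show "?I s1" by fact
    show "Q (k + t) s'" if I: "?I s'" and "reg s' rEnd \<le> reg s' rQ" "t \<le> n * (4 * n + 30) + 1" for s' t
    proof (rule Q)
      show "k + t \<le> n * (4 * n + 30) + 4 * n + 33" using k that by simp
      show "same ?R s s'" using I by blast
      have "reg s' rQ - p = ?len" using that by auto
      then show "reg s' rBad = 0 \<and> reg s' rNew < 4 ^ n \<and>
          assign (reg s rV) (set xs) (reg s rR) (dig (reg s rC)) (dig (reg s' rNew)) \<or>
        reg s' rBad \<noteq> 0 \<and> \<not> legal (reg s rV) (set xs) (reg s rR) (dig (reg s rC))"
        using I by (auto simp: part_def defs)
    qed
    show "0 < p + ?len - reg s' rQ \<and>
        wp M ?b s' (\<lambda>t s''. ?I s'' \<and> p + ?len - reg s'' rQ < p + ?len - reg s' rQ \<and> t \<le> 4 * n + 28)"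
      if "?I s'" "reg s' rQ < reg s' rEnd" for s'
    proof -
      have "reg s' rQ < p + ?len" using that by auto
      then show ?thesis using body[OF that(1)] by auto
    qed
    have "p \<le> reg s1 rQ" using I by blast
    then have "p + ?len - reg s1 rQ \<le> n" using len by linarith
    then have "(p + ?len - reg s1 rQ) * (4 * n + 28 + 2) \<le> n * (4 * n + 28 + 2)" by (rule mult_le_mono1)
    then show "(p + ?len - reg s1 rQ) * (4 * n + 28 + 2) + 1 \<le> n * (4 * n + 30) + 1"
      by (simp add: add.commute)
  qed
  let ?s1 = "s\<lparr>reg := (reg s)(rBad := 0, rNew := c, rX := v)\<rparr>"
  let ?rest = "Bas (Load rEnd rP) ;; Bas (Add rEnd rEnd rP) ;; Bas (Add rQ rP rZ) ;; WhileGt rEnd rQ ?b"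
  have "wp M param_v ?s1 (\<lambda>t s'. vc M (Call elem_c ;; ?rest) s' (\<lambda>u. Q (1 + (1 + (1 + (t + u))))))"
  proof (rule wp_param_v[OF M(2)], subst vc.simps(3), subst vc.simps(7), rule wp_elem)
    fix t :: nat and s3
    assume t: "t \<le> 10" and s3: "same {rLo, rHi, rTgt} ?s1 s3"
      "reg s3 rLo = 0" "reg s3 rHi = 1" "reg s3 rTgt = (if reg ?s1 rX = reg ?s1 rR then 2 else 3)"
    have r3: "reg s3 rLo = lo v r v" "reg s3 rHi = hi v v" "reg s3 rTgt = tgt v r v"
      "reg s3 rX = v" "reg s3 rNew = c" "reg s3 rBad = 0"
      using s3 by (auto simp: lo_def hi_def tgt_def same_def defs)
    have s3': "same ?R s s3" using s3(1) by (auto simp: same_def)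
    show "std n s3" using s3' std by (auto simp: std_def same_def)
    show "reg s3 rX < n" "4 ^ n \<le> M" "reg s3 rNew < 4 ^ n" "reg s3 rTgt \<le> 3"
      using r3 M v c by (auto simp: tgt_def defs)
    fix u :: nat and s4
    assume u: "u \<le> 4 * n + 16" and s4: "same {rPow, rT, rU, rD, rNew, rBad} s3 s4"
      "reg s4 rBad = (if elem_ok s3 then reg s3 rBad else 1)" "reg s4 rNew < 4 ^ n"
      "\<forall>y. dig (reg s4 rNew) y = (if elem_ok s3 \<and> y = reg s3 rX
          then max (dig (reg s3 rNew) y) (reg s3 rTgt) else dig (reg s3 rNew) y)"
    have s4': "same ?R s s4" using s3' s4(1) by (auto simp: same_def)
    have r4: "reg s4 rP = p" "reg s4 rZ = 0" "mem s4 p = ?len"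
      using s4' std mem by (auto simp: same_def std_def defs)
    have G: "?G {} s4"
      using s4(2-4) r3 by (auto simp: part_def assign_def legal_def split: if_splits)
    have "?I (s4\<lparr>reg := (reg s4)(rEnd := ?len + p, rQ := p)\<rparr>)"
      using s4' G by (auto simp: same_def)
    then have "wp M (WhileGt rEnd rQ ?b) (s4\<lparr>reg := (reg s4)(rEnd := ?len + p, rQ := p)\<rparr>)
        (\<lambda>w. Q ((6 + t + u) + w))" using t u by (intro loop) auto
    moreover have "p + ?len \<le> M" using M(3) by (simp add: defs)
    ultimately show "vc M ?rest s4 (\<lambda>w. Q (1 + (1 + (1 + (t + (u + w))))))"
      by (simp add: r4 add.commute[of ?len]) (erule wp_conseq, simp add: algebra_simps numeral_eq_Suc)
  qed
  then show ?thesis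
    unfolding try_c_def using boundedD[OF b] std by (intro wp_vc) (simp add: std_def defs)
qed

section \<open>Relaxing one transition\<close>

definition store_c :: com where
  "store_c = Bas (Add rT rC rI) ;; Bas (Store rA rT) ;; Bas (Add rA rA rI) ;; Bas (Store rA rV) ;;
     Bas (Add rA rA rI) ;; Bas (Store rA rP) ;; Bas (RStore rU 0)"

definition push_c :: com where
  "push_c = Bas (Mul rT rTail rF) ;; Bas (Add rT rT rB) ;; Bas (Const rD 3) ;; Bas (Add rT rT rD) ;;
     Bas (Store rT rNew) ;; Bas (Add rTail rTail rI)"

text \<open>A known code whose score improves is not enqueued again: it is one level above the head
  of the queue and still waits to be expanded.\<close>

definition relax_c :: com where
  "relax_c = Bas (Mul rA rNew rF) ;; Bas (Add rA rA rB) ;; Bas (Add rT rB rC) ;; Bas (RLoad 0 rT) ;;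
     Bas (RLoad 1 rRP) ;; Bas (RAdd 0 0 1) ;; Bas (Add rU rB rNew) ;; Bas (Load rD rA) ;;
     IfLe rD rZ (push_c ;; store_c) (Bas (RLoad 1 rU) ;; IfRLe 0 1 Skip store_c)"

definition body_c :: com where
  "body_c = Call try_c ;;
     IfLe rBad rZ (Call count_c ;; IfLe rA rW (Call relax_c) Skip) Skip"

text \<open>\<open>rM\<close> holds \<open>n + 1\<close>, so the candidates for the vertex that
  stays active include the value \<open>n\<close>, which stands for none.\<close>

definition entry_c :: com where
  "entry_c = Bas (Const rR 0) ;; WhileGt rM rR (Call body_c ;; Bas (Add rR rR rI))"

definition frame :: "nat set \<Rightarrow> machine_state \<Rightarrow> machine_state \<Rightarrow> bool" where
  "frame R s s' \<longleftrightarrow> (\<forall>i. i \<notin> R \<longrightarrow> reg s' i = reg s i)"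

section \<open>Memory layout and the invariant of the machine state\<close>

locale listed_problem = polytree_problem +
  fixes L :: listing
  assumes lists: "lists_instance L n F f"
begin

definition inp :: "nat list" where "inp = nat_input L"
definition rinp :: "real list" where "rinp = real_input L"
definition base :: nat where "base = length inp"
text \<open>Room for the input, the tables between \<open>base\<close> and
  \<open>base + 4 * 4 ^ n\<close>, at most \<open>n * n\<close> arcs behind them, the width bound
  and the small constants of the program.\<close>

definition M :: nat where "M = base + 16 * 4 ^ n + Suc k * Suc n + 16"

lemma n4: "n < 4 ^ n" by (rule power_gt_expt) simp

text \<open>A table refers to a parent set by its position \<open>p\<close> in the input, so sets
  are never copied.\<close>

definition entry :: "nat \<Rightarrow> nat \<Rightarrow> nat list \<Rightarrow> bool" where
  "entry v p xs \<longleftrightarrow> v < n \<and> p + length xs < base \<and> inp ! p = length xs \<and>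
     (\<forall>i<length xs. inp ! Suc (p + i) = xs ! i) \<and> set xs \<in> F v \<and> distinct xs"

definition E :: "nat \<Rightarrow> nat \<Rightarrow> nat set \<Rightarrow> bool" where
  "E v p S \<longleftrightarrow> (\<exists>xs. entry v p xs \<and> set xs = S)"

definition input_ok :: "machine_state \<Rightarrow> bool" where
  "input_ok s \<longleftrightarrow> (\<forall>i<base. mem s i = inp ! i) \<and> (\<forall>i<length rinp. rmem s i = rinp ! i)"

definition regs_ok :: "machine_state \<Rightarrow> bool" where
  "regs_ok s \<longleftrightarrow> std n s \<and> reg s rM = Suc n \<and> reg s rW = W \<and> reg s rB = base \<and> reg s rTop = 4 ^ n"

text \<open>
  The tables behind the input are indexed by state codes and interleaved with the queue \<open>quA\<close>, so
  that they need no allocation.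
\<close>

definition prvA where "prvA s c = mem s (base + 4 * c)"
definition bvA where "bvA s c = mem s (base + 4 * c + 1)"
definition bpA where "bpA s c = mem s (base + 4 * c + 2)"
definition quA where "quA s c = mem s (base + 4 * c + 3)"
definition scA where "scA s c = rmem s (base + c)"

definition dps :: "nat list \<Rightarrow> nat \<Rightarrow> (nat \<times> nat set \<times> nat) set \<Rightarrow> machine_state \<Rightarrow> bool" where
  "dps Q h R s \<longleftrightarrow> input_ok s \<and> regs_ok s \<and> dp_inv E Q h (prvA s) (bvA s) (bpA s) (scA s) R \<and>
     reg s rTail = length Q \<and> reg s rHead = h \<and> (\<forall>i<length Q. quA s i = Q ! i)"

lemma dps_regs:
  assumes "dps Q h R s" "mem s' = mem s" "rmem s' = rmem s"
    "\<And>i. i \<le> rTail \<or> i = rI \<Longrightarrow> reg s' i = reg s i"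
  shows "dps Q h R s'"
proof -
  have "prvA s' = prvA s" "bvA s' = bvA s" "bpA s' = bpA s" "scA s' = scA s" "quA s' = quA s"
    using assms(2,3) by (auto simp: prvA_def bvA_def bpA_def quA_def scA_def fun_eq_iff)
  moreover have "input_ok s' = input_ok s" using assms(2,3) by (simp add: input_ok_def)
  moreover have "regs_ok s' = regs_ok s" using assms(4) by (simp add: regs_ok_def std_def)
  ultimately show ?thesis using assms(1,4) by (simp add: dps_def)
qed

lemma dps_same:
  assumes "dps Q h R s" "same Z s s'" "\<forall>i\<in>Z. rTail < i \<and> i \<noteq> rI"
  shows "dps Q h R s'"
proof (rule dps_regs[OF assms(1)])
  fix i :: nat assume "i \<le> rTail \<or> i = rI"
  then have "i \<notin> Z" using assms(3) by auto
  then show "reg s' i = reg s i" using assms(2) by (simp add: same_def)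
qed (use assms(2) in \<open>simp_all add: same_def\<close>)

lemma dp_inv_len4: "dp_inv E Q h prv bv bp sc R \<Longrightarrow> length Q \<le> 4 ^ n"
  using dp_inv_length[of E Q h prv bv bp sc R] card_mono[of "{..<4 ^ n}" "{c. c < 4 ^ n \<and> card (active n (dig c)) \<le> W}"]
  by fastforce

text \<open>Each score comes with a length field among the natural numbers. Hence the score table,
  which starts at \<open>base\<close> in real memory, does not overlap the input scores.\<close>

lemma rinp_base: "length rinp \<le> base"
proof -
  have e: "length es \<le> length (concat (map (\<lambda>(xs, r). length xs # xs) es))" for es :: "(nat list \<times> real) list"
    by (induction es) auto
  have "length (concat (map (map snd) L)) \<le>
      length (concat (map (\<lambda>es. length es # concat (map (\<lambda>(xs, r). length xs # xs) es)) L))" for L :: listing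
  proof (induction L)
    case (Cons es L)
    then show ?case using e[of es] by simp
  qed simp
  then show ?thesis by (simp add: rinp_def base_def inp_def real_input_def nat_input_def le_SucI)
qed

lemma wp_relax:
  assumes d: "dps Q h R s" and h: "h < length Q" and c: "reg s rC = Q ! h"
    and tr: "trans (Q ! h) (reg s rNew) (reg s rV) S r" and e: "E (reg s rV) (reg s rP) S"
    and rp: "reg s rRP < length rinp" "rinp ! reg s rRP = f (reg s rV) S"
    and P: "\<And>t s' Q'. t \<le> 40 \<Longrightarrow> frame {rA, rT, rU, rD, rTail} s s' \<Longrightarrow>
      dps Q' h (insert (reg s rV, S, r) R) s' \<Longrightarrow> h < length Q' \<Longrightarrow> Q' ! h = Q ! h \<Longrightarrow> P t s'"
  shows "wp M relax_c s P"
proof (rule wp_boundedI)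
  assume bd: "bounded M s"
  define new v p where "new = reg s rNew" and "v = reg s rV" and "p = reg s rP"
  note defs = new_def v_def p_def
  let ?c = "Q ! h" and ?val = "scA s (Q ! h) + f v S"
  note D = d[unfolded dps_def regs_ok_def std_def]
  have c4: "?c < 4 ^ n" "new < 4 ^ n" using tr by (auto simp: trans_def defs)
  have tl: "length Q \<le> 4 ^ n" using D dp_inv_len4 by blast
  have mM: "base + 4 * x + y \<le> M" if "x \<le> 4 ^ n" "y \<le> 4" for x y
    using that by (simp add: M_def)
  have bM: "?c + 1 \<le> M" "base + ?c \<le> M" "base + new \<le> M" "new * 4 \<le> M" "length Q * 4 \<le> M"
    "Suc (length Q) \<le> M" "3 \<le> M"
    using c4 tl by (simp_all add: M_def)
  have rr: "reg s rF = 4" "reg s rI = 1" "reg s rZ = 0" "reg s rB = base" "reg s rTail = length Q"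
    "reg s rNew = new" "reg s rV = v" "reg s rP = p" "reg s rC = ?c" using D c by (auto simp: defs)
  have rv: "rmem s (reg s rRP) = f v S" using D rp by (auto simp: input_ok_def defs)
  have pr: "mem s (new * 4 + base) = prvA s new" by (simp add: prvA_def mult.commute add.commute)
  have vis: "prvA s new = 0 \<longleftrightarrow> new \<notin> set Q" using D c4 by (auto simp: dp_inv_def)
  let ?upd = "\<lambda>m. m(new * 4 + base := Suc ?c, Suc (new * 4 + base) := v, Suc (Suc (new * 4 + base)) := p)"
  have fin: "P t s'" if t: "t \<le> 40" and fr: "frame {rA, rT, rU, rD, rTail} s s'"
    and Q': "Q' = (if new \<in> set Q then Q else Q @ [new])" and tl': "reg s' rTail = length Q'"
    and m: "mem s' = ?upd (if new \<in> set Q then mem s else (mem s)(length Q * 4 + base + 3 := new))"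
    and rm: "rmem s' = (rmem s)(base + new := ?val)"
    and up: "new \<notin> set Q \<or> scA s new < ?val" for t s' Q'
  proof (rule P[OF t fr])
    \<comment> \<open>Relative to \<open>base\<close>, the four interleaved tables occupy different
      residues modulo 4.\<close>
    have neq: "base + 4 * x \<noteq> length Q * 4 + base + 3" "base + 4 * x + 1 \<noteq> length Q * 4 + base + 3"
      "base + 4 * x + 2 \<noteq> length Q * 4 + base + 3" for x by presburger+
    have a1: "prvA s' = (prvA s)(new := Suc ?c)"
    proof
      fix x
      have "base + 4 * x \<noteq> Suc (new * 4 + base)" "base + 4 * x \<noteq> Suc (Suc (new * 4 + base))" by presburger+
      then show "prvA s' x = ((prvA s)(new := Suc ?c)) x" using m neq(1)[of x] by (auto simp: prvA_def)
    qed
    have a2: "bvA s' = (bvA s)(new := v)"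
    proof
      fix x
      have "base + 4 * x + 1 \<noteq> new * 4 + base" "base + 4 * x + 1 \<noteq> Suc (Suc (new * 4 + base))" by presburger+
      then show "bvA s' x = ((bvA s)(new := v)) x" using m neq(2)[of x] by (auto simp: bvA_def)
    qed
    have a3: "bpA s' = (bpA s)(new := p)"
    proof
      fix x
      have "base + 4 * x + 2 \<noteq> new * 4 + base" "base + 4 * x + 2 \<noteq> Suc (new * 4 + base)" by presburger+
      then show "bpA s' x = ((bpA s)(new := p)) x" using m neq(3)[of x] by (auto simp: bpA_def)
    qed
    have a4: "scA s' = (scA s)(new := ?val)" using rm by (auto simp: scA_def fun_eq_iff)
    have a5: "quA s' i = Q' ! i" if i: "i < length Q'" for i
    proof -
      have "base + 4 * i + 3 \<noteq> new * 4 + base" "base + 4 * i + 3 \<noteq> Suc (new * 4 + base)"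
        "base + 4 * i + 3 \<noteq> Suc (Suc (new * 4 + base))" by presburger+
      moreover have "base + 4 * i + 3 = length Q * 4 + base + 3 \<longleftrightarrow> i = length Q" by auto
      moreover have "quA s i = Q ! i" if "i < length Q" using D that by blast
      ultimately show ?thesis using m Q' i by (auto simp: quA_def nth_append split: if_splits)
    qed
    have "dp_inv E Q' h (prvA s') (bvA s') (bpA s') (scA s') (insert (v, S, r) R)"
      unfolding a1 a2 a3 a4 Q' using D h tr e up by (intro dp_inv_relax) (auto simp: defs)
    moreover have "input_ok s'"
      using D m rm rinp_base by (auto simp: input_ok_def)
    moreover have "regs_ok s'" using D fr by (auto simp: regs_ok_def std_def frame_def)
    moreover have "reg s' rHead = h" using D fr by (auto simp: frame_def)
    ultimately show "dps Q' h (insert (reg s rV, S, r) R) s'"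
      using tl' a5 by (simp add: dps_def defs)
    show "h < length Q'" "Q' ! h = Q ! h" using h Q' by (auto simp: nth_append)
  qed
  have keep: "P t s'" if t: "t \<le> 40" and fr: "frame {rA, rT, rU, rD} s s'" and "mem s' = mem s" "rmem s' = rmem s"
    and up: "new \<in> set Q" "?val \<le> scA s new" for t s'
  proof (rule P[OF t])
    show "frame {rA, rT, rU, rD, rTail} s s'" using fr by (auto simp: frame_def)
    have "dps Q h (insert (reg s rV, S, r) R) s"
      using D dp_inv_keep[of E Q h "prvA s" "bvA s" "bpA s" "scA s" R new v S r] tr up
      by (auto simp: dps_def regs_ok_def std_def defs)
    then show "dps Q h (insert (reg s rV, S, r) R) s'"
      by (rule dps_regs) (use that in \<open>auto simp: frame_def\<close>)
  qed (use h in auto)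
  have sc: "rmem s (base + ?c) = scA s ?c" "rmem s (base + new) = scA s new" by (simp_all add: scA_def)
  have aM: "new * 4 + base \<le> M" "new * 4 + base + 1 \<le> M" "new * 4 + base + 2 \<le> M" 
    "length Q * 4 + base \<le> M" "length Q * 4 + base + 3 \<le> M"
    using mM[of new 0] mM[of new 1] mM[of new 2] mM[of "length Q" 0] mM[of "length Q" 3] c4 tl by auto
  note sym = rr bM aM rv pr sc vis
  note cdefs = relax_c_def push_c_def store_c_def
  have "vc M relax_c s P"
  proof (cases "new \<in> set Q")
    case False
    then show ?thesis
      unfolding cdefs using bM aM by (auto simp: sym frame_def intro!: fin[OF _ _ refl])
  next
    case True
    show ?thesis
    proof (cases "?val \<le> scA s new")
      case le: True
      then show ?thesis
        unfolding cdefs using True bM aM by (auto simp: sym frame_def intro!: keep)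
    next
      case False
      then show ?thesis
        unfolding cdefs using True bM aM by (auto simp: sym frame_def intro!: fin[OF _ _ refl])
    qed
  qed
  then show ?thesis by (rule wp_vc)
qed

lemma entry_facts:
  assumes "entry v p xs" "input_ok s"
  shows "mem s p = length xs" "\<And>i. i < length xs \<Longrightarrow> mem s (Suc (p + i)) = xs ! i"
    "set xs \<subseteq> {..<n} - {v}" "distinct xs" "p + length xs \<le> M" "v < n" "E v p (set xs)"
  using assms F_sub[of v "set xs"] by (auto simp: entry_def input_ok_def M_def E_def)

definition bodyT :: nat where "bodyT = n * (4 * n + 30) + 16 * n + 90"

abbreviation (input) try_regs :: "nat set" where
  "try_regs \<equiv> {rPow, rT, rU, rD, rNew, rBad, rX, rLo, rHi, rTgt, rQ, rEnd, rA}"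

abbreviation (input) work_regs :: "nat set" where
  "work_regs \<equiv> insert rTail try_regs"

text \<open>The triple counts as tried in each of the three outcomes: after illegal states or too
  many active vertices there is no transition with these data, and otherwise it has been
  relaxed.\<close>

lemma wp_body:
  assumes d: "dps Q h R s" and h: "h < length Q" and c: "reg s rC = Q ! h"
    and e: "entry (reg s rV) (reg s rP) xs" and r: "reg s rR \<le> n"
    and rp: "reg s rRP < length rinp" "rinp ! reg s rRP = f (reg s rV) (set xs)"
    and P: "\<And>t s' Q'. t \<le> bodyT \<Longrightarrow> frame work_regs s s' \<Longrightarrow>
      dps Q' h (insert (reg s rV, set xs, reg s rR) R) s' \<Longrightarrow> h < length Q' \<Longrightarrow> Q' ! h = Q ! h \<Longrightarrow> P t s'"
  shows "wp M body_c s P"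
proof -
  let ?v = "reg s rV" and ?r = "reg s rR" and ?S = "set xs" and ?c = "Q ! h"
  note D = d[unfolded dps_def]
  have io: "input_ok s" and st: "std n s" using D by (auto simp: regs_ok_def)
  note ef = entry_facts[OF e io]
  have "dp_inv E Q h (prvA s) (bvA s) (bpA s) (scA s) R" using D by blast
  then have c4: "?c < 4 ^ n" using nth_mem[OF h] unfolding dp_inv_def by blast
  have M: "4 ^ n \<le> M" "3 \<le> M" "4 \<le> M" "n \<le> M" using n4 by (simp_all add: M_def)
  have skip: "P t s'" if "t \<le> bodyT" "same try_regs s s'"
    "\<And>c'. \<not> trans ?c c' ?v ?S ?r" for t s'
  proof (rule P[OF that(1)])
    show "frame work_regs s s'" using that(2) by (auto simp: frame_def same_def)
    have "dp_inv E Q h (prvA s) (bvA s) (bpA s) (scA s) (insert (?v, ?S, ?r) R)"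
      using D by (intro dp_inv_skip[OF _ that(3)]) blast
    then have "dps Q h (insert (?v, ?S, ?r) R) s" using D by (simp add: dps_def)
    then show "dps Q h (insert (?v, ?S, ?r) R) s'" using that(2) by (rule dps_same) simp
  qed (use h in auto)
  show ?thesis
    unfolding body_c_def
  proof (rule wp_vc, subst vc.simps(3), subst vc.simps(7), rule wp_try[of n s M xs])
    fix t s1
    assume t: "t \<le> n * (4 * n + 30) + 4 * n + 33"
      and s1: "same {rPow, rT, rU, rD, rNew, rBad, rX, rLo, rHi, rTgt, rQ, rEnd} s s1"
      and ok: "reg s1 rBad = 0 \<and> reg s1 rNew < 4 ^ n \<and>
          assign ?v ?S ?r (dig (reg s rC)) (dig (reg s1 rNew)) \<or>
        reg s1 rBad \<noteq> 0 \<and> \<not> legal ?v ?S ?r (dig (reg s rC))"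
    have r1: "reg s1 rZ = 0" "std n s1" "reg s1 rW = W"
      using s1 D by (auto simp: same_def std_def regs_ok_def)
    have t': "t + 2 \<le> bodyT" using t by (simp add: bodyT_def)
    show "vc M (IfLe rBad rZ (Call count_c ;; IfLe rA rW (Call relax_c) Skip) Skip) s1 (\<lambda>u. P (t + u))"
    proof (cases "reg s1 rBad = 0")
      case False
      then have "\<And>c'. \<not> trans ?c c' ?v ?S ?r" using ok c by (auto simp: trans_def assign_legal)
      then have "P (t + 2) s1" using t' s1 by (intro skip) (auto simp: same_def)
      then show ?thesis using False r1 by simp
    next
      case True
      then have a: "reg s1 rNew < 4 ^ n" "assign ?v ?S ?r (dig ?c) (dig (reg s1 rNew))"
        using ok c by auto
      have "wp M count_c s1 (\<lambda>u s'. vc M (IfLe rA rW (Call relax_c) Skip) s' (\<lambda>w. P (t + (u + w + 2))))"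
      proof (rule wp_count[OF r1(2) M(3) a(1) M(4)])
        fix u s2
        assume u: "u \<le> 12 * n + 5" and s2: "same {rA, rD, rQ, rEnd, rT, rU} s1 s2"
          and cnt: "reg s2 rA = card (active n (dig (reg s1 rNew)))"
        have s2': "same try_regs s s2" using s1 s2 by (auto simp: same_def)
        have nw: "reg s2 rNew = reg s1 rNew" "reg s2 rW = W" using s2 r1 by (auto simp: same_def)
        have tb: "t + (u + 4) \<le> bodyT" "t + (u + w + 4) \<le> bodyT" if "w \<le> 40" for w
          using t u that by (auto simp: bodyT_def)
        show "vc M (IfLe rA rW (Call relax_c) Skip) s2 (\<lambda>w. P (t + (u + w + 2)))"
        proof (cases "reg s2 rA \<le> W")
          case False
          \<comment> \<open>\<open>assign\<close> determines all digits of the successor, so a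
            transition could only lead to the code just counted, which has too many active
            vertices.\<close>
          have "\<not> trans ?c c' ?v ?S ?r" for c'
          proof
            assume tr: "trans ?c c' ?v ?S ?r"
            then have "dig c' = dig (reg s1 rNew)" using a(2) by (auto simp: trans_def assign_def)
            then show False using tr False cnt by (auto simp: trans_def)
          qed
          then have "P (t + (u + 4)) s2" using tb(1)[of 0] s2' by (intro skip) auto
          then show ?thesis using False nw by (simp add: numeral_eq_Suc)
        next
          case True
          have d2: "dps Q h R s2" using d s2' by (rule dps_same) simp
          have rr: "reg s2 rC = ?c" "reg s2 rV = ?v" "reg s2 rP = reg s rP" "reg s2 rRP = reg s rRP"
            using s2' c by (auto simp: same_def)
          have tr: "trans ?c (reg s2 rNew) ?v ?S ?r"
            using a True cnt nw e r c4 by (auto simp: trans_def entry_def)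
          have "wp M relax_c s2 (\<lambda>w. P (t + (u + (w + 2) + 2)))"
          proof (rule wp_relax[OF d2 h rr(1)])
            show "trans ?c (reg s2 rNew) (reg s2 rV) ?S ?r" using tr rr by simp
            show "E (reg s2 rV) (reg s2 rP) ?S" using ef rr by simp
            show "reg s2 rRP < length rinp" "rinp ! reg s2 rRP = f (reg s2 rV) ?S" using rp rr by auto
            fix w :: nat and s3 Q'
            assume w: "w \<le> 40" and s3: "frame {rA, rT, rU, rD, rTail} s2 s3"
              and d3: "dps Q' h (insert (reg s2 rV, ?S, ?r) R) s3" "h < length Q'" "Q' ! h = Q ! h"
            show "P (t + (u + (w + 2) + 2)) s3"
            proof (rule P[OF _ _ _ d3(2,3)])
              show "t + (u + (w + 2) + 2) \<le> bodyT" using tb(2)[OF w] by simp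
              show "frame work_regs s s3" using s3 s2' by (auto simp: frame_def same_def)
              show "dps Q' h (insert (?v, ?S, ?r) R) s3" using d3(1) rr by simp
            qed
          qed
          then show ?thesis using True nw by simp
        qed
      qed
      then show ?thesis using True r1 by (simp add: add.assoc)
    qed
  qed (use st M ef c c4 in auto)
qed

definition entryT :: nat where "entryT = Suc n * (bodyT + 3) + 2"

lemma wp_entry:
  assumes d: "dps Q h R s" and h: "h < length Q" and c: "reg s rC = Q ! h"
    and e: "entry (reg s rV) (reg s rP) xs"
    and rp: "reg s rRP < length rinp" "rinp ! reg s rRP = f (reg s rV) (set xs)"
    and P: "\<And>t s' Q'. t \<le> entryT \<Longrightarrow> frame (insert rR work_regs) s s' \<Longrightarrow>
      dps Q' h (R \<union> {reg s rV} \<times> {set xs} \<times> {..n}) s' \<Longrightarrow> h < length Q' \<Longrightarrow> Q' ! h = Q ! h \<Longrightarrow> P t s'"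
  shows "wp M entry_c s P"
proof -
  let ?v = "reg s rV" and ?S = "set xs"
  let ?I = "\<lambda>s'. frame (insert rR work_regs) s s' \<and> reg s' rR \<le> Suc n \<and>
      (\<exists>Q'. dps Q' h (R \<union> {?v} \<times> {?S} \<times> {..<reg s' rR}) s' \<and> h < length Q' \<and> Q' ! h = Q ! h)"
  let ?b = "Call body_c ;; Bas (Add rR rR rI)"
  have M: "Suc n \<le> M" using n4 by (simp add: M_def)
  have loop: "wp M (WhileGt rM rR ?b) s1 (\<lambda>t. P (1 + t))" if I: "?I s1" for s1
  proof (rule wp_WhileGt[where I = ?I and \<mu> = "\<lambda>s'. Suc n - reg s' rR" and T = "bodyT + 1" and
        T' = "Suc n * (bodyT + 3) + 1"])
    show "?I s1" by fact
    have rM: "reg s' rM = Suc n" "reg s' rI = 1" if "?I s'" for s' using that by (auto simp: dps_def regs_ok_def std_def)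
    show "P (1 + t) s'" if I': "?I s'" and le: "reg s' rM \<le> reg s' rR" "t \<le> Suc n * (bodyT + 3) + 1" for s' t
    proof -
      have "reg s' rR = Suc n" using I' le(1) rM[OF I'] by auto
      then have eq: "{..<reg s' rR} = {..n}" by auto
      obtain Q' where Q': "dps Q' h (R \<union> {?v} \<times> {?S} \<times> {..<reg s' rR}) s'" "h < length Q'" "Q' ! h = Q ! h"
        using I' by blast
      have fr: "frame (insert rR work_regs) s s'" using I' by blast
      show ?thesis
        by (rule P[OF _ fr Q'(1)[unfolded eq] Q'(2,3)]) (use le(2) in \<open>simp add: entryT_def\<close>)
    qed
    show "0 < Suc n - reg s' rR \<and> wp M ?b s' (\<lambda>t s''. ?I s'' \<and> Suc n - reg s'' rR < Suc n - reg s' rR \<and> t \<le> bodyT + 1)"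
      if I: "?I s'" "reg s' rR < reg s' rM" for s'
    proof
      have lt: "reg s' rR < Suc n" using I rM by auto
      then show "0 < Suc n - reg s' rR" by simp
      obtain Q' where Q': "dps Q' h (R \<union> {?v} \<times> {?S} \<times> {..<reg s' rR}) s'" "h < length Q'" "Q' ! h = Q ! h"
        using I by blast
      have rr: "reg s' rC = Q' ! h" "reg s' rV = ?v" "reg s' rP = reg s rP" "reg s' rRP = reg s rRP"
        using I c Q' by (auto simp: frame_def)
      have ins: "insert (?v, ?S, i) (R \<union> {?v} \<times> {?S} \<times> {..<i}) = R \<union> {?v} \<times> {?S} \<times> {..<Suc i}" for i :: nat
        by auto
      have "wp M body_c s' (\<lambda>t s''. vc M (Bas (Add rR rR rI)) s'' (\<lambda>u s''. ?I s'' \<and>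
          Suc n - reg s'' rR < Suc n - reg s' rR \<and> t + u \<le> bodyT + 1))"
      proof (rule wp_body[OF Q'(1,2) rr(1)])
        show "entry (reg s' rV) (reg s' rP) xs" "reg s' rR \<le> n" "reg s' rRP < length rinp"
          "rinp ! reg s' rRP = f (reg s' rV) (set xs)" using e rp rr lt by auto
        fix t s2 Q2
        assume t: "t \<le> bodyT" and s2: "frame work_regs s' s2"
          "dps Q2 h (insert (reg s' rV, ?S, reg s' rR) (R \<union> {?v} \<times> {?S} \<times> {..<reg s' rR})) s2"
          "h < length Q2" "Q2 ! h = Q' ! h"
        have r2: "reg s2 rR = reg s' rR" using s2 by (auto simp: frame_def)
        have i2: "reg s2 rI = 1" using s2(2) by (auto simp: dps_def regs_ok_def std_def)
        let ?s3 = "s2\<lparr>reg := (reg s2)(rR := Suc (reg s' rR))\<rparr>"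
        have "dps Q2 h (R \<union> {?v} \<times> {?S} \<times> {..<Suc (reg s' rR)}) ?s3"
          using s2(2) unfolding rr ins by (rule dps_regs) auto
        moreover have "frame (insert rR work_regs) s ?s3" using I(1) s2(1) by (auto simp: frame_def)
        ultimately have "?I ?s3" using lt s2 Q' by auto
        then show "vc M (Bas (Add rR rR rI)) s2 (\<lambda>u s''. ?I s'' \<and>
          Suc n - reg s'' rR < Suc n - reg s' rR \<and> t + u \<le> bodyT + 1)"
          using t lt M by (simp add: r2 i2)
      qed
      then show "wp M ?b s' (\<lambda>t s''. ?I s'' \<and> Suc n - reg s'' rR < Suc n - reg s' rR \<and> t \<le> bodyT + 1)"
        by (intro wp_vc) simp
    qed
    have "(Suc n - reg s1 rR) * (bodyT + 1 + 2) \<le> Suc n * (bodyT + 1 + 2)" by (rule mult_le_mono1) simp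
    then show "(Suc n - reg s1 rR) * (bodyT + 1 + 2) + 1 \<le> Suc n * (bodyT + 3) + 1" by (simp add: numeral_eq_Suc)
  qed
  have "dps Q h R (s\<lparr>reg := (reg s)(rR := 0)\<rparr>)" using d by (rule dps_regs) auto
  then have "?I (s\<lparr>reg := (reg s)(rR := 0)\<rparr>)" using h by (auto simp: frame_def)
  then show ?thesis
    unfolding entry_c_def by (intro wp_vc) (simp add: loop)
qed

end

section \<open>Traversal of the encoded input\<close>

definition trav_c :: "com \<Rightarrow> com" where
  "trav_c b = Bas (Const rP 1) ;; Bas (Const rRP 0) ;; Bas (Const rV 0) ;;
     WhileGt rN rV (Bas (Load rCnt rP) ;; Bas (Add rP rP rI) ;;
       WhileGt rCnt rZ (Call b ;; Bas (Load rT rP) ;; Bas (Add rP rP rT) ;; Bas (Add rP rP rI) ;;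
         Bas (Add rRP rRP rI) ;; Bas (Sub rCnt rCnt rI)) ;;
       Bas (Add rV rV rI))"

text \<open>Parsing rule for a header \<open>a\<close> followed by its payload \<open>ys\<close>. An
  empty payload covers the reading of a single number.\<close>

lemma drop_Cons_append:
  assumes "drop p l = a # ys @ zs"
  shows "p + length ys < length l" "l ! p = a" "i < length ys \<Longrightarrow> l ! Suc (p + i) = ys ! i"
    "drop (Suc (p + length ys)) l = zs"
proof -
  have p: "p \<le> length l" using assms by (cases "p \<le> length l") auto
  have l: "l = take p l @ a # ys @ zs" using assms by (metis append_take_drop_id)
  have tp: "length (take p l) = p" using p by simp
  have "length l = p + Suc (length ys + length zs)" using arg_cong[OF l, of length] tp by simp
  then show "p + length ys < length l" by simp
  show "l ! p = a" by (subst l) (simp add: nth_append p)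
  show "l ! Suc (p + i) = ys ! i" if "i < length ys"
    by (subst l) (use that in \<open>simp add: nth_append p\<close>)
  show "drop (Suc (p + length ys)) l = zs"
    by (subst l) (simp add: p)
qed

lemma wp_WhileGt_indexed:
  assumes I: "I m s" and fin: "\<And>m s t. bounded N s \<Longrightarrow> I m s \<Longrightarrow> reg s i \<le> reg s j \<Longrightarrow> t \<le> T' \<Longrightarrow> Q t s"
    and step: "\<And>m s. bounded N s \<Longrightarrow> I m s \<Longrightarrow> reg s j < reg s i \<Longrightarrow>
        wp N c s (\<lambda>t s'. (\<exists>l<m. I l s') \<and> t \<le> T)"
    and T': "m * (T + 2) + 1 \<le> T'"
  shows "wp N (WhileGt i j c) s Q"
proof (rule wp_WhileGt[where I = "\<lambda>s. \<exists>m. I m s" and \<mu> = "\<lambda>s. LEAST m. I m s" and T = T and T' = T'])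
  show "\<exists>m. I m s" using I by blast
  show "Q t s'" if "bounded N s'" "\<exists>m. I m s'" "reg s' i \<le> reg s' j" "t \<le> T'" for s' t
    using fin that by blast
  have "(LEAST m. I m s) \<le> m" using I by (rule Least_le)
  then have "(LEAST m. I m s) * (T + 2) \<le> m * (T + 2)" by (rule mult_le_mono1)
  then show "(LEAST m. I m s) * (T + 2) + 1 \<le> T'" using T' by linarith
  fix s' assume b: "bounded N s'" and ex: "\<exists>m. I m s'" and lt: "reg s' j < reg s' i"
  let ?m = "LEAST m. I m s'"
  have Im: "I ?m s'" using ex by (rule LeastI_ex)
  have w: "wp N c s' (\<lambda>t s''. (\<exists>l<?m. I l s'') \<and> t \<le> T)" using step[OF b Im lt] .
  have w': "wp N c s' (\<lambda>t s''. (\<exists>m. I m s'') \<and> (LEAST m. I m s'') < ?m \<and> t \<le> T)"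
    by (rule wp_conseq[OF w]) (meson Least_le le_less_trans)
  \<comment> \<open>With index 0 the body would establish \<open>False\<close>, which is impossible
    because \<open>wp\<close> asserts termination in some state.\<close>
  have "0 < ?m"
  proof (rule ccontr)
    assume "\<not> 0 < ?m"
    then have "wp N c s' (\<lambda>t s''. False)" using w by (intro wp_conseq[OF w]) auto
    then show False using b unfolding wp_def by blast
  qed
  then show "0 < ?m \<and> wp N c s' (\<lambda>t s''. (\<exists>m. I m s'') \<and> (LEAST m. I m s'') < ?m \<and> t \<le> T)"
    using w' by blast
qed

definition ence :: "nat list \<times> real \<Rightarrow> nat list" where "ence = (\<lambda>(xs, r). length xs # xs)"
definition encv :: "(nat list \<times> real) list \<Rightarrow> nat list" where
  "encv es = length es # concat (map ence es)"

context listed_problem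
begin

lemma inp_eq: "inp = n # concat (map encv L)"
  using lists by (simp add: inp_def nat_input_def lists_instance_def encv_def[abs_def] ence_def)

lemma rinp_eq: "rinp = concat (map (map snd) L)"
  by (simp add: rinp_def real_input_def)

lemma lenL: "length L = n" using lists by (simp add: lists_instance_def)

lemma list_entry:
  assumes "v < n" "(xs, r) \<in> set (L ! v)"
  shows "set xs \<in> F v" "distinct xs" "r = f v (set xs)"
proof -
  have l: "(set \<circ> fst) ` set (L ! v) = F v" "\<forall>(xs, r) \<in> set (L ! v). distinct xs \<and> r = f v (set xs)"
    using lists assms(1) by (auto simp: lists_instance_def)
  show "set xs \<in> F v" using l(1) assms(2) by force
  show "distinct xs" "r = f v (set xs)" using l(2) assms(2) by auto
qed

lemma list_F: "v < n \<Longrightarrow> {S. \<exists>xs r. (xs, r) \<in> set (L ! v) \<and> S = set xs} = F v"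
proof -
  assume "v < n"
  then have "F v = (set \<circ> fst) ` set (L ! v)" using lists by (auto simp: lists_instance_def)
  then show ?thesis by (auto simp: image_def Bex_def)
qed

lemma length_encv: "length es \<le> length (concat (map ence es))"
  by (induction es) (auto simp: ence_def)

definition travT :: "nat \<Rightarrow> nat" where "travT T = n * (base * (T + 7) + 6) + 4"

text \<open>\<open>R\<close> collects the pairs already visited. The rule is generic because the
  traversal serves twice: with an empty body it finds the end of the input, whose length the program
  is not told, and with \<open>entry_c\<close> it expands a queue entry.\<close>

lemma wp_trav:
  fixes J :: "(nat \<times> nat set) set \<Rightarrow> machine_state \<Rightarrow> bool"
  assumes J0: "J {} s"
    and Jstd: "\<And>R s. J R s \<Longrightarrow> std n s \<and> input_ok s"
    and Jsame: "\<And>R s s'. J R s \<Longrightarrow> same {rP, rRP, rV, rCnt, rT} s s' \<Longrightarrow> J R s'"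
    and body: "\<And>R s xs. J R s \<Longrightarrow> entry (reg s rV) (reg s rP) xs \<Longrightarrow> reg s rRP < length rinp \<Longrightarrow>
      rinp ! reg s rRP = f (reg s rV) (set xs) \<Longrightarrow>
      wp M b s (\<lambda>t s'. t \<le> T \<and> J (insert (reg s rV, set xs) R) s' \<and> reg s' rP = reg s rP \<and>
        reg s' rRP = reg s rRP \<and> reg s' rV = reg s rV \<and> reg s' rCnt = reg s rCnt)"
    and P: "\<And>t s'. t \<le> travT T \<Longrightarrow> J {(v, S). v < n \<and> S \<in> F v} s' \<Longrightarrow> reg s' rP = base \<Longrightarrow> P t s'"
  shows "wp M (trav_c b) s P"
proof -
  have M: "base \<le> M" "1 \<le> M" "n \<le> M" using n4 by (auto simp: M_def)
  let ?D = "\<lambda>v. {(w, S). w < v \<and> S \<in> F w}"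
  let ?inner = "Call b ;; Bas (Load rT rP) ;; Bas (Add rP rP rT) ;; Bas (Add rP rP rI) ;;
         Bas (Add rRP rRP rI) ;; Bas (Sub rCnt rCnt rI)"
  let ?outer = "Bas (Load rCnt rP) ;; Bas (Add rP rP rI) ;; WhileGt rCnt rZ (?inner) ;; Bas (Add rV rV rI)"
  \<comment> \<open>The two read positions are pinned down by what is left to be read of each
    input.\<close>
  let ?IO = "\<lambda>s'. reg s' rV \<le> n \<and> reg s' rP \<le> base \<and> reg s' rRP \<le> length rinp \<and>
      drop (reg s' rP) inp = concat (map encv (drop (reg s' rV) L)) \<and>
      drop (reg s' rRP) rinp = concat (map (map snd) (drop (reg s' rV) L)) \<and> J (?D (reg s' rV)) s'"
  have inner: "wp M (WhileGt rCnt rZ (?inner)) s1 P'"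
    if v: "reg s1 rV = v" "v < n" and p: "reg s1 rP \<le> base" "reg s1 rRP \<le> length rinp"
      and dr: "drop (reg s1 rP) inp = concat (map ence (L ! v)) @ rest"
        "drop (reg s1 rRP) rinp = map snd (L ! v) @ rrest" and cnt: "reg s1 rCnt = length (L ! v)"
      and J: "J (?D v) s1"
      and P': "\<And>t s'. t \<le> base * (T + 7) + 1 \<Longrightarrow> J (?D (Suc v)) s' \<Longrightarrow> reg s' rV = v \<Longrightarrow> reg s' rP \<le> base \<Longrightarrow>
        reg s' rRP \<le> length rinp \<Longrightarrow> drop (reg s' rP) inp = rest \<Longrightarrow> drop (reg s' rRP) rinp = rrest \<Longrightarrow> P' t s'"
    for s1 P' v rest rrest
  proof -
    let ?R = "\<lambda>es. ?D v \<union> {(v, set xs) | xs r. (xs, r) \<in> set es}"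
    let ?I = "\<lambda>m s'. \<exists>es1 es2. L ! v = es1 @ es2 \<and> reg s' rV = v \<and> reg s' rP \<le> base \<and> reg s' rRP \<le> length rinp \<and>
        drop (reg s' rP) inp = concat (map ence es2) @ rest \<and>
        drop (reg s' rRP) rinp = map snd es2 @ rrest \<and> reg s' rCnt = length es2 \<and> m = length es2 \<and> J (?R es1) s'"
    show ?thesis
    proof (rule wp_WhileGt_indexed[where I = ?I and m = "length (L ! v)" and T = "T + 5" and T' = "base * (T + 7) + 1"])
      show "?I (length (L ! v)) s1" using v p dr cnt J by (intro exI[of _ "[]"] exI[of _ "L ! v"]) auto
      show "P' t s'" if I: "?I m s'" and le: "reg s' rCnt \<le> reg s' rZ" and t: "t \<le> base * (T + 7) + 1" for m s' t
      proof -
        obtain es1 es2 where e: "L ! v = es1 @ es2" "reg s' rV = v" "reg s' rP \<le> base" "reg s' rRP \<le> length rinp"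
          "drop (reg s' rP) inp = concat (map ence es2) @ rest"
          "drop (reg s' rRP) rinp = map snd es2 @ rrest" "reg s' rCnt = length es2" "J (?R es1) s'"
          using I by blast
        have "reg s' rZ = 0" using Jstd[OF e(8)] by (simp add: std_def)
        then have "es2 = []" using le e(7) by simp
        moreover have "?R (L ! v) = ?D (Suc v)" using list_F[OF v(2)] by (auto simp: less_Suc_eq)
        ultimately show ?thesis using e t by (intro P') auto
      qed
      show "wp M (?inner) s' (\<lambda>t s''. (\<exists>l<m. ?I l s'') \<and> t \<le> T + 5)"
        if I: "?I m s'" and gt: "reg s' rZ < reg s' rCnt" for m s'
      proof -
        obtain es1 es2 where e: "L ! v = es1 @ es2" "reg s' rV = v" "reg s' rP \<le> base" "reg s' rRP \<le> length rinp"
          "drop (reg s' rP) inp = concat (map ence es2) @ rest"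
          "drop (reg s' rRP) rinp = map snd es2 @ rrest" "reg s' rCnt = length es2" "m = length es2" "J (?R es1) s'"
          using I by blast
        have "es2 \<noteq> []" using gt e(7) by auto
        then obtain xs r es3 where es2: "es2 = (xs, r) # es3" by (cases es2) auto
        let ?p = "reg s' rP" and ?q = "reg s' rRP"
        have xsr: "(xs, r) \<in> set (L ! v)" using e(1) es2 by simp
        note le = list_entry[OF v(2) xsr]
        have d1: "drop ?p inp = length xs # xs @ (concat (map ence es3) @ rest)" using e(5) es2 by (simp add: ence_def)
        have d2: "drop ?q rinp = r # [] @ (map snd es3 @ rrest)" using e(6) es2 by simp
        note f1 = drop_Cons_append[OF d1] and f2 = drop_Cons_append[OF d2]
        have ent: "entry (reg s' rV) ?p xs" using f1(1-3) le v(2) e(2) by (simp add: entry_def base_def)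
        have q: "?q < length rinp" "rinp ! ?q = f (reg s' rV) (set xs)" using f2(1,2) le(3) e(2) by auto
        have "?R (es1 @ [(xs, r)]) = insert (reg s' rV, set xs) (?R es1)" using e(2) by auto
        then have Ji: "J (insert (reg s' rV, set xs) (?R es1)) t \<Longrightarrow> J (?R (es1 @ [(xs, r)])) t" for t by simp
        have "wp M b s' (\<lambda>t s2. vc M (Bas (Load rT rP) ;; Bas (Add rP rP rT) ;; Bas (Add rP rP rI) ;;
         Bas (Add rRP rRP rI) ;; Bas (Sub rCnt rCnt rI)) s2 (\<lambda>u s''. (\<exists>l<m. ?I l s'') \<and> t + u \<le> T + 5))"
        proof (rule wp_conseq[OF body[OF e(9) ent q]], elim conjE)
          fix t s2
          assume t: "t \<le> T" and J2: "J (insert (reg s' rV, set xs) (?R es1)) s2"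
            and r2: "reg s2 rP = ?p" "reg s2 rRP = ?q" "reg s2 rV = reg s' rV" "reg s2 rCnt = reg s' rCnt"
          have st: "reg s2 rI = 1" "mem s2 ?p = length xs"
            using Jstd[OF J2] f1(1,2) by (auto simp: std_def input_ok_def base_def)
          let ?s3 = "s2\<lparr>reg := (reg s2)(rT := length xs, rP := Suc (?p + length xs), rRP := Suc ?q,
            rCnt := length es3)\<rparr>"
          have J3: "J (?R (es1 @ [(xs, r)])) ?s3" by (rule Jsame[OF Ji[OF J2]]) (simp add: same_def)
          have "?I (length es3) ?s3"
            using e(1,2) es2 f1(1,4) f2(1,4) r2 J3
            by (intro exI[of _ "es1 @ [(xs, r)]"] exI[of _ es3]) (simp add: base_def)
          then have "\<exists>l<m. ?I l ?s3" using e(8) es2 by (intro exI[of _ "length es3"] conjI) (simp, assumption)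
          moreover have "Suc (?p + length xs) \<le> M" "Suc ?q \<le> M" "?p + length xs \<le> M"
            using f1(1) f2(1) M rinp_base by (auto simp: base_def)
          moreover have "reg s' rCnt - 1 = length es3" using e(7) es2 by simp
          ultimately show "vc M (Bas (Load rT rP) ;; Bas (Add rP rP rT) ;; Bas (Add rP rP rI) ;;
             Bas (Add rRP rRP rI) ;; Bas (Sub rCnt rCnt rI)) s2 (\<lambda>u s''. (\<exists>l<m. ?I l s'') \<and> t + u \<le> T + 5)"
            using t e(7) es2 by (simp add: st r2 del: ex_simps)
        qed
        then show ?thesis by (intro wp_vc) (simp only: vc.simps)
      qed
      have "length (L ! v) \<le> base"
      proof -
        have "length (concat (map ence (L ! v))) \<le> length (drop (reg s1 rP) inp)" using dr(1) by simp
        also have "\<dots> \<le> base" by (simp add: base_def)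
        finally show ?thesis using length_encv[of "L ! v"] by linarith
      qed
      then have "length (L ! v) * (T + 5 + 2) \<le> base * (T + 5 + 2)" by (rule mult_le_mono1)
      then show "length (L ! v) * (T + 5 + 2) + 1 \<le> base * (T + 7) + 1" by (simp add: add.commute)
    qed
  qed
  have outer: "wp M (WhileGt rN rV (?outer)) s1 (\<lambda>t. P (1 + (1 + (1 + t))))" if "?IO s1" for s1
  proof (rule wp_WhileGt[where I = ?IO and \<mu> = "\<lambda>s'. n - reg s' rV" and T = "base * (T + 7) + 4" and
        T' = "n * (base * (T + 7) + 6) + 1"])
    show "?IO s1" by fact
    have rN: "reg s' rN = n" "reg s' rI = 1" "input_ok s'" if "?IO s'" for s'
      using Jstd that by (auto simp: std_def)
    show "P (1 + (1 + (1 + t))) s'" if I: "?IO s'" and le: "reg s' rN \<le> reg s' rV" and t: "t \<le> n * (base * (T + 7) + 6) + 1" for s' t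
    proof (rule P)
      have v: "reg s' rV = n" using I le rN[OF I] by linarith
      then show "J {(v, S). v < n \<and> S \<in> F v} s'" using I by auto
      have "drop (reg s' rP) inp = []" using I v lenL by simp
      then have "base \<le> reg s' rP" unfolding base_def by (simp only: drop_eq_Nil)
      then show "reg s' rP = base" using I by linarith
      show "1 + (1 + (1 + t)) \<le> travT T" using t by (simp add: travT_def)
    qed
    show "0 < n - reg s' rV \<and> wp M (?outer) s' (\<lambda>t s''. ?IO s'' \<and> n - reg s'' rV < n - reg s' rV \<and> t \<le> base * (T + 7) + 4)"
      if I: "?IO s'" and lt: "reg s' rV < reg s' rN" for s'
    proof
      let ?v = "reg s' rV" and ?p = "reg s' rP"
      have v: "?v < n" using lt rN[OF I] by simp
      then show "0 < n - ?v" by simp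
      have dL: "drop ?v L = L ! ?v # drop (Suc ?v) L" using v lenL by (simp add: Cons_nth_drop_Suc)
      have d1: "drop ?p inp = length (L ! ?v) # [] @ (concat (map ence (L ! ?v)) @ concat (map encv (drop (Suc ?v) L)))"
        using I dL by (simp add: encv_def)
      note f1 = drop_Cons_append[OF d1]
      have m: "mem s' ?p = length (L ! ?v)" using rN[OF I] f1(1,2) by (simp add: input_ok_def base_def)
      let ?s2 = "s'\<lparr>reg := (reg s')(rCnt := length (L ! ?v), rP := Suc ?p)\<rparr>"
      have "J (?D ?v) s'" using I by blast
      then have J2: "J (?D ?v) ?s2" by (rule Jsame) (simp add: same_def)
      have "wp M (WhileGt rCnt rZ (?inner)) ?s2 (\<lambda>t s3. vc M (Bas (Add rV rV rI)) s3
          (\<lambda>u s''. ?IO s'' \<and> n - reg s'' rV < n - reg s' rV \<and> 1 + (1 + (t + u)) \<le> base * (T + 7) + 4))"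
      proof (rule inner[of ?s2 ?v "concat (map encv (drop (Suc ?v) L))"
            "concat (map (map snd) (drop (Suc ?v) L))"])
        show "reg ?s2 rV = ?v" "?v < n" "reg ?s2 rRP \<le> length rinp" "reg ?s2 rCnt = length (L ! ?v)"
          using v I by auto
        show "reg ?s2 rP \<le> base" using f1(1) by (simp add: base_def)
        show "drop (reg ?s2 rP) inp = concat (map ence (L ! ?v)) @ concat (map encv (drop (Suc ?v) L))"
          using f1(4) by simp
        show "drop (reg ?s2 rRP) rinp = map snd (L ! ?v) @ concat (map (map snd) (drop (Suc ?v) L))"
          using I dL by simp
        show "J (?D ?v) ?s2" by (rule J2)
        fix t s3
        assume t: "t \<le> base * (T + 7) + 1" and s3: "J (?D (Suc ?v)) s3" "reg s3 rV = ?v" "reg s3 rP \<le> base"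
          "reg s3 rRP \<le> length rinp" "drop (reg s3 rP) inp = concat (map encv (drop (Suc ?v) L))"
          "drop (reg s3 rRP) rinp = concat (map (map snd) (drop (Suc ?v) L))"
        let ?s4 = "s3\<lparr>reg := (reg s3)(rV := Suc ?v)\<rparr>"
        have J4: "J (?D (Suc ?v)) ?s4" by (rule Jsame[OF s3(1)]) (simp add: same_def)
        have "?IO ?s4" using s3 J4 v by simp
        moreover have "reg s3 rI = 1" using Jstd[OF s3(1)] by (simp add: std_def)
        ultimately show "vc M (Bas (Add rV rV rI)) s3
          (\<lambda>u s''. ?IO s'' \<and> n - reg s'' rV < n - reg s' rV \<and> 1 + (1 + (t + u)) \<le> base * (T + 7) + 4)"
          using t v M by (simp add: s3(2))
      qed
      moreover have "Suc ?p \<le> M" using f1(1) M by (simp add: base_def)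
      ultimately show "wp M (?outer) s' (\<lambda>t s''. ?IO s'' \<and> n - reg s'' rV < n - reg s' rV \<and> t \<le> base * (T + 7) + 4)"
        by (intro wp_vc) (simp add: m rN[OF I])
    qed
    have "(n - reg s1 rV) * (base * (T + 7) + 4 + 2) \<le> n * (base * (T + 7) + 4 + 2)" by (rule mult_le_mono1) simp
    then show "(n - reg s1 rV) * (base * (T + 7) + 4 + 2) + 1 \<le> n * (base * (T + 7) + 6) + 1" by (simp add: add.commute)
  qed
  let ?s1 = "s\<lparr>reg := (reg s)(rP := 1, rRP := 0, rV := 0)\<rparr>"
  have "J {} ?s1" using J0 by (rule Jsame) (simp add: same_def)
  then have "?IO ?s1" by (simp add: inp_eq rinp_eq base_def)
  then show ?thesis unfolding trav_c_def using M
    by (intro wp_vc) (simp add: outer)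
qed

end

section \<open>Initialisation and the main loop\<close>

definition init_c :: "nat \<Rightarrow> com" where
  "init_c k = Bas (Const rI 1) ;; Bas (Const rF 4) ;; Bas (Load rN rZ) ;; Bas (Add rM rN rI) ;;
     Bas (Const rW 0) ;; Bas (Const rD 2) ;; Bas (Const rU (Suc k)) ;; Bas (Add rT rN rZ) ;;
     WhileGt rT rZ (Bas (Add rW rW rU) ;; Bas (Div rT rT rD))"

text \<open>No table is cleared: the zeros behind the input already say that no code is visited.
  Storing 1 at \<open>base\<close> marks code 0 as visited, and its queue entry and score are the
  zeros found there.\<close>

definition setup_c :: com where
  "setup_c = Call (trav_c Skip) ;; Bas (Add rB rP rZ) ;; Bas (Add rX rN rZ) ;; Call pow_c ;;
     Bas (Add rTop rPow rZ) ;; Bas (Store rB rI) ;; Bas (Const rHead 0) ;; Bas (Const rTail 1)"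

definition bfs_c :: com where
  "bfs_c = WhileGt rTail rHead (Bas (Mul rT rHead rF) ;; Bas (Add rT rT rB) ;; Bas (Const rD 3) ;;
     Bas (Add rT rT rD) ;; Bas (Load rC rT) ;; Call (trav_c entry_c) ;; Bas (Add rHead rHead rI))"

context listed_problem
begin

lemma width_le: "width k m \<le> Suc k * m"
proof (cases "m = 0")
  case False
  have "floor_log m < m"
    using floor_log_exp2_le[of m] less_exp[of "floor_log m"] False by (meson gr0I less_le_trans)
  then have "Suc k * Suc (floor_log m) \<le> Suc k * m" by (intro mult_le_mono2) simp
  then show ?thesis using False by (simp add: width_def)
qed (simp add: width_def)

definition init_ok :: "machine_state \<Rightarrow> bool" where
  "init_ok s \<longleftrightarrow> std n s \<and> reg s rM = Suc n \<and> reg s rW = W \<and>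
     mem s = mem (initial_state L) \<and> rmem s = rmem (initial_state L)"

lemma initial_mem:
  "mem (initial_state L) i = (if i < base then inp ! i else 0)"
  "rmem (initial_state L) i = (if i < length rinp then rinp ! i else 0)"
  by (simp_all add: initial_state_def base_def inp_def rinp_def)

text \<open>The machine has no logarithm, so the width bound is accumulated by halving
  \<open>n\<close>, with one summand \<open>Suc k\<close> per round as in
  \<open>width_half\<close>.\<close>

lemma wp_init:
  assumes P: "\<And>t s'. t \<le> 4 * n + 9 \<Longrightarrow> init_ok s' \<Longrightarrow> P t s'"
  shows "wp M (init_c k) (initial_state L) P"
proof -
  let ?s0 = "initial_state L"
  let ?R = "{rI, rF, rN, rM, rW, rD, rU, rT}"
  let ?I = "\<lambda>s'. same ?R ?s0 s' \<and> std n s' \<and> reg s' rM = Suc n \<and> reg s' rD = 2 \<and> reg s' rU = Suc k \<and>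
      reg s' rT \<le> n \<and> reg s' rW + width k (reg s' rT) = W"
  let ?b = "Bas (Add rW rW rU) ;; Bas (Div rT rT rD)"
  have kn: "Suc k * Suc n = k * n + k + n + 1" by simp
  have WM: "W \<le> M" using width_le[of n] kn by (simp add: W_def M_def)
  have M: "Suc k \<le> M" "4 \<le> M" "Suc n \<le> M" using kn n4 by (simp_all add: M_def)
  have loop: "wp M (WhileGt rT rZ ?b) s1 (\<lambda>t. P (i + t))" if I: "?I s1" and i: "i \<le> 8" for s1 i
  proof (rule wp_WhileGt[where I = ?I and \<mu> = "\<lambda>s'. reg s' rT" and T = 2 and T' = "4 * n + 1"])
    show "?I s1" by fact
    show "P (i + t) s'" if I: "?I s'" and le: "reg s' rT \<le> reg s' rZ" and t: "t \<le> 4 * n + 1" for s' t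
    proof (rule P)
      have "reg s' rT = 0" using I le by (auto simp: std_def)
      then show "init_ok s'" using I by (auto simp: init_ok_def same_def width_def)
      show "i + t \<le> 4 * n + 9" using i t by simp
    qed
    show "0 < reg s' rT \<and> wp M ?b s' (\<lambda>t s''. ?I s'' \<and> reg s'' rT < reg s' rT \<and> t \<le> 2)"
      if I: "?I s'" and gt: "reg s' rZ < reg s' rT" for s'
    proof
      show pos: "0 < reg s' rT" using gt by simp
      have w: "width k (reg s' rT) = width k (reg s' rT div 2) + Suc k" using width_half[OF pos] .
      have "reg s' rW + Suc k \<le> M" using I w WM by simp
      then show "wp M ?b s' (\<lambda>t s''. ?I s'' \<and> reg s'' rT < reg s' rT \<and> t \<le> 2)"
        using I w pos by (intro wp_vc) (auto simp: same_def std_def)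
    qed
    show "reg s1 rT * (2 + 2) + 1 \<le> 4 * n + 1" using I by simp
  qed
  have m0: "mem ?s0 0 = n" by (simp add: initial_mem base_def inp_eq)
  have r0: "reg ?s0 i = 0" for i by (simp add: initial_state_def)
  let ?s1 = "?s0\<lparr>reg := (reg ?s0)(rI := 1, rF := 4, rN := n, rM := Suc n, rW := 0, rD := 2, rU := Suc k, rT := n)\<rparr>"
  have "?I ?s1" using r0 by (auto simp: same_def std_def W_def)
  then have "wp M (WhileGt rT rZ ?b) ?s1 (\<lambda>t. P (8 + t))" by (rule loop) simp
  then have "wp M (WhileGt rT rZ ?b) ?s1 (\<lambda>t. P (1 + (1 + (1 + (1 + (1 + (1 + (1 + (1 + t)))))))))"
    by (rule wp_conseq) (simp add: numeral_eq_Suc)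
  then show ?thesis
    unfolding init_c_def using M by (intro wp_vc) (simp add: r0 m0)
qed

definition setupT :: nat where "setupT = travT 0 + 4 * n + 9"

lemma wp_setup:
  assumes s: "init_ok s" and P: "\<And>t s'. t \<le> setupT \<Longrightarrow> dps [0] 0 {} s' \<Longrightarrow> P t s'"
  shows "wp M setup_c s P"
  unfolding setup_c_def
proof (rule wp_vc, subst vc.simps(3), subst vc.simps(7), rule wp_trav[where J = "\<lambda>R. init_ok" and T = 0])
  show "init_ok s" by fact
  show "std n s' \<and> input_ok s'" if "init_ok s'" for s'
    using that by (auto simp: init_ok_def input_ok_def initial_mem)
  show "init_ok s''" if "init_ok s'" "same {rP, rRP, rV, rCnt, rT} s' s''" for s' s''
    using that by (auto simp: init_ok_def same_def std_def)
  show "wp M Skip s' (\<lambda>t s''. t \<le> 0 \<and> init_ok s'' \<and> reg s'' rP = reg s' rP \<and>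
        reg s'' rRP = reg s' rRP \<and> reg s'' rV = reg s' rV \<and> reg s'' rCnt = reg s' rCnt)" if "init_ok s'" for s'
    using that by (intro wp_Skip) auto
  fix t s1
  assume t: "t \<le> travT 0" and s1: "init_ok s1" "reg s1 rP = base"
  have M: "4 ^ n \<le> M" "base \<le> M" "n \<le> M" "1 \<le> M" using n4 by (simp_all add: M_def)
  have r1: "reg s1 rZ = 0" "reg s1 rN = n" using s1 by (auto simp: init_ok_def std_def)
  let ?s2 = "s1\<lparr>reg := (reg s1)(rB := base, rX := n)\<rparr>"
  have "wp M pow_c ?s2 (\<lambda>u s3. vc M (Bas (Add rTop rPow rZ) ;; Bas (Store rB rI) ;; Bas (Const rHead 0) ;;
      Bas (Const rTail 1)) s3 (\<lambda>w. P (t + (1 + (1 + (u + w))))))"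
  proof (rule wp_pow[of n])
    show "std n ?s2" using s1 by (auto simp: init_ok_def std_def)
    show "reg ?s2 rX \<le> n" "4 ^ n \<le> M" using M by auto
    fix u s3
    assume u: "u \<le> 4 * n + 3" and s3: "same {rPow, rT} ?s2 s3" "reg s3 rPow = 4 ^ reg ?s2 rX"
    have r3: "reg s3 rPow = 4 ^ n" "reg s3 rZ = 0" "reg s3 rB = base" "reg s3 rI = 1"
      using s3 s1 by (auto simp: same_def init_ok_def std_def)
    have m3: "mem s3 = mem (initial_state L)" "rmem s3 = rmem (initial_state L)"
      using s3 s1 by (auto simp: same_def init_ok_def)
    let ?s4 = "s3\<lparr>mem := (mem s3)(base := 1), reg := (reg s3)(rTop := 4 ^ n, rHead := 0, rTail := 1)\<rparr>"
    have "dp_inv E [0] 0 (prvA ?s4) (bvA ?s4) (bpA ?s4) (scA ?s4) {}"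
      using rinp_base by (intro dp_inv_init) (auto simp: prvA_def scA_def m3 initial_mem)
    moreover have "input_ok ?s4" by (auto simp: input_ok_def m3 initial_mem)
    moreover have "regs_ok ?s4" using s3 s1 by (auto simp: regs_ok_def std_def init_ok_def same_def)
    moreover have "quA ?s4 0 = 0" by (simp add: quA_def m3 initial_mem)
    ultimately have "dps [0] 0 {} ?s4" by (simp add: dps_def)
    then have "P (t + (1 + (1 + (u + (1 + (1 + (1 + 1))))))) ?s4"
      using t u by (intro P) (simp add: setupT_def)
    then show "vc M (Bas (Add rTop rPow rZ) ;; Bas (Store rB rI) ;; Bas (Const rHead 0) ;;
      Bas (Const rTail 1)) s3 (\<lambda>w. P (t + (1 + (1 + (u + w)))))"
      using M by (simp add: r3)
  qed
  then show "vc M (Bas (Add rB rP rZ) ;; Bas (Add rX rN rZ) ;; Call pow_c ;;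
     Bas (Add rTop rPow rZ) ;; Bas (Store rB rI) ;; Bas (Const rHead 0) ;; Bas (Const rTail 1)) s1 (\<lambda>u. P (t + u))"
    using M by (simp add: r1 s1(2))
qed

definition NS :: nat where "NS = card {c. c < 4 ^ n \<and> card (active n (dig c)) \<le> W}"

definition bfsT :: nat where "bfsT = NS * (travT entryT + 8) + 1"

text \<open>Each round expands one queue entry and no code is queued twice, so the number of rounds
  is at most \<open>NS\<close> instead of \<open>4 ^ n\<close>.\<close>

lemma wp_bfs:
  assumes s: "dps [0] 0 {} s" and P: "\<And>t s' Q. t \<le> bfsT \<Longrightarrow> dps Q (length Q) {} s' \<Longrightarrow> P t s'"
  shows "wp M bfs_c s P"
proof -
  let ?I = "\<lambda>s'. \<exists>Q. dps Q (reg s' rHead) {} s'"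
  let ?b = "Bas (Mul rT rHead rF) ;; Bas (Add rT rT rB) ;; Bas (Const rD 3) ;;
     Bas (Add rT rT rD) ;; Bas (Load rC rT) ;; Call (trav_c entry_c) ;; Bas (Add rHead rHead rI)"
  have len: "length Q \<le> NS" if "dps Q h R s'" for Q h R s'
    using that dp_inv_length[of E Q h "prvA s'" "bvA s'" "bpA s'" "scA s'" R] by (auto simp: dps_def NS_def)
  show ?thesis
    unfolding bfs_c_def
  proof (rule wp_WhileGt[where I = ?I and \<mu> = "\<lambda>s'. NS - reg s' rHead" and T = "travT entryT + 6" and T' = bfsT])
    show "?I s" using s by (auto simp: dps_def)
    show "P t s'" if I: "?I s'" and le: "reg s' rTail \<le> reg s' rHead" and t: "t \<le> bfsT" for s' t
    proof -
      obtain Q where Q: "dps Q (reg s' rHead) {} s'" using I by blast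
      then have "reg s' rHead = length Q" using le by (auto simp: dps_def dp_inv_def)
      then show ?thesis using P[OF t] Q by simp
    qed
    have "(NS - reg s rHead) * (travT entryT + 8) \<le> NS * (travT entryT + 8)"
      by (rule mult_le_mono1) simp
    then show "(NS - reg s rHead) * (travT entryT + 6 + 2) + 1 \<le> bfsT"
      by (simp add: bfsT_def add.commute)
    show "0 < NS - reg s' rHead \<and> wp M ?b s' (\<lambda>t s''. ?I s'' \<and> NS - reg s'' rHead < NS - reg s' rHead \<and> t \<le> travT entryT + 6)"
      if I: "?I s'" and lt: "reg s' rHead < reg s' rTail" for s'
    proof -
      define h where "h = reg s' rHead"
      obtain Q where Q: "dps Q h {} s'" using I by (auto simp: h_def)
      have h: "h < length Q" using lt Q by (auto simp: dps_def h_def)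
      have rr: "reg s' rF = 4" "reg s' rB = base" using Q by (auto simp: dps_def regs_ok_def std_def)
      have hN: "h < NS" using h len[OF Q] by simp
      have h4: "h < 4 ^ n" using h Q dp_inv_len4 by (fastforce simp: dps_def)
      have q: "mem s' (h * 4 + base + 3) = Q ! h"
        using Q h by (auto simp: dps_def quA_def mult.commute add.commute)
      have M: "h * 4 \<le> M" "h * 4 + base \<le> M" "3 \<le> M" "h * 4 + base + 3 \<le> M" "Suc h \<le> M"
        using h4 by (simp_all add: M_def)
      let ?R = "\<lambda>R. {(v, S, r). (v, S) \<in> R \<and> r \<le> n}"
      let ?J = "\<lambda>R s'. \<exists>Q'. dps Q' h (?R R) s' \<and> h < length Q' \<and> Q' ! h = Q ! h \<and> reg s' rC = Q ! h"
      let ?s1 = "s'\<lparr>reg := (reg s')(rD := 3, rT := h * 4 + base + 3, rC := Q ! h)\<rparr>"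
      have R0: "?R {} = {}" by auto
      have "dps Q h (?R {}) ?s1" unfolding R0 using Q by (rule dps_regs) auto
      moreover have "reg ?s1 rC = Q ! h" by simp
      ultimately have J0: "?J {} ?s1" using h by blast
      have "wp M (trav_c entry_c) ?s1 (\<lambda>t s2. vc M (Bas (Add rHead rHead rI)) s2
        (\<lambda>u s''. ?I s'' \<and> NS - reg s'' rHead < NS - h \<and> 1 + (1 + (1 + (1 + (1 + (t + u))))) \<le> travT entryT + 6))"
      proof (rule wp_trav[where J = ?J and T = entryT, OF J0])
        show "std n s2 \<and> input_ok s2" if "?J R s2" for R s2 using that by (auto simp: dps_def regs_ok_def)
        show "?J R s3" if J: "?J R s2" and sm: "same {rP, rRP, rV, rCnt, rT} s2 s3" for R s2 s3
        proof -
          obtain Q' where Q': "dps Q' h (?R R) s2" "h < length Q'" "Q' ! h = Q ! h" "reg s2 rC = Q ! h"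
            using J by blast
          have "dps Q' h (?R R) s3" using Q'(1) sm by (rule dps_same) simp
          moreover have "reg s3 rC = Q ! h" using Q'(4) sm by (simp add: same_def)
          ultimately show ?thesis using Q' by blast
        qed
        show "wp M entry_c s2 (\<lambda>t s3. t \<le> entryT \<and> ?J (insert (reg s2 rV, set xs) R) s3 \<and> reg s3 rP = reg s2 rP \<and>
          reg s3 rRP = reg s2 rRP \<and> reg s3 rV = reg s2 rV \<and> reg s3 rCnt = reg s2 rCnt)"
          if J: "?J R s2" and e: "entry (reg s2 rV) (reg s2 rP) xs" "reg s2 rRP < length rinp"
            "rinp ! reg s2 rRP = f (reg s2 rV) (set xs)" for R s2 xs
        proof -
          obtain Q' where Q': "dps Q' h (?R R) s2" "h < length Q'" "Q' ! h = Q ! h" "reg s2 rC = Q ! h"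
            using J by blast
          have rc: "reg s2 rC = Q' ! h" using Q' by simp
          have eq: "?R R \<union> {reg s2 rV} \<times> {set xs} \<times> {..n} = ?R (insert (reg s2 rV, set xs) R)" by auto
          show ?thesis
          proof (rule wp_entry[OF Q'(1,2) rc e])
            fix t s3 Q3
            assume t: "t \<le> entryT" and fr: "frame (insert rR work_regs) s2 s3"
              and d3: "dps Q3 h (?R R \<union> {reg s2 rV} \<times> {set xs} \<times> {..n}) s3" "h < length Q3" "Q3 ! h = Q' ! h"
            have "reg s3 rP = reg s2 rP" "reg s3 rRP = reg s2 rRP" "reg s3 rV = reg s2 rV"
              "reg s3 rCnt = reg s2 rCnt" "reg s3 rC = Q ! h" using fr Q'(4) by (auto simp: frame_def)
            moreover have "?J (insert (reg s2 rV, set xs) R) s3"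
              using d3 Q'(3) calculation(5) unfolding eq by auto
            ultimately show "t \<le> entryT \<and> ?J (insert (reg s2 rV, set xs) R) s3 \<and> reg s3 rP = reg s2 rP \<and>
              reg s3 rRP = reg s2 rRP \<and> reg s3 rV = reg s2 rV \<and> reg s3 rCnt = reg s2 rCnt" using t by blast
          qed
        qed
        fix t s2
        assume t: "t \<le> travT entryT" and J: "?J {(v, S). v < n \<and> S \<in> F v} s2"
        obtain Q' where Q': "dps Q' h (?R {(v, S). v < n \<and> S \<in> F v}) s2" "h < length Q'" using J by blast
        have "dp_inv E Q' h (prvA s2) (bvA s2) (bpA s2) (scA s2) (?R {(v, S). v < n \<and> S \<in> F v})"
          using Q' by (auto simp: dps_def)
        then have dn: "dp_inv E Q' (Suc h) (prvA s2) (bvA s2) (bpA s2) (scA s2) {}"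
          using Q'(2) by (rule dp_inv_next) auto
        let ?s3 = "s2\<lparr>reg := (reg s2)(rHead := Suc h)\<rparr>"
        have "prvA ?s3 = prvA s2" "bvA ?s3 = bvA s2" "bpA ?s3 = bpA s2" "scA ?s3 = scA s2" "quA ?s3 = quA s2"
          by (auto simp: prvA_def bvA_def bpA_def scA_def quA_def)
        then have "dps Q' (Suc h) {} ?s3"
          using Q'(1) dn by (auto simp: dps_def input_ok_def regs_ok_def std_def)
        then have "?I ?s3" by auto
        moreover have "reg s2 rHead = h" "reg s2 rI = 1" using Q'(1) by (auto simp: dps_def regs_ok_def std_def)
        ultimately show "vc M (Bas (Add rHead rHead rI)) s2
          (\<lambda>u s''. ?I s'' \<and> NS - reg s'' rHead < NS - h \<and> 1 + (1 + (1 + (1 + (1 + (t + u))))) \<le> travT entryT + 6)"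
          using t hN M by simp
      qed
      then have "wp M ?b s' (\<lambda>t s''. ?I s'' \<and> NS - reg s'' rHead < NS - h \<and> t \<le> travT entryT + 6)"
        using M by (intro wp_vc) (simp add: rr h_def[symmetric] q)
      then show ?thesis using hN unfolding h_def by (intro conjI) simp_all
    qed
  qed
qed

end

section \<open>Reading the optimal polytree off the tables\<close>

definition collect_c :: com where
  "collect_c = Bas (Sub rC rTop rI) ;; Bas (Mul rA rTop rF) ;; Bas (Add rA rA rB) ;; Bas (Add rQ rA rZ) ;;
     WhileGt rC rZ (Bas (Mul rT rC rF) ;; Bas (Add rT rT rB) ;; Bas (Load rU rT) ;; Bas (Add rT rT rI) ;;
       Bas (Load rV rT) ;; Bas (Add rT rT rI) ;; Bas (Load rP rT) ;; Bas (Load rEnd rP) ;;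
       Bas (Add rEnd rEnd rP) ;;
       WhileGt rEnd rP (Bas (Add rP rP rI) ;; Bas (Load rX rP) ;; Bas (Store rQ rX) ;;
         Bas (Add rQ rQ rI) ;; Bas (Store rQ rV) ;; Bas (Add rQ rQ rI)) ;;
       Bas (Sub rC rU rI))"

text \<open>The arcs are collected behind all tables first, because the output overwrites the input.\<close>

definition copy_c :: com where
  "copy_c = Bas (Const rT 1) ;; Bas (Add rP rA rZ) ;;
     WhileGt rQ rP (Bas (Load rX rP) ;; Bas (Store rT rX) ;; Bas (Add rP rP rI) ;; Bas (Add rT rT rI)) ;;
     Bas (Sub rT rT rI) ;; Bas (Const rD 2) ;; Bas (Div rT rT rD) ;; Bas (Store rZ rT)"

definition prog :: "nat \<Rightarrow> com" where
  "prog k = Call (init_c k) ;; Call setup_c ;; Call bfs_c ;; Call collect_c ;; Call copy_c"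

context listed_problem
begin

definition start :: nat where "start = base + 4 * 4 ^ n"

definition stored :: "(nat \<Rightarrow> nat) \<Rightarrow> (nat \<times> nat) list \<Rightarrow> bool" where
  "stored m al \<longleftrightarrow> (\<forall>i<length al. m (start + 2 * i) = fst (al ! i) \<and> m (start + 2 * i + 1) = snd (al ! i))"

lemma stored_snoc:
  assumes "stored m al"
  shows "stored (m(start + 2 * length al := x, Suc (start + 2 * length al) := y)) (al @ [(x, y)])"
  unfolding stored_def
proof (intro allI impI)
  fix i assume "i < length (al @ [(x, y)])"
  then consider "i < length al" | "i = length al" by fastforce
  then show "(m(start + 2 * length al := x, Suc (start + 2 * length al) := y)) (start + 2 * i) = fst ((al @ [(x, y)]) ! i) \<and>
    (m(start + 2 * length al := x, Suc (start + 2 * length al) := y)) (start + 2 * i + 1) = snd ((al @ [(x, y)]) ! i)"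
  proof cases
    case 1
    have "start + 2 * i \<noteq> Suc (start + 2 * length al)" "start + 2 * i + 1 \<noteq> start + 2 * length al" by presburger+
    then show ?thesis using 1 assms by (auto simp: stored_def nth_append)
  next
    case 2
    then show ?thesis by auto
  qed
qed

text \<open>At most \<open>n\<close> traced steps with at most \<open>n\<close> arcs each: this
  keeps the addresses of the collected arcs below \<open>M\<close>.\<close>

lemma nn4: "n * n \<le> 4 ^ n"
proof -
  have "n * n \<le> 2 ^ n * 2 ^ n" using less_exp[of n] by (intro mult_le_mono) auto
  also have "\<dots> = 4 ^ n" by (simp add: power_mult_distrib[symmetric])
  finally show ?thesis .
qed

definition collectT :: nat where "collectT = n * (8 * n + 13) + 5"

text \<open>Only addresses from \<open>start\<close> on are written, so the tables and the input,
  which the rest of the trace still reads, keep their contents.\<close>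

lemma wp_collect:
  assumes s: "dps Q (length Q) {} s"
    and P: "\<And>t s' al. t \<le> collectT \<Longrightarrow> optimal_polytree {..<n} F f (set al) \<Longrightarrow> length al \<le> n * n \<Longrightarrow>
      reg s' rZ = 0 \<Longrightarrow> reg s' rI = 1 \<Longrightarrow> reg s' rA = start \<Longrightarrow> reg s' rQ = start + 2 * length al \<Longrightarrow>
      stored (mem s') al \<Longrightarrow> P t s'"
  shows "wp M collect_c s P"
proof -
  let ?tr = "trace E (prvA s) (bvA s) (bpA s)"
  have dp: "dp_inv E Q (length Q) (prvA s) (bvA s) (bpA s) (scA s) {}" and io: "input_ok s" and ro: "regs_ok s"
    using s by (auto simp: dps_def)
  obtain A0 m0 where A0: "?tr (4 ^ n - 1) A0 m0" "m0 \<le> n" "optimal_polytree {..<n} F f A0"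
    using dp_inv_optimal[OF dp] by blast
  let ?C = "\<lambda>s'. (\<forall>i<start. mem s' i = mem s i) \<and> reg s' rZ = 0 \<and> reg s' rI = 1 \<and> reg s' rF = 4 \<and>
      reg s' rB = base \<and> reg s' rA = start"
  let ?in = "Bas (Add rP rP rI) ;; Bas (Load rX rP) ;; Bas (Store rQ rX) ;;
         Bas (Add rQ rQ rI) ;; Bas (Store rQ rV) ;; Bas (Add rQ rQ rI)"
  have inner: "wp M (WhileGt rEnd rP (?in)) s1 P'"
    if C: "?C s1" and r: "reg s1 rV = v" "reg s1 rP = p" "reg s1 rEnd = p + length xs" "reg s1 rU = u"
      "reg s1 rQ = start + 2 * length al" and st: "stored (mem s1) al"
      and len: "length al + length xs \<le> n * n" and e: "entry v p xs"
      and P': "\<And>t s'. t \<le> 8 * n + 1 \<Longrightarrow> ?C s' \<Longrightarrow> reg s' rU = u \<Longrightarrow>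
        reg s' rQ = start + 2 * length (al @ map (\<lambda>x. (x, v)) xs) \<Longrightarrow>
        stored (mem s') (al @ map (\<lambda>x. (x, v)) xs) \<Longrightarrow> P' t s'" for s1 P' v p xs u al
  proof -
    let ?al = "\<lambda>i. al @ map (\<lambda>x. (x, v)) (take i xs)"
    let ?I = "\<lambda>m s'. \<exists>i. m + i = length xs \<and> ?C s' \<and> reg s' rV = v \<and> reg s' rP = p + i \<and>
      reg s' rEnd = p + length xs \<and> reg s' rU = u \<and> reg s' rQ = start + 2 * (length al + i) \<and> stored (mem s') (?al i)"
    show ?thesis
    proof (rule wp_WhileGt_indexed[where I = ?I and m = "length xs" and T = 6 and T' = "8 * n + 1"])
      show "?I (length xs) s1" using C r st by (intro exI[of _ 0]) auto
      show "P' t s'" if I: "?I m s'" and le: "reg s' rEnd \<le> reg s' rP" and t: "t \<le> 8 * n + 1" for m s' t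
      proof -
        obtain i where i: "m + i = length xs" "?C s'" "reg s' rV = v" "reg s' rP = p + i"
          "reg s' rEnd = p + length xs" "reg s' rU = u" "reg s' rQ = start + 2 * (length al + i)" "stored (mem s') (?al i)"
          using I by blast
        have il: "i = length xs" using i(1,4,5) le by simp
        show ?thesis by (rule P'[OF t i(2) i(6)]) (use i(7,8) il in auto)
      qed
      show "wp M (?in) s' (\<lambda>t s''. (\<exists>l<m. ?I l s'') \<and> t \<le> 6)"
        if I: "?I m s'" and lt: "reg s' rP < reg s' rEnd" for m s'
      proof -
        obtain i where i: "m + i = length xs" "?C s'" "reg s' rV = v" "reg s' rP = p + i"
          "reg s' rEnd = p + length xs" "reg s' rU = u" "reg s' rQ = start + 2 * (length al + i)" "stored (mem s') (?al i)"
          using I by blast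
        have il: "i < length xs" using i(4,5) lt by simp
        note ef = entry_facts[OF e io]
        have pb: "p + length xs < base" using e by (simp add: entry_def)
        have "Suc (p + i) < start" using pb il by (simp add: start_def)
        then have mx: "mem s' (Suc (p + i)) = xs ! i" using i(2) ef(2)[OF il] by simp
        have al: "?al (Suc i) = ?al i @ [(xs ! i, v)]" using il by (simp add: take_Suc_conv_app_nth)
        have lal: "length (?al i) = length al + i" using il by simp
        let ?o = "start + 2 * (length al + i)"
        let ?m = "(mem s')(?o := xs ! i, Suc ?o := v)"
        have st': "stored ?m (?al (Suc i))"
          using stored_snoc[OF i(8), of "xs ! i" v] unfolding al lal .
        have "length al + i < n * n" using len il by simp
        then have bM: "Suc (Suc ?o) \<le> M" using nn4 by (simp add: M_def start_def)
        have pM: "Suc (p + i) \<le> M" using pb il by (simp add: M_def)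
        let ?s3 = "s'\<lparr>mem := ?m, reg := (reg s')(rP := Suc (p + i), rX := xs ! i, rQ := Suc (Suc ?o))\<rparr>"
        have "?C ?s3" using i(2) by simp
        then have I3: "?I (m - 1) ?s3" using i(1,3,5,6) st' il by (intro exI[of _ "Suc i"]) auto
        have lm: "m - 1 < m" using i(1) il by simp
        have "\<exists>l<m. ?I l ?s3" using lm I3 by blast
        moreover have "reg s' rI = 1" using i(2) by blast
        ultimately show ?thesis
          using bM pM mx i(3,4,7) by (intro wp_vc) (simp del: ex_simps)
      qed
      have "length xs \<le> n" using entry_facts(3,4)[OF e io] distinct_card[of xs] card_mono[of "{..<n}" "set xs"] by fastforce
      then show "length xs * (6 + 2) + 1 \<le> 8 * n + 1" by simp
    qed
  qed
  let ?out = "Bas (Mul rT rC rF) ;; Bas (Add rT rT rB) ;; Bas (Load rU rT) ;; Bas (Add rT rT rI) ;;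
       Bas (Load rV rT) ;; Bas (Add rT rT rI) ;; Bas (Load rP rT) ;; Bas (Load rEnd rP) ;;
       Bas (Add rEnd rEnd rP) ;; WhileGt rEnd rP (?in) ;; Bas (Sub rC rU rI)"
  \<comment> \<open>\<open>A\<close> is what the rest of the trace will still contribute, and
    \<open>n * m\<close> reserves room for its arcs.\<close>
  let ?I = "\<lambda>m s'. \<exists>A al. ?tr (reg s' rC) A m \<and> A \<union> set al = A0 \<and> length al + n * m \<le> n * n \<and> ?C s' \<and>
      reg s' rQ = start + 2 * length al \<and> stored (mem s') al"
  have outer: "wp M (WhileGt rC rZ (?out)) s1 (\<lambda>t. P (1 + (1 + (1 + (1 + t)))))" if I: "?I m0 s1" for s1
  proof (rule wp_WhileGt_indexed[where I = ?I and m = m0 and T = "8 * n + 11" and T' = "n * (8 * n + 13) + 1", OF I])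
    show "P (1 + (1 + (1 + (1 + t)))) s'" if I: "?I m s'" and le: "reg s' rC \<le> reg s' rZ" and t: "t \<le> n * (8 * n + 13) + 1" for m s' t
    proof -
      obtain A al where i: "?tr (reg s' rC) A m" "A \<union> set al = A0" "length al + n * m \<le> n * n" "?C s'"
        "reg s' rQ = start + 2 * length al" "stored (mem s') al" using I by blast
      have r0: "reg s' rC = 0" using le i(4) by simp
      have "A = {}" using i(1) r0 by (cases rule: trace.cases) auto
      then have "set al = A0" using i(2) by simp
      then show ?thesis using t i A0(3) by (intro P[of _ al]) (auto simp: collectT_def)
    qed
    show "wp M (?out) s' (\<lambda>t s''. (\<exists>l<m. ?I l s'') \<and> t \<le> 8 * n + 11)"
      if I: "?I m s'" and gt: "reg s' rZ < reg s' rC" for m s'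
    proof -
      obtain A al where i: "?tr (reg s' rC) A m" "A \<union> set al = A0" "length al + n * m \<le> n * n" "?C s'"
        "reg s' rQ = start + 2 * length al" "stored (mem s') al" using I by blast
      define c where "c = reg s' rC"
      have "c \<noteq> 0" using gt by (simp add: c_def)
      with i(1)[folded c_def] obtain c' A' m' S where c': "?tr c' A' m'" "c < 4 ^ n" "prvA s c = Suc c'"
        "E (bvA s c) (bpA s c) S" "A = A' \<union> S \<times> {bvA s c}" "m = Suc m'"
        by (cases rule: trace.cases) auto
      define v p where "v = bvA s c" and "p = bpA s c"
      obtain xs where xs: "entry v p xs" "set xs = S" using c'(4) by (auto simp: E_def v_def p_def)
      note ef = entry_facts[OF xs(1) io]
      have pb: "p + length xs < base" using xs(1) by (simp add: entry_def)
      have lx: "length xs \<le> n" using ef(3,4) distinct_card[of xs] card_mono[of "{..<n}" "set xs"] by fastforce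
      have mm: "mem s' (c * 4 + base) = Suc c'" "mem s' (Suc (c * 4 + base)) = v"
        "mem s' (Suc (Suc (c * 4 + base))) = p" "mem s' p = length xs"
        using i(4) c'(2,3) ef(1) pb
        by (auto simp: start_def prvA_def bvA_def bpA_def v_def p_def mult.commute add.commute)
      have bM: "c * 4 \<le> M" "c * 4 + base \<le> M" "Suc (Suc (c * 4 + base)) \<le> M" "length xs + p \<le> M"
        using c'(2) pb by (simp_all add: M_def)
      let ?s2 = "s'\<lparr>reg := (reg s')(rU := Suc c', rV := v, rT := Suc (Suc (c * 4 + base)), rP := p, rEnd := length xs + p)\<rparr>"
      have "wp M (WhileGt rEnd rP (?in)) ?s2 (\<lambda>t s3. vc M (Bas (Sub rC rU rI)) s3 (\<lambda>w s''. (\<exists>l<m. ?I l s'') \<and>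
          1 + (1 + (1 + (1 + (1 + (1 + (1 + (1 + (1 + (t + w))))))))) \<le> 8 * n + 11))"
      proof (rule inner[of ?s2 v p xs "Suc c'" al])
        show "?C ?s2" using i(4) by simp
        show "reg ?s2 rV = v" "reg ?s2 rP = p" "reg ?s2 rEnd = p + length xs" "reg ?s2 rU = Suc c'"
          "reg ?s2 rQ = start + 2 * length al" "stored (mem ?s2) al" using i(5,6) by auto
        show "length al + length xs \<le> n * n" using i(3) lx c'(6) by simp
        show "entry v p xs" by fact
        fix t :: nat and s3 :: machine_state
        let ?al = "al @ map (\<lambda>x. (x, v)) xs"
        assume t: "t \<le> 8 * n + 1" and s3: "?C s3" "reg s3 rU = Suc c'" "reg s3 rQ = start + 2 * length ?al"
          "stored (mem s3) ?al"
        let ?s4 = "s3\<lparr>reg := (reg s3)(rC := c')\<rparr>"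
        have "A' \<union> set ?al = A0" using i(2) c'(5) xs(2) by (auto simp: v_def)
        moreover have "length ?al + n * m' \<le> n * n" using i(3) lx c'(6) by simp
        ultimately have I4: "?I m' ?s4" using c'(1) s3 by (intro exI[of _ A'] exI[of _ ?al]) auto
        have lm: "m' < m" using c'(6) by simp
        have "\<exists>l<m. ?I l ?s4" using lm I4 by blast
        moreover have "reg s3 rI = 1" using s3(1) by blast
        ultimately show "vc M (Bas (Sub rC rU rI)) s3 (\<lambda>w s''. (\<exists>l<m. ?I l s'') \<and>
          1 + (1 + (1 + (1 + (1 + (1 + (1 + (1 + (1 + (t + w))))))))) \<le> 8 * n + 11)"
          using t s3(2) by (simp del: ex_simps)
      qed
      moreover have "reg s' rF = 4" "reg s' rB = base" "reg s' rI = 1" using i(4) by blast+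
      ultimately show ?thesis using bM by (intro wp_vc) (simp add: mm c_def[symmetric])
    qed
    have "m0 * (8 * n + 11 + 2) \<le> n * (8 * n + 11 + 2)" using A0(2) by (rule mult_le_mono1)
    then show "m0 * (8 * n + 11 + 2) + 1 \<le> n * (8 * n + 13) + 1" by (simp add: add.commute)
  qed
  have rr: "reg s rTop = 4 ^ n" "reg s rI = 1" "reg s rF = 4" "reg s rB = base" "reg s rZ = 0"
    using ro by (auto simp: regs_ok_def std_def)
  have st: "4 ^ n * 4 + base = start" by (simp add: start_def)
  have bM: "4 ^ n * 4 \<le> M" "start \<le> M" by (simp_all add: M_def start_def)
  let ?s1 = "s\<lparr>reg := (reg s)(rC := 4 ^ n - 1, rA := start, rQ := start)\<rparr>"
  have "n * m0 \<le> n * n" using A0(2) by simp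
  then have "?I m0 ?s1" using A0(1) rr by (intro exI[of _ A0] exI[of _ "[]"]) (auto simp: stored_def)
  from outer[OF this] show ?thesis
    unfolding collect_c_def using bM by (intro wp_vc) (simp add: rr st)
qed

definition copyT :: nat where "copyT = 12 * (n * n) + 10"

lemma wp_copy:
  assumes s: "reg s rZ = 0" "reg s rI = 1" "reg s rA = start" "reg s rQ = start + 2 * length al"
    "stored (mem s) al" "length al \<le> n * n"
    and P: "\<And>t s'. t \<le> copyT \<Longrightarrow> output_arcs s' = set al \<Longrightarrow> P t s'"
  shows "wp M copy_c s P"
proof -
  let ?l = "2 * length al"
  let ?b = "Bas (Load rX rP) ;; Bas (Store rT rX) ;; Bas (Add rP rP rI) ;; Bas (Add rT rT rI)"
  let ?I = "\<lambda>m s'. \<exists>j. m + j = ?l \<and> reg s' rZ = 0 \<and> reg s' rI = 1 \<and> reg s' rQ = start + ?l \<and>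
      reg s' rP = start + j \<and> reg s' rT = Suc j \<and> (\<forall>i<j. mem s' (Suc i) = mem s (start + i)) \<and>
      (\<forall>i\<ge>j. mem s' (start + i) = mem s (start + i))"
  have bM: "start + ?l + 1 \<le> M" "2 \<le> M" "?l + 1 \<le> M" using s(6) nn4 by (simp_all add: M_def start_def)
  \<comment> \<open>Therefore writing to \<open>Suc j\<close> never destroys an arc that is still to
    be copied.\<close>
  have pos: "0 < start" by (simp add: start_def)
  have loop: "wp M (WhileGt rQ rP ?b) s1 P'" if I: "?I ?l s1"
    and P': "\<And>t s'. t \<le> 12 * (n * n) + 1 \<Longrightarrow> reg s' rZ = 0 \<Longrightarrow> reg s' rI = 1 \<Longrightarrow> reg s' rT = Suc ?l \<Longrightarrow>
      (\<forall>i<?l. mem s' (Suc i) = mem s (start + i)) \<Longrightarrow> P' t s'" for s1 P'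
  proof (rule wp_WhileGt_indexed[where I = ?I and m = ?l and T = 4 and T' = "12 * (n * n) + 1", OF I])
    show "P' t s'" if I: "?I m s'" and le: "reg s' rQ \<le> reg s' rP" and t: "t \<le> 12 * (n * n) + 1" for m s' t
    proof -
      obtain j where j: "m + j = ?l" "reg s' rZ = 0" "reg s' rI = 1" "reg s' rQ = start + ?l"
        "reg s' rP = start + j" "reg s' rT = Suc j" "\<forall>i<j. mem s' (Suc i) = mem s (start + i)" using I by blast
      have "j = ?l" using j(1,4,5) le by simp
      then show ?thesis using j t by (intro P') auto
    qed
    show "wp M ?b s' (\<lambda>t s''. (\<exists>l<m. ?I l s'') \<and> t \<le> 4)" if I: "?I m s'" and lt: "reg s' rP < reg s' rQ" for m s'
    proof -
      obtain j where j: "m + j = ?l" "reg s' rZ = 0" "reg s' rI = 1" "reg s' rQ = start + ?l"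
        "reg s' rP = start + j" "reg s' rT = Suc j" "\<forall>i<j. mem s' (Suc i) = mem s (start + i)"
        "\<forall>i\<ge>j. mem s' (start + i) = mem s (start + i)" using I by blast
      have jl: "j < ?l" using j(4,5) lt by simp
      let ?x = "mem s (start + j)"
      have mx: "mem s' (start + j) = ?x" using j(8) by simp
      let ?s2 = "s'\<lparr>mem := (mem s')(Suc j := ?x), reg := (reg s')(rX := ?x, rP := Suc (start + j), rT := Suc (Suc j))\<rparr>"
      have "mem ?s2 (start + i) = mem s (start + i)" if "i \<ge> Suc j" for i using j(8) that pos by auto
      then have I2: "?I (m - 1) ?s2" using j jl by (intro exI[of _ "Suc j"]) (auto simp: less_Suc_eq)
      have lm: "m - 1 < m" using j(1) jl by simp
      have "\<exists>l<m. ?I l ?s2" using lm I2 by blast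
      moreover have "Suc (start + j) \<le> M" "Suc (Suc j) \<le> M" using jl bM by auto
      ultimately show ?thesis using j(3,5,6) mx by (intro wp_vc) (simp del: ex_simps)
    qed
    show "?l * (4 + 2) + 1 \<le> 12 * (n * n) + 1" using s(6) by simp
  qed
  let ?rest = "Bas (Sub rT rT rI) ;; Bas (Const rD 2) ;; Bas (Div rT rT rD) ;; Bas (Store rZ rT)"
  let ?s1 = "s\<lparr>reg := (reg s)(rT := 1, rP := start)\<rparr>"
  have "wp M (WhileGt rQ rP ?b) ?s1 (\<lambda>t s2. vc M ?rest s2 (\<lambda>u. P (1 + (1 + (t + u)))))"
  proof (rule loop)
    show "?I ?l ?s1" using s by (intro exI[of _ 0]) auto
    fix t :: nat and s2 :: machine_state
    assume t: "t \<le> 12 * (n * n) + 1" and s2: "reg s2 rZ = 0" "reg s2 rI = 1" "reg s2 rT = Suc ?l"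
      "\<forall>i<?l. mem s2 (Suc i) = mem s (start + i)"
    let ?s3 = "s2\<lparr>reg := (reg s2)(rD := 2, rT := length al), mem := (mem s2)(0 := length al)\<rparr>"
    have "output_arcs ?s3 = set al"
    proof -
      have "mem ?s3 (2 * i + 1) = fst (al ! i)" "mem ?s3 (2 * i + 2) = snd (al ! i)" if "i < length al" for i
      proof -
        have "mem s2 (Suc (2 * i)) = mem s (start + 2 * i)" "mem s2 (Suc (2 * i + 1)) = mem s (start + (2 * i + 1))"
          using s2(4) that by auto
        then show "mem ?s3 (2 * i + 1) = fst (al ! i)" "mem ?s3 (2 * i + 2) = snd (al ! i)"
          using s(5) that by (auto simp: stored_def)
      qed
      then have pair: "(mem ?s3 (2 * i + 1), mem ?s3 (2 * i + 2)) = al ! i" if "i < length al" for i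
        using that by (metis prod.collapse)
      have m0: "mem ?s3 0 = length al" by simp
      have "output_arcs ?s3 = (\<lambda>i. (mem ?s3 (2 * i + 1), mem ?s3 (2 * i + 2))) ` {..<length al}"
        unfolding output_arcs_def m0 by blast
      also have "\<dots> = (!) al ` {..<length al}" by (rule image_cong[OF refl], rule pair) simp
      also have "\<dots> = set al" by (auto simp: set_conv_nth)
      finally show ?thesis .
    qed
    then have "P (1 + (1 + (t + (1 + (1 + (1 + 1)))))) ?s3" using t by (intro P) (simp_all add: copyT_def)
    then show "vc M ?rest s2 (\<lambda>u. P (1 + (1 + (t + u))))" using bM s2 by simp
  qed
  then show ?thesis unfolding copy_c_def using bM s by (intro wp_vc) simp
qed

definition totalT :: nat where "totalT = (4 * n + 9) + setupT + bfsT + collectT + copyT"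

lemma wp_prog:
  "wp M (prog k) (initial_state L) (\<lambda>t s. t \<le> totalT \<and> optimal_polytree {..<n} F f (output_arcs s))"
proof -
  show ?thesis
    unfolding prog_def
  proof (rule wp_Seq, rule wp_Call, rule wp_init, rule wp_Seq, rule wp_Call, rule wp_setup, assumption,
      rule wp_Seq, rule wp_Call, rule wp_bfs, assumption, rule wp_Seq, rule wp_Call, rule wp_collect,
      assumption, rule wp_Call)
    fix t1 t2 t3 t4 :: nat and s4 :: machine_state and al
    assume t: "t1 \<le> 4 * n + 9" "t2 \<le> setupT" "t3 \<le> bfsT" "t4 \<le> collectT"
      and o: "optimal_polytree {..<n} F f (set al)" and s4: "length al \<le> n * n"
      "reg s4 rZ = 0" "reg s4 rI = 1" "reg s4 rA = start" "reg s4 rQ = start + 2 * length al" "stored (mem s4) al"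
    show "wp M copy_c s4 (\<lambda>u s. t1 + (t2 + (t3 + (t4 + u))) \<le> totalT \<and> optimal_polytree {..<n} F f (output_arcs s))"
      by (rule wp_copy[OF s4(2-6) s4(1)]) (use t o in \<open>auto simp: totalT_def\<close>)
  qed
qed

text \<open>The input consists of \<open>n\<close>, entry counts, which are at most
  \<open>base\<close>, and set sizes and vertices, which are at most \<open>n\<close>.\<close>

lemma bounded_initial: "bounded M (initial_state L)"
proof -
  have "x \<le> M" if "x \<in> set inp" for x
  proof -
    have n: "n \<le> M" using n4 by (simp add: M_def)
    have bM: "base \<le> M" by (simp add: M_def)
    from that consider "x = n" | es where "es \<in> set L" "x \<in> set (encv es)" by (auto simp: inp_eq)
    then show ?thesis
    proof cases
      case 2
      then obtain v where v: "v < n" "es = L ! v" using lenL by (auto simp: in_set_conv_nth)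
      from 2(2) consider "x = length es" | xs r where "(xs, r) \<in> set es" "x \<in> set (length xs # xs)"
        by (auto simp: encv_def ence_def)
      then show ?thesis
      proof cases
        case 1
        have "length (encv es) \<le> length (concat (map encv L))"
          using 2(1) by (auto simp: length_concat intro!: member_le_sum_list)
        then have "length es \<le> base" using length_encv[of es] by (simp add: base_def inp_eq encv_def)
        then show ?thesis using 1 bM by simp
      next
        case 2
        have "set xs \<subseteq> {..<n}" "distinct xs"
          using list_entry[OF v(1), of xs r] F_sub[OF v(1), of "set xs"] 2(1) v(2) by auto
        moreover from this have "length xs \<le> n" using distinct_card[of xs] card_mono[of "{..<n}" "set xs"] by simp
        ultimately show ?thesis using 2(2) n by auto
      qed
    qed (use n in simp)
  qed
  then show ?thesis by (auto simp: bounded_def initial_mem) (auto simp: initial_state_def base_def)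
qed

end

section \<open>Running time\<close>

context listed_problem
begin

abbreviation z :: nat where "z \<equiv> input_size L"

lemma base_le: "base \<le> z"
proof -
  have "length xs \<le> sum_list (map bit_length xs)" for xs
  proof (induction xs)
    case (Cons a xs)
    then show ?case using bit_length_pos[of a] by simp
  qed simp
  then show ?thesis by (simp add: base_def inp_def input_size_def trans_le_add1)
qed

lemma n_less_base: "n < base"
proof -
  have "length es \<le> length (concat (map encv es))" for es by (induction es) (auto simp: encv_def)
  from this[of L] show ?thesis using lenL by (simp add: base_def inp_eq)
qed

lemma z_bounds: "1 \<le> z" "n \<le> z" "Suc n \<le> z"
  using base_le n_less_base by simp_all

text \<open>\<open>NS\<close> multiplies the time of one expansion. There \<open>n * base\<close> is
  a crude bound on the entries visited, and each of them takes \<open>Suc n\<close> trials of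
  quadratic time, in all of order \<open>z ^ 5\<close>.\<close>

lemma totalT_le: "totalT \<le> (NS + 1) * (500 * z ^ 5)"
proof -
  note nz = z_bounds(2) and z1 = z_bounds(1)
  have mono: "z ^ i \<le> z ^ j" if "i \<le> j" for i j using that z1 by (rule power_increasing)
  have z2: "1 \<le> z ^ 2" "z \<le> z ^ 2" using mono[of 0 2] mono[of 1 2] by auto
  have z3: "1 \<le> z ^ 3" "z ^ 2 \<le> z ^ 3" "z \<le> z ^ 3" using mono[of 0 3] mono[of 2 3] mono[of 1 3] by auto
  have z5: "1 \<le> z ^ 5" "z ^ 2 \<le> z ^ 5" "z \<le> z ^ 5" using mono[of 0 5] mono[of 2 5] mono[of 1 5] by auto
  have nn: "n * n \<le> z ^ 2" using mult_le_mono[OF nz nz] by (simp add: power2_eq_square)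
  have nb: "n * base \<le> z ^ 2" using mult_le_mono[OF nz base_le] by (simp add: power2_eq_square)
  have b: "bodyT \<le> 140 * z ^ 2"
    using nn nz z2 by (simp add: bodyT_def algebra_simps)
  have e: "entryT \<le> 288 * z ^ 3"
  proof -
    have "Suc n * (bodyT + 3) \<le> z * (143 * z ^ 2)"
      using z_bounds(3) b z2 by (intro mult_le_mono) auto
    also have "\<dots> = 143 * z ^ 3" by (simp add: power3_eq_cube power2_eq_square)
    finally show ?thesis using z3 by (simp add: entryT_def)
  qed
  have tr: "travT T = n * base * (T + 7) + 6 * n + 4" for T by (simp add: travT_def algebra_simps)
  have t1: "travT entryT \<le> 305 * z ^ 5"
  proof -
    have "n * base * (entryT + 7) \<le> z ^ 2 * (295 * z ^ 3)" using nb e z3 by (intro mult_le_mono) auto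
    also have "\<dots> = 295 * z ^ 5" by (simp add: power_add[symmetric])
    finally show ?thesis using nz z5 by (simp add: tr)
  qed
  have t0: "travT 0 \<le> 17 * z ^ 2" using nb nz z2 by (simp add: tr)
  have "bfsT \<le> NS * (313 * z ^ 5) + z ^ 5"
  proof -
    have "NS * (travT entryT + 8) \<le> NS * (313 * z ^ 5)" using t1 z5 by (intro mult_le_mono2) auto
    then show ?thesis unfolding bfsT_def using z5(1) by linarith
  qed
  moreover have "setupT \<le> 30 * z ^ 5" using t0 nz z2 z5 by (simp add: setupT_def)
  moreover have "collectT \<le> 26 * z ^ 5" using nn nz z2 z5 by (simp add: collectT_def algebra_simps)
  moreover have "copyT \<le> 22 * z ^ 5" using nn z5 by (simp add: copyT_def)
  moreover have "4 * n + 9 \<le> 13 * z ^ 5" using nz z5 by simp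
  ultimately have "totalT \<le> NS * (313 * z ^ 5) + 92 * z ^ 5" by (simp add: totalT_def)
  also have "\<dots> \<le> NS * (500 * z ^ 5) + 500 * z ^ 5" by (intro add_mono mult_le_mono) auto
  finally show ?thesis by simp
qed

text \<open>\<open>M\<close> is at most exponential in the input size, so the logarithmic cost of
  using codes as addresses is a linear factor.\<close>

lemma bit_length_M: "bit_length M \<le> (38 + 2 * k) * z"
proof -
  have p: "1 \<le> (4::nat) ^ z" "z \<le> 4 ^ z" by (auto intro: less_imp_le power_gt_expt)
  have pn: "(4::nat) ^ n \<le> 4 ^ z" using z_bounds(2) by (intro power_increasing) auto
  have "Suc k * Suc n \<le> Suc k * 4 ^ z" using z_bounds(3) p(2) by (intro mult_le_mono2) linarith
  moreover have "Suc k * 4 ^ z = 4 ^ z + k * 4 ^ z" by simp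
  moreover have eq: "4 ^ z * (35 + 2 * k) = 35 * 4 ^ z + 2 * (k * 4 ^ z)" by (simp add: algebra_simps)
  ultimately have "M \<le> 4 ^ z * (35 + 2 * k)" unfolding M_def eq using base_le p pn by linarith
  also have "\<dots> \<le> 4 ^ z * 2 ^ (35 + 2 * k)" by (intro mult_le_mono2 less_imp_le less_exp)
  also have "\<dots> = (2::nat) ^ (2 * z + (35 + 2 * k))" by (simp add: power_add power_mult)
  finally have "bit_length M \<le> bit_length (2 ^ (2 * z + (35 + 2 * k)))" by (rule bit_length_mono)
  also have "\<dots> = 2 * z + (36 + 2 * k)" unfolding bit_length_def floor_log_power by simp
  also have "\<dots> \<le> 2 * z + (36 + 2 * k) * z"
    using z_bounds(1) by (intro add_left_mono) (metis mult.right_neutral mult_le_mono2)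
  finally show ?thesis by (simp add: algebra_simps)
qed

text \<open>\<open>card_narrow_codes\<close> with \<open>N = 2 ^ a\<close>. For a power of two and
  logarithmic \<open>W\<close>, the factor \<open>N ^ W\<close> becomes
  \<open>(2 * 2 ^ floor_log n) ^ (a * Suc k)\<close>, which is polynomial in
  \<open>n\<close>.\<close>

lemma NS_le:
  fixes \<epsilon> :: real and a :: nat
  assumes "\<epsilon> > 0" "2 / 2 ^ a \<le> \<epsilon>"
  shows "real NS \<le> (2 * real z) ^ (a * Suc k) * (2 + \<epsilon>) ^ n"
proof -
  have "real NS \<le> (2 ^ a) ^ W * (2 + 2 / 2 ^ a) ^ n"
    unfolding NS_def by (rule card_narrow_codes) simp
  also have "\<dots> \<le> (2 * real z) ^ (a * Suc k) * (2 + \<epsilon>) ^ n"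
  proof (rule mult_mono)
    show "(2 + 2 / 2 ^ a) ^ n \<le> (2 + \<epsilon>) ^ n" using assms(2) by (intro power_mono) auto
    show "((2::real) ^ a) ^ W \<le> (2 * real z) ^ (a * Suc k)"
    proof (cases "n = 0")
      case True
      then have "W = 0" unfolding W_def by (simp add: width_def)
      moreover have "1 \<le> (2 * real z) ^ (a * Suc k)" using z_bounds(1) by (intro one_le_power) simp
      ultimately show ?thesis by simp
    next
      case False
      have "((2::real) ^ a) ^ W = (2 * 2 ^ floor_log n) ^ (a * Suc k)"
        using False by (simp add: W_def width_def power_mult[symmetric] power_Suc[symmetric] algebra_simps
            del: power_Suc)
      also have "\<dots> \<le> (2 * real z) ^ (a * Suc k)"
      proof (rule power_mono)
        have "2 ^ floor_log n \<le> z" using floor_log_exp2_le[of n] False z_bounds(2) by linarith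
        then show "2 * 2 ^ floor_log n \<le> 2 * real z" by (simp flip: of_nat_le_iff)
      qed simp
      finally show ?thesis .
    qed
  qed (use assms in auto)
  finally show ?thesis .
qed

end

theorem theorem3p3:
  fixes k :: nat and \<epsilon> :: real
  assumes "\<epsilon> > 0"
  shows "\<exists>(P :: instr list) (C :: nat) (c :: nat).
           \<forall>(n :: nat) (F :: nat \<Rightarrow> nat set set) (f :: nat \<Rightarrow> nat set \<Rightarrow> real) (L :: listing).
             polytree_instance {..<n} F f \<longrightarrow>
             indegree_bounded k {..<n} F \<longrightarrow>
             lists_instance L n F f \<longrightarrow>
             (\<exists>t s. run P (initial_state L) t s \<and>
                    optimal_polytree {..<n} F f (output_arcs s) \<and>
                    real t \<le> real C * (2 + \<epsilon>) ^ n * real (input_size L) ^ c)"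
proof -
  obtain a :: nat where "2 / \<epsilon> < 2 ^ a" using real_arch_pow[of 2 "2 / \<epsilon>"] by auto
  then have a: "2 / 2 ^ a \<le> \<epsilon>" using assms by (simp add: field_simps)
  \<comment> \<open>\<open>e\<close> is the degree of the factor \<open>N ^ W\<close>.
    \<open>D\<close> combines 500 from the instruction count with \<open>2 * (38 + 2 * k)\<close>
    from the cost of a single instruction.\<close>
  define e where "e = a * Suc k"
  define D where "D = 1000 * (38 + 2 * k)"
  show ?thesis
  \<comment> \<open>The exponent adds 5 for the number of instructions and 1 for the bit lengths. In
    the constant, \<open>2 ^ e\<close> comes from \<open>(2 * z) ^ e\<close>, and the other factor 2
    absorbs the summand 1 in \<open>NS + 1\<close>.\<close>
  proof (rule exI[of _ "compile 0 (prog k)"], rule exI[of _ "2 * 2 ^ e * D"], rule exI[of _ "e + 6"],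
      intro allI impI)
    fix n F f L
    assume "polytree_instance {..<n} F f" "indegree_bounded k {..<n} F" "lists_instance L n F f"
    then interpret listed_problem n k F f L by unfold_locales
    obtain t T s where run: "run (compile 0 (prog k)) (initial_state L) t (s\<lparr>pc := csize (prog k)\<rparr>)"
      and t: "t \<le> T * (2 * bit_length M)" "T \<le> totalT" and opt: "optimal_polytree {..<n} F f (output_arcs s)"
      using wp_run[OF wp_prog bounded_initial] by (auto simp: initial_state_def)
    have "t \<le> (NS + 1) * (500 * z ^ 5) * (2 * ((38 + 2 * k) * z))"
      using t totalT_le bit_length_M by (meson le_trans mult_le_mono mult_le_mono2)
    also have "\<dots> = (NS + 1) * (D * (z ^ 5 * z))" by (simp add: D_def algebra_simps)
    also have "z ^ 5 * z = z ^ 6" by (simp flip: power_Suc2)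
    finally have "real t \<le> real ((NS + 1) * (D * z ^ 6))" by (rule of_nat_mono)
    also have "\<dots> = (real NS + 1) * (real D * real z ^ 6)" by (simp add: algebra_simps)
    also have "\<dots> \<le> (2 * ((2 * real z) ^ e * (2 + \<epsilon>) ^ n)) * (real D * real z ^ 6)"
    proof (rule mult_right_mono)
      have "1 \<le> (2 * real z) ^ e * (2 + \<epsilon>) ^ n"
        using z_bounds(1) assms by (intro mult_ge1_I one_le_power) auto
      then show "real NS + 1 \<le> 2 * ((2 * real z) ^ e * (2 + \<epsilon>) ^ n)"
        using NS_le[OF assms a] by (simp add: e_def)
    qed simp
    also have "\<dots> = real (2 * 2 ^ e * D) * (2 + \<epsilon>) ^ n * real z ^ (e + 6)"
      by (simp add: power_mult_distrib power_add)
    finally have "real t \<le> real (2 * 2 ^ e * D) * (2 + \<epsilon>) ^ n * real z ^ (e + 6)" .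
    moreover have "output_arcs (s\<lparr>pc := csize (prog k)\<rparr>) = output_arcs s" by (simp add: output_arcs_def)
    ultimately show "\<exists>t s. run (compile 0 (prog k)) (initial_state L) t s \<and>
        optimal_polytree {..<n} F f (output_arcs s) \<and>
        real t \<le> real (2 * 2 ^ e * D) * (2 + \<epsilon>) ^ n * real (input_size L) ^ (e + 6)"
      using run opt by metis
  qed
qed

end
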